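(* Let $S$ be a smooth oriented closed surface of genus $g\ge 2$ equipped with a higher complex structure $I$ of order $n$, and let $\Sigma$, $V$, $L$, $\Phi$ be the induced Riemann surface, vector bundle, line subbundle and field. Let $$C(\lambda)=\lambda\Phi+d_A+\lambda^{-1}\Psi,\qquad \lambda\in\mathbb{C}^*,$$ where $d_A$ is an $\mathfrak{sl}_n(\mathbb{C})$-connection on $V$ satisfying $d_A(\Phi)=0$ and $\Psi\in\Omega^1(S,\mathfrak{sl}(V))$. Let $(\mu_k,t_k)_{2\le k\le n}$ be the tensors given by the highest order terms, in the Taylor expansion for $\lambda\to\infty$, of the parameters $(\hat\mu_k(\lambda),\hat t_k(\lambda))_{2\le k\le n}$ of $C(\lambda)$. If $C(\lambda)$ is flat for all $\lambda\in\mathbb{C}^*$, then the covector $(t_2,\dots,t_n)$ is $\mu$-holomorphic, i.e. for all $k=2,\dots,n$ $$(-\bar\partial+\mu_2\partial+k\,\partial\mu_2)t_k+\sum_{\ell=1}^{n-k}\big((\ell+k)\,\partial\mu_{\ell+2}+(\ell+1)\mu_{\ell+2}\,\partial\big)t_{k+\ell}=0 .$$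
   Context: Higher complex structures. $\mathrm{Hilb}^n_0(\mathbb{C}^2)$ is the set of ideals of $\mathbb{C}[x,y]$ of codimension $n$ whose support is the origin. A higher complex structure of order $n$ on $S$ is a section $I$ of the bundle with fibers $\mathrm{Hilb}^n_0(T_z^{*\mathbb{C}}S)$ such that at each point $I(z)+\bar I(z)=\langle p,\bar p\rangle$, where $(p,\bar p)$ are the linear fiber coordinates on $T^{*\mathbb{C}}S$ associated with a local complex coordinate $z$. Locally $$I=\langle p^n,\,-\bar p+\mu_2p+\mu_3p^2+\dots+\mu_np^{n-1}\rangle ,$$ and $\mu_k\in\Gamma(K^{1-k}\otimes\bar K)$ are the higher Beltrami differentials. $\mu_2$ is the Beltrami differential of a complex structure on $S$, called the induced complex structure; $\Sigma$ denotes the resulting Riemann surface, $K$ its canonical bundle, $(z,\bar z)$ its local coordinates (characterized by $\mu_2=0$; $\mu_2$ is nevertheless kept in formulas). $\partial=\partial/\partial z$, $\bar\partial=\partial/\partial\bar z$. Induced bundle. Fix a square root $K^{1/2}$. Let $V'$ be the rank-$n$ bundle with fiber $\mathbb{C}[p,\bar p]/I(z)$, $L'\subset V'$ the line subbundle spanned by the images of constants, $V=V'\otimes K^{(n-1)/2}$ and $L=L'\otimes K^{(n-1)/2}\cong K^{(n-1)/2}$; $V$ is equipped with a volume form. The field $\Phi\in\Omega^1(S,\mathfrak{sl}(V))$ is locally $\Phi=\Phi_1dz+\Phi_2d\bar z$ with $\Phi_1,\Phi_2$ acting by multiplication by $p,\bar p$. In a local frame $(\sigma,\Phi_1\sigma,\dots,\Phi_1^{n-1}\sigma)$,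 $\sigma$ a nowhere vanishing local section of $L$, $\Phi_1=\sum_iE_{i+1,i}$ and $\Phi_2=\sum_{k=2}^n\mu_k\Phi_1^{k-1}$. Parameters. Locally write $d_A=d+A_1dz+A_2d\bar z$, $\Psi=\Psi_1dz+\Psi_2d\bar z$, $\nabla=\partial+\lambda\Phi_1+A_1+\lambda^{-1}\Psi_1$, $\bar\nabla=\bar\partial+\lambda\Phi_2+A_2+\lambda^{-1}\Psi_2$. For large $\lambda$ there is a local section $s$ of $L$ (depending on $\lambda$), unique up to an $n$-th root of unity, such that $(s,\nabla s,\dots,\nabla^{n-1}s)$ is a unit-volume local basis of $V$. The functions $\hat\mu_k(\lambda),\hat t_k(\lambda)$ are defined by $$\nabla^ns=\hat t_n(\lambda)s+\hat t_{n-1}(\lambda)\nabla s+\dots+\hat t_2(\lambda)\nabla^{n-2}s,\qquad \bar\nabla s=\hat\mu_1(\lambda)s+\hat\mu_2(\lambda)\nabla s+\dots+\hat\mu_n(\lambda)\nabla^{n-1}s .$$ They are rational in $\lambda$ and for $\lambda\to\infty$ satisfy $\hat\mu_k(\lambda)=\lambda^{2-k}\mu_k+O(\lambda^{1-k})$ (with $\mu_k$ the higher Beltrami differentials of $I$) and $\hat t_k(\lambda)=\lambda^{k-1}t_k+O(\lambda^{k-2})$; this defines $t_k\in\Gamma(K^k)$. *)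

theory Defs
  imports
    "HOL-Complex_Analysis.Complex_Analysis"
    "HOL-Homology.Homology"
    "HOL-Library.Landau_Symbols"
    "Jordan_Normal_Form.Determinant"
begin

section \<open>Smooth functions on open subsets of the plane\<close>

definition d_x :: "(complex \<Rightarrow> complex) \<Rightarrow> complex \<Rightarrow> complex" where
  "d_x f z = frechet_derivative f (at z) 1"

definition d_y :: "(complex \<Rightarrow> complex) \<Rightarrow> complex \<Rightarrow> complex" where
  "d_y f z = frechet_derivative f (at z) \<i>"

definition d_z :: "(complex \<Rightarrow> complex) \<Rightarrow> complex \<Rightarrow> complex" where
  "d_z f z = (d_x f z - \<i> * d_y f z) / 2"

definition d_zbar :: "(complex \<Rightarrow> complex) \<Rightarrow> complex \<Rightarrow> complex" where
  "d_zbar f z = (d_x f z + \<i> * d_y f z) / 2"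

primrec Ck_on :: "nat \<Rightarrow> complex set \<Rightarrow> (complex \<Rightarrow> complex) \<Rightarrow> bool" where
  "Ck_on 0 D f \<longleftrightarrow> continuous_on D f"
| "Ck_on (Suc k) D f \<longleftrightarrow> (\<forall>z\<in>D. f differentiable (at z)) \<and> Ck_on k D (d_x f) \<and> Ck_on k D (d_y f)"

definition smooth_on :: "complex set \<Rightarrow> (complex \<Rightarrow> complex) \<Rightarrow> bool" where
  "smooth_on D f \<longleftrightarrow> (\<forall>k. Ck_on k D f)"

text \<open>Derivatives of vector and matrix valued functions are taken entrywise.\<close>

definition vec_deriv ::
  "nat \<Rightarrow> ((complex \<Rightarrow> complex) \<Rightarrow> complex \<Rightarrow> complex) \<Rightarrow> (complex \<Rightarrow> complex vec) \<Rightarrow> complex \<Rightarrow> complex vec" where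
  "vec_deriv n D s z = Matrix.vec n (\<lambda>i. D (\<lambda>w. vec_index (s w) i) z)"

definition mat_deriv ::
  "nat \<Rightarrow> ((complex \<Rightarrow> complex) \<Rightarrow> complex \<Rightarrow> complex) \<Rightarrow> (complex \<Rightarrow> complex mat) \<Rightarrow> complex \<Rightarrow> complex mat" where
  "mat_deriv n D M z = Matrix.mat n n (\<lambda>(i, j). D (\<lambda>w. M w $$ (i, j)) z)"

definition smooth_mat_on :: "nat \<Rightarrow> complex set \<Rightarrow> (complex \<Rightarrow> complex mat) \<Rightarrow> bool" where
  "smooth_mat_on n D M \<longleftrightarrow> (\<forall>z\<in>D. M z \<in> carrier_mat n n) \<and>
     (\<forall>i<n. \<forall>j<n. smooth_on D (\<lambda>z. M z $$ (i, j)))"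

definition mat_trace :: "complex mat \<Rightarrow> complex" where
  "mat_trace M = (\<Sum>i<dim_row M. M $$ (i, i))"


section \<open>Oriented surfaces\<close>

text \<open>A chart is a domain together with a map to the plane; the values of the map outside the
  domain are irrelevant. Everything local is written as a function of the coordinate, i.e. on the
  image of the chart.\<close>

type_synonym 'a chart = "'a set \<times> ('a \<Rightarrow> complex)"

definition img :: "'a chart \<Rightarrow> complex set" where
  "img c = snd c ` fst c"

definition overlap :: "'a chart \<Rightarrow> 'a chart \<Rightarrow> complex set" where
  "overlap c d = snd c ` (fst c \<inter> fst d)"

definition transition :: "'a chart \<Rightarrow> 'a chart \<Rightarrow> complex \<Rightarrow> complex" where
  "transition c d z = snd d (inv_into (fst c) (snd c) z)"

definition is_chart :: "'a topology \<Rightarrow> 'a chart \<Rightarrow> bool" where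
  "is_chart X c \<longleftrightarrow> openin X (fst c) \<and> open (img c) \<and>
     homeomorphic_map (subtopology X (fst c)) (top_of_set (img c)) (snd c)"

definition oriented_compatible :: "'a chart \<Rightarrow> 'a chart \<Rightarrow> bool" where
  "oriented_compatible c d \<longleftrightarrow> smooth_on (overlap c d) (transition c d) \<and>
     (\<forall>z\<in>overlap c d. (cmod (d_zbar (transition c d) z))\<^sup>2 < (cmod (d_z (transition c d) z))\<^sup>2)"

definition oriented_atlas :: "'a topology \<Rightarrow> 'a chart set \<Rightarrow> bool" where
  "oriented_atlas X \<A> \<longleftrightarrow> (\<forall>c\<in>\<A>. is_chart X c) \<and> (\<Union>c\<in>\<A>. fst c) = topspace X \<and>
     (\<forall>c\<in>\<A>. \<forall>d\<in>\<A>. oriented_compatible c d)"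

definition oriented_charts :: "'a topology \<Rightarrow> 'a chart set \<Rightarrow> 'a chart set" where
  "oriented_charts X \<A> =
     {c. is_chart X c \<and> (\<forall>d\<in>\<A>. oriented_compatible c d \<and> oriented_compatible d c)}"

text \<open>A compact connected surface; second countability is automatic by compactness. For a closed
  oriented surface the genus is half the rank of the (free) first integral homology group.\<close>

definition closed_oriented_surface :: "'a topology \<Rightarrow> 'a chart set \<Rightarrow> bool" where
  "closed_oriented_surface X \<A> \<longleftrightarrow> Hausdorff_space X \<and> compact_space X \<and> connected_space X \<and>
     topspace X \<noteq> {} \<and> oriented_atlas X \<A>"

definition has_genus :: "'a topology \<Rightarrow> nat \<Rightarrow> bool" where
  "has_genus X g \<longleftrightarrow> homology_group 1 X \<cong> free_Abelian_group {..<2 * g}"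


section \<open>Ideals of the polynomial ring in two variables\<close>

text \<open>The ring of polynomials in \<open>p\<close> and \<open>pbar\<close> is the type \<^typ>\<open>complex poly poly\<close>, with
  \<open>pbar\<close> as the outer variable: the coefficient of \<open>p ^ i * pbar ^ j\<close> in \<open>f\<close> is
  \<^term>\<open>poly.coeff (poly.coeff f j) i\<close>.\<close>

type_synonym cpoly2 = "complex poly poly"

definition con :: "complex \<Rightarrow> cpoly2" where "con a = [:[:a:]:]"
definition p_var :: cpoly2 where "p_var = [:[:0, 1:]:]"
definition pbar_var :: cpoly2 where "pbar_var = [:0, 1:]"

definition eval2 :: "cpoly2 \<Rightarrow> complex \<Rightarrow> complex \<Rightarrow> complex" where
  "eval2 f a b = poly (poly f [:b:]) a"

definition substitute :: "cpoly2 \<Rightarrow> cpoly2 \<Rightarrow> cpoly2 \<Rightarrow> cpoly2" where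
  "substitute P Q f = (\<Sum>j\<le>degree f. \<Sum>i\<le>degree (poly.coeff f j).
     con (poly.coeff (poly.coeff f j) i) * P ^ i * Q ^ j)"

definition conjugate2 :: "cpoly2 \<Rightarrow> cpoly2" where
  "conjugate2 f = (\<Sum>j\<le>degree f. \<Sum>i\<le>degree (poly.coeff f j).
     con (cnj (poly.coeff (poly.coeff f j) i)) * pbar_var ^ i * p_var ^ j)"

text \<open>Ideals of a commutative ring are its submodules over itself.\<close>

lemma module_times: "Modules.module ((*) :: 'a :: comm_ring_1 \<Rightarrow> 'a \<Rightarrow> 'a)"
  by unfold_locales (auto simp: algebra_simps)

abbreviation is_ideal :: "cpoly2 set \<Rightarrow> bool" where
  "is_ideal \<equiv> Modules.module.subspace (*)"

abbreviation ideal_generated :: "cpoly2 set \<Rightarrow> cpoly2 set" where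
  "ideal_generated \<equiv> Modules.module.span (*)"

text \<open>Codimension \<open>n\<close>: the quotient has a basis with \<open>n\<close> elements.\<close>

definition codimension :: "cpoly2 set \<Rightarrow> nat \<Rightarrow> bool" where
  "codimension J n \<longleftrightarrow> (\<exists>b :: nat \<Rightarrow> cpoly2. \<forall>f.
     \<exists>!v. v \<in> carrier_vec n \<and> f - (\<Sum>i<n. con (vec_index v i) * b i) \<in> J)"

definition support :: "cpoly2 set \<Rightarrow> (complex \<times> complex) set" where
  "support J = {(a, b). \<forall>f\<in>J. eval2 f a b = 0}"

definition Hilb0 :: "nat \<Rightarrow> cpoly2 set set" where
  "Hilb0 n = {J. is_ideal J \<and> codimension J n \<and> support J = {(0, 0)}}"


section \<open>Higher complex structures\<close>

text \<open>The expression of polynomial functions on the complexified cotangent space under a change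
  of coordinates \<open>w = \<tau> z\<close>: as functions on covectors, \<open>p\<close> and \<open>pbar\<close> are evaluation on the
  coordinate vector fields, so the chain rule expresses those of \<open>z\<close> through those of \<open>w\<close>.\<close>

definition cotangent_change :: "(complex \<Rightarrow> complex) \<Rightarrow> complex \<Rightarrow> cpoly2 \<Rightarrow> cpoly2" where
  "cotangent_change \<tau> z = substitute
     (con (d_z \<tau> z) * p_var + con (cnj (d_zbar \<tau> z)) * pbar_var)
     (con (d_zbar \<tau> z) * p_var + con (cnj (d_z \<tau> z)) * pbar_var)"

definition normal_form :: "nat \<Rightarrow> (nat \<Rightarrow> complex) \<Rightarrow> cpoly2 set" where
  "normal_form n m =
     ideal_generated {p_var ^ n, - pbar_var + (\<Sum>k = 2..n. con (m k) * p_var ^ (k - 1))}"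

text \<open>The higher Beltrami differentials as functions of the ideal, extended by zero to
  indices outside \<open>{2..n}\<close> to make the \<open>THE\<close> unique.\<close>

definition beltrami :: "nat \<Rightarrow> cpoly2 set \<Rightarrow> nat \<Rightarrow> complex" where
  "beltrami n J = (THE m. (\<forall>k. k \<notin> {2..n} \<longrightarrow> m k = 0) \<and> J = normal_form n m)"

text \<open>\<open>I c z\<close> is the ideal at the point with coordinate \<open>z\<close>, written in the fibre coordinates of
  the chart \<open>c\<close>. The \<open>\<mu>\<^sub>k\<close> are the coordinates on the open set of ideals of the form
  \<^const>\<open>normal_form\<close>, so a section with values there is smooth iff they are smooth. That the ideal
  has this form in every positively oriented coordinate says that the induced complex structure
  is compatible with the orientation.\<close>

definition higher_complex_structure ::
  "'a topology \<Rightarrow> 'a chart set \<Rightarrow> nat \<Rightarrow> ('a chart \<Rightarrow> complex \<Rightarrow> cpoly2 set) \<Rightarrow> bool" where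
  "higher_complex_structure X \<A> n I \<longleftrightarrow>
     (\<forall>c\<in>oriented_charts X \<A>.
        (\<forall>z\<in>img c. I c z \<in> Hilb0 n \<and>
           {f + conjugate2 g | f g. f \<in> I c z \<and> g \<in> I c z} = ideal_generated {p_var, pbar_var}) \<and>
        (\<exists>m. (\<forall>k\<in>{2..n}. smooth_on (img c) (m k)) \<and>
           (\<forall>z\<in>img c. I c z = normal_form n (\<lambda>k. m k z)))) \<and>
     (\<forall>c\<in>oriented_charts X \<A>. \<forall>d\<in>oriented_charts X \<A>. \<forall>z\<in>overlap c d.
        I d (transition c d z) = cotangent_change (transition c d) z ` I c z)"

text \<open>The holomorphic charts of the induced Riemann surface.\<close>

definition induced_charts ::
  "'a topology \<Rightarrow> 'a chart set \<Rightarrow> nat \<Rightarrow> ('a chart \<Rightarrow> complex \<Rightarrow> cpoly2 set) \<Rightarrow> 'a chart set" where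
  "induced_charts X \<A> n I = {c \<in> oriented_charts X \<A>. \<forall>z\<in>img c. beltrami n (I c z) 2 = 0}"

text \<open>A square root of the canonical bundle need not be trivial over a chart whose domain is not
  simply connected: on a closed surface of positive genus there are always essential annuli where
  \<open>dz\<close> has no square root in it. Hence the bundle is only trivialised over simply connected
  charts, which still contain a neighbourhood of every point.\<close>

definition bundle_charts ::
  "'a topology \<Rightarrow> 'a chart set \<Rightarrow> nat \<Rightarrow> ('a chart \<Rightarrow> complex \<Rightarrow> cpoly2 set) \<Rightarrow> 'a chart set" where
  "bundle_charts X \<A> n I = {c \<in> induced_charts X \<A> n I. simply_connected (img c)}"


section \<open>The induced bundle and its field\<close>

text \<open>A square root of the canonical bundle, given by its transition functions: on each chart in
  \<open>\<C>\<close> there is a section \<open>\<nu>\<^sub>c\<close> with \<open>\<nu>\<^sub>c\<^sup>2 = dz\<^sub>c\<close>, and \<open>\<nu>\<^sub>c = \<kappa> c d \<cdot> \<nu>\<^sub>d\<close> on overlaps.\<close>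

definition sqrt_canonical ::
  "'a chart set \<Rightarrow> ('a chart \<Rightarrow> 'a chart \<Rightarrow> complex \<Rightarrow> complex) \<Rightarrow> bool" where
  "sqrt_canonical \<C> \<kappa> \<longleftrightarrow>
     (\<forall>c\<in>\<C>. \<forall>d\<in>\<C>. \<kappa> c d holomorphic_on overlap c d \<and>
        (\<forall>z\<in>overlap c d. (\<kappa> c d z)\<^sup>2 * d_z (transition c d) z = 1)) \<and>
     (\<forall>c\<in>\<C>. \<forall>d\<in>\<C>. \<forall>e\<in>\<C>. \<forall>z\<in>overlap c d \<inter> overlap c e.
        \<kappa> c d z * \<kappa> d e (transition c d z) = \<kappa> c e z)"

text \<open>Coordinates in the quotient by \<open>J\<close> with respect to the classes of \<open>1, p, \<dots>, p ^ (n - 1)\<close>.\<close>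

definition coords :: "nat \<Rightarrow> cpoly2 set \<Rightarrow> cpoly2 \<Rightarrow> complex vec" where
  "coords n J f = (THE v. v \<in> carrier_vec n \<and> f - (\<Sum>i<n. con (vec_index v i) * p_var ^ i) \<in> J)"

definition mult_mat :: "nat \<Rightarrow> cpoly2 set \<Rightarrow> cpoly2 \<Rightarrow> complex mat" where
  "mult_mat n J f = Matrix.mat n n (\<lambda>(i, j). vec_index (coords n J (f * p_var ^ j)) i)"

text \<open>Over a chart \<open>c\<close>, the bundle \<open>V\<close> is trivialised by the frame \<open>p ^ k \<otimes> \<nu>\<^sub>c ^ (n - 1)\<close>,
  \<open>0 \<le> k < n\<close>. All vectors and matrices below are with respect to these frames;
  \<open>bundle_transition\<close> sends components over \<open>c\<close> to components over \<open>d\<close>. The line subbundle \<open>L\<close>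
  is spanned by \<open>unit_section\<close>.\<close>

definition bundle_transition ::
  "nat \<Rightarrow> ('a chart \<Rightarrow> complex \<Rightarrow> cpoly2 set) \<Rightarrow> ('a chart \<Rightarrow> 'a chart \<Rightarrow> complex \<Rightarrow> complex) \<Rightarrow>
   'a chart \<Rightarrow> 'a chart \<Rightarrow> complex \<Rightarrow> complex mat" where
  "bundle_transition n I \<kappa> c d z = \<kappa> c d z ^ (n - 1) \<cdot>\<^sub>m
     Matrix.mat n n (\<lambda>(i, j). vec_index
       (coords n (I d (transition c d z)) (cotangent_change (transition c d) z (p_var ^ j))) i)"

definition unit_section :: "nat \<Rightarrow> (complex \<Rightarrow> cpoly2 set) \<Rightarrow> complex \<Rightarrow> complex vec" where
  "unit_section n J z = coords n (J z) 1"

definition \<Phi>1 :: "nat \<Rightarrow> (complex \<Rightarrow> cpoly2 set) \<Rightarrow> complex \<Rightarrow> complex mat" where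
  "\<Phi>1 n J z = mult_mat n (J z) p_var"

definition \<Phi>2 :: "nat \<Rightarrow> (complex \<Rightarrow> cpoly2 set) \<Rightarrow> complex \<Rightarrow> complex mat" where
  "\<Phi>2 n J z = mult_mat n (J z) pbar_var"

text \<open>\<open>\<omega> c\<close> is the value of the volume form on the frame over \<open>c\<close>, and \<open>G\<close> stands for the
  transition functions of the bundle.\<close>

definition volume_form ::
  "'a chart set \<Rightarrow> ('a chart \<Rightarrow> 'a chart \<Rightarrow> complex \<Rightarrow> complex mat) \<Rightarrow>
   ('a chart \<Rightarrow> complex \<Rightarrow> complex) \<Rightarrow> bool" where
  "volume_form \<C> G \<omega> \<longleftrightarrow>
     (\<forall>c\<in>\<C>. smooth_on (img c) (\<omega> c) \<and> (\<forall>z\<in>img c. \<omega> c z \<noteq> 0)) \<and>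
     (\<forall>c\<in>\<C>. \<forall>d\<in>\<C>. \<forall>z\<in>overlap c d.
        \<omega> c z = \<omega> d (transition c d z) * Determinant.det (G c d z))"

text \<open>Connections \<open>d + A1 dz + A2 dzbar\<close> preserving the volume form. The last conjunct is the
  gauge transformation law for the components \<open>v\<^sub>d = G v\<^sub>c\<close>, the transition functions of the
  coordinate being holomorphic; the trace conditions say that the volume form is parallel (the
  traces vanish in a unimodular frame).\<close>

definition sl_connection ::
  "nat \<Rightarrow> 'a chart set \<Rightarrow> ('a chart \<Rightarrow> 'a chart \<Rightarrow> complex \<Rightarrow> complex mat) \<Rightarrow>
   ('a chart \<Rightarrow> complex \<Rightarrow> complex) \<Rightarrow>
   ('a chart \<Rightarrow> complex \<Rightarrow> complex mat) \<Rightarrow> ('a chart \<Rightarrow> complex \<Rightarrow> complex mat) \<Rightarrow> bool" where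
  "sl_connection n \<C> G \<omega> A1 A2 \<longleftrightarrow>
     (\<forall>c\<in>\<C>. smooth_mat_on n (img c) (A1 c) \<and> smooth_mat_on n (img c) (A2 c) \<and>
        (\<forall>z\<in>img c. d_z (\<omega> c) z = mat_trace (A1 c z) * \<omega> c z \<and>
                    d_zbar (\<omega> c) z = mat_trace (A2 c z) * \<omega> c z)) \<and>
     (\<forall>c\<in>\<C>. \<forall>d\<in>\<C>. \<forall>z\<in>overlap c d.
        G c d z * A1 c z = mat_deriv n d_z (G c d) z +
          d_z (transition c d) z \<cdot>\<^sub>m (A1 d (transition c d z) * G c d z) \<and>
        G c d z * A2 c z = mat_deriv n d_zbar (G c d) z +
          cnj (d_z (transition c d) z) \<cdot>\<^sub>m (A2 d (transition c d z) * G c d z))"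

text \<open>One-forms \<open>P1 dz + P2 dzbar\<close> with values in trace-free endomorphisms.\<close>

definition sl_one_form ::
  "nat \<Rightarrow> 'a chart set \<Rightarrow> ('a chart \<Rightarrow> 'a chart \<Rightarrow> complex \<Rightarrow> complex mat) \<Rightarrow>
   ('a chart \<Rightarrow> complex \<Rightarrow> complex mat) \<Rightarrow> ('a chart \<Rightarrow> complex \<Rightarrow> complex mat) \<Rightarrow> bool" where
  "sl_one_form n \<C> G P1 P2 \<longleftrightarrow>
     (\<forall>c\<in>\<C>. smooth_mat_on n (img c) (P1 c) \<and> smooth_mat_on n (img c) (P2 c) \<and>
        (\<forall>z\<in>img c. mat_trace (P1 c z) = 0 \<and> mat_trace (P2 c z) = 0)) \<and>
     (\<forall>c\<in>\<C>. \<forall>d\<in>\<C>. \<forall>z\<in>overlap c d.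
        G c d z * P1 c z =
          d_z (transition c d) z \<cdot>\<^sub>m (P1 d (transition c d z) * G c d z) \<and>
        G c d z * P2 c z =
          cnj (d_z (transition c d) z) \<cdot>\<^sub>m (P2 d (transition c d z) * G c d z))"

text \<open>The \<open>dz \<and> dzbar\<close> components of \<open>d\<^sub>A F\<close> for a one-form \<open>F\<close> with values in endomorphisms, and
  of the curvature of \<open>d + M1 dz + M2 dzbar\<close>.\<close>

definition cov_ext_deriv ::
  "nat \<Rightarrow> (complex \<Rightarrow> complex mat) \<Rightarrow> (complex \<Rightarrow> complex mat) \<Rightarrow>
   (complex \<Rightarrow> complex mat) \<Rightarrow> (complex \<Rightarrow> complex mat) \<Rightarrow> complex \<Rightarrow> complex mat" where
  "cov_ext_deriv n A1 A2 F1 F2 z = mat_deriv n d_z F2 z - mat_deriv n d_zbar F1 z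
     + (A1 z * F2 z - F2 z * A1 z) - (A2 z * F1 z - F1 z * A2 z)"

definition curvature ::
  "nat \<Rightarrow> (complex \<Rightarrow> complex mat) \<Rightarrow> (complex \<Rightarrow> complex mat) \<Rightarrow> complex \<Rightarrow> complex mat" where
  "curvature n M1 M2 z = mat_deriv n d_z M2 z - mat_deriv n d_zbar M1 z
     + (M1 z * M2 z - M2 z * M1 z)"

text \<open>Components of \<open>C(\<lambda>) = \<lambda> \<Phi> + d\<^sub>A + \<lambda>\<^sup>-\<^sup>1 \<Psi>\<close>.\<close>

definition pencil ::
  "(complex \<Rightarrow> complex mat) \<Rightarrow> (complex \<Rightarrow> complex mat) \<Rightarrow> (complex \<Rightarrow> complex mat) \<Rightarrow>
   complex \<Rightarrow> complex \<Rightarrow> complex mat" where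
  "pencil F A P lam z = lam \<cdot>\<^sub>m F z + A z + inverse lam \<cdot>\<^sub>m P z"


section \<open>Parameters of a connection\<close>

definition nabla ::
  "nat \<Rightarrow> ((complex \<Rightarrow> complex) \<Rightarrow> complex \<Rightarrow> complex) \<Rightarrow> (complex \<Rightarrow> complex mat) \<Rightarrow>
   (complex \<Rightarrow> complex vec) \<Rightarrow> complex \<Rightarrow> complex vec" where
  "nabla n D M s z = vec_deriv n D s z + M z *\<^sub>v s z"

text \<open>\<open>s\<close> is a section over \<open>W\<close> of the line bundle spanned by \<open>e\<close> whose derivatives
  \<open>s, \<nabla>s, \<dots>, \<nabla>\<^sup>n\<^sup>-\<^sup>1s\<close> form a basis of unit volume.\<close>

definition adapted_section ::
  "nat \<Rightarrow> (complex \<Rightarrow> complex vec) \<Rightarrow> (complex \<Rightarrow> complex) \<Rightarrow> (complex \<Rightarrow> complex mat) \<Rightarrow>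
   complex set \<Rightarrow> (complex \<Rightarrow> complex vec) \<Rightarrow> bool" where
  "adapted_section n e vol M1 W s \<longleftrightarrow>
     (\<exists>f. smooth_on W f \<and> (\<forall>w\<in>W. s w = f w \<cdot>\<^sub>v e w)) \<and>
     (\<forall>w\<in>W. vol w *
        Determinant.det (mat_of_cols n (map (\<lambda>j. (nabla n d_z M1 ^^ j) s w) [0..<n])) = 1)"

text \<open>The values do not depend on the choice of \<open>W\<close> and \<open>s\<close>, because \<open>s\<close> is unique
  up to an \<open>n\<close>-th root of unity.\<close>

definition hat_t ::
  "nat \<Rightarrow> complex set \<Rightarrow> (complex \<Rightarrow> complex vec) \<Rightarrow> (complex \<Rightarrow> complex) \<Rightarrow>
   (complex \<Rightarrow> complex mat) \<Rightarrow> nat \<Rightarrow> complex \<Rightarrow> complex" where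
  "hat_t n D e vol M1 k z = (THE x. \<exists>W s a. open W \<and> W \<subseteq> D \<and> z \<in> W \<and>
     adapted_section n e vol M1 W s \<and>
     (\<forall>i<n. vec_index ((nabla n d_z M1 ^^ n) s z) i =
        (\<Sum>j = 2..n. a j * vec_index ((nabla n d_z M1 ^^ (n - j)) s z) i)) \<and>
     x = a k)"

definition hat_mu ::
  "nat \<Rightarrow> complex set \<Rightarrow> (complex \<Rightarrow> complex vec) \<Rightarrow> (complex \<Rightarrow> complex) \<Rightarrow>
   (complex \<Rightarrow> complex mat) \<Rightarrow> (complex \<Rightarrow> complex mat) \<Rightarrow> nat \<Rightarrow> complex \<Rightarrow> complex" where
  "hat_mu n D e vol M1 M2 k z = (THE x. \<exists>W s a. open W \<and> W \<subseteq> D \<and> z \<in> W \<and>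
     adapted_section n e vol M1 W s \<and>
     (\<forall>i<n. vec_index (nabla n d_zbar M2 s z) i =
        (\<Sum>j = 1..n. a j * vec_index ((nabla n d_z M1 ^^ (j - 1)) s z) i)) \<and>
     x = a k)"

text \<open>The coefficient \<open>x\<close> in an expansion \<open>f(\<lambda>) = \<lambda>\<^sup>d x + O(\<lambda>\<^sup>d\<^sup>-\<^sup>1)\<close>.\<close>

definition top_coeff :: "int \<Rightarrow> (complex \<Rightarrow> complex) \<Rightarrow> complex" where
  "top_coeff d f =
     (THE x. (\<lambda>lam. f lam - lam powi d * x) \<in> O[at_infinity](\<lambda>lam. lam powi (d - 1)))"

definition mu_tensor ::
  "nat \<Rightarrow> ('a chart \<Rightarrow> complex \<Rightarrow> cpoly2 set) \<Rightarrow> ('a chart \<Rightarrow> complex \<Rightarrow> complex) \<Rightarrow>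
   ('a chart \<Rightarrow> complex \<Rightarrow> complex mat) \<Rightarrow> ('a chart \<Rightarrow> complex \<Rightarrow> complex mat) \<Rightarrow>
   ('a chart \<Rightarrow> complex \<Rightarrow> complex mat) \<Rightarrow> ('a chart \<Rightarrow> complex \<Rightarrow> complex mat) \<Rightarrow>
   'a chart \<Rightarrow> nat \<Rightarrow> complex \<Rightarrow> complex" where
  "mu_tensor n I \<omega> A1 A2 \<Psi>1 \<Psi>2 c k z = top_coeff (2 - int k)
     (\<lambda>lam. hat_mu n (img c) (unit_section n (I c)) (\<omega> c)
        (pencil (\<Phi>1 n (I c)) (A1 c) (\<Psi>1 c) lam) (pencil (\<Phi>2 n (I c)) (A2 c) (\<Psi>2 c) lam) k z)"

definition t_tensor ::
  "nat \<Rightarrow> ('a chart \<Rightarrow> complex \<Rightarrow> cpoly2 set) \<Rightarrow> ('a chart \<Rightarrow> complex \<Rightarrow> complex) \<Rightarrow>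
   ('a chart \<Rightarrow> complex \<Rightarrow> complex mat) \<Rightarrow> ('a chart \<Rightarrow> complex \<Rightarrow> complex mat) \<Rightarrow>
   'a chart \<Rightarrow> nat \<Rightarrow> complex \<Rightarrow> complex" where
  "t_tensor n I \<omega> A1 \<Psi>1 c k z = top_coeff (int k - 1)
     (\<lambda>lam. hat_t n (img c) (unit_section n (I c)) (\<omega> c)
        (pencil (\<Phi>1 n (I c)) (A1 c) (\<Psi>1 c) lam) k z)"

text \<open>Differentiability is stated explicitly since \<^const>\<open>frechet_derivative\<close> is unspecified
  at points where it fails.\<close>

definition mu_holomorphic ::
  "nat \<Rightarrow> complex set \<Rightarrow> (nat \<Rightarrow> complex \<Rightarrow> complex) \<Rightarrow> (nat \<Rightarrow> complex \<Rightarrow> complex) \<Rightarrow> bool" where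
  "mu_holomorphic n D \<mu> t \<longleftrightarrow> (\<forall>k\<in>{2..n}. \<forall>z\<in>D.
     \<mu> k differentiable (at z) \<and> t k differentiable (at z) \<and>
     (- d_zbar (t k) z + \<mu> 2 z * d_z (t k) z + of_nat k * d_z (\<mu> 2) z * t k z) +
     (\<Sum>l = 1..n - k. of_nat (l + k) * d_z (\<mu> (l + 2)) z * t (k + l) z
                     + of_nat (l + 1) * \<mu> (l + 2) z * d_z (t (k + l)) z) = 0)"

end

theory Submission
  imports Defs
begin


text \<open>
  The statement is local. Fix a chart with coordinate \<open>z\<close> and write \<open>\<partial>\<close> and \<open>dbar\<close> for the
  derivatives. In the frame \<open>1, p, \<dots>, p ^ (n - 1)\<close> the field has the components \<open>\<Phi>\<^sub>1 = N\<close>, the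
  nilpotent shift, and \<open>\<Phi>\<^sub>2 = \<Sum>\<^sub>k \<mu>\<^sub>k N ^ (k - 1)\<close>.

  The idea is that the highest order terms are traces: \<open>t\<^sub>k = tr (N ^ (k - 1) A\<^sub>1)\<close>. Put
  \<open>h = 1 / \<lambda>\<close>. The operator \<open>h \<nabla> = N + h (\<partial> + A\<^sub>1) + h\<^sup>2 \<Psi>\<^sub>1\<close> is polynomial in \<open>h\<close>, and for the
  generator \<open>e\<close> of \<open>L\<close> one has \<open>(h \<nabla>) ^ j e = N ^ j e + O(h)\<close> for \<open>j < n\<close>, while
  \<open>(h \<nabla>) ^ n e = h \<Sum>\<^sub>k tr (N ^ (k - 1) A\<^sub>1) N ^ (n - k) e + O(h\<^sup>2)\<close> because \<open>N ^ n = 0\<close>. The section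
  of unit volume is \<open>s = f e\<close> for a function \<open>f\<close>, and replacing \<open>e\<close> by \<open>s\<close> amounts to adding
  the scalar \<open>\<partial> f / f\<close> to \<open>A\<^sub>1\<close>, which does not change the traces with \<open>k \<ge> 2\<close>. In the same
  way \<open>h\<close> times the other covariant derivative of \<open>s\<close> is \<open>f\<close> times \<open>\<Phi>\<^sub>2 e + O(h)\<close>, so that the highest
  order terms of the second set of parameters are the \<open>\<mu>\<^sub>k\<close>. These expansions are
  \<open>frame_expansion\<close>, \<open>hat_asymptotics\<close> and \<open>top_coeff_parameters\<close>.

  Now \<open>d\<^sub>A \<Phi> = 0\<close> and the coefficient of \<open>\<lambda> ^ 0\<close> in the curvature are the two equations
  \<open>[A\<^sub>2, N] = \<partial> \<Phi>\<^sub>2 + [A\<^sub>1, \<Phi>\<^sub>2]\<close> and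
  \<open>\<partial> A\<^sub>2 - dbar A\<^sub>1 + [A\<^sub>1, A\<^sub>2] + [N, \<Psi>\<^sub>2] + [\<Psi>\<^sub>1, \<Phi>\<^sub>2] = 0\<close>. Take the trace of the second one against
  \<open>N ^ (k - 1)\<close>. This matrix commutes with \<open>N\<close> and \<open>\<Phi>\<^sub>2\<close>, so the terms with \<open>\<Psi>\<close> vanish and
  \<open>dbar t\<^sub>k = \<partial> tr (N ^ (k - 1) A\<^sub>2) + tr (N ^ (k - 1) [A\<^sub>1, A\<^sub>2])\<close>. The first equation evaluates both
  terms on the right: the first trace is \<open>\<Sum>\<^sub>j (j - 1) \<mu>\<^sub>j t\<^sub>k\<^sub>+\<^sub>j\<^sub>-\<^sub>2\<close> (\<open>tau_second_component\<close>) and the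
  second one is \<open>(k - 1) \<Sum>\<^sub>j \<partial>\<mu>\<^sub>j t\<^sub>k\<^sub>+\<^sub>j\<^sub>-\<^sub>2\<close> (\<open>tau_commutator\<close>). The sum of the two is the
  equation of \<open>\<mu>\<close>-holomorphicity, with \<open>j = \<ell> + 2\<close>.

  The parameters are defined at one point \<open>z\<close>, but they contain derivatives in \<open>z\<close> of \<open>f\<close>, which
  depends on \<open>h\<close>. The error terms therefore have to be controlled together with their derivatives;
  this is done by the class \<open>smooth_family\<close>.
\<close>
section \<open>Derivations of smooth functions\<close>

lemma d_x_eqI: "(f has_derivative f') (at z) \<Longrightarrow> d_x f z = f' 1"
  unfolding d_x_def by (simp add: frechet_derivative_at[symmetric])

lemma d_y_eqI: "(f has_derivative f') (at z) \<Longrightarrow> d_y f z = f' \<i>"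
  unfolding d_y_def by (simp add: frechet_derivative_at[symmetric])

text \<open>One product rule serves \<^const>\<open>d_x\<close>, \<^const>\<open>d_y\<close>, \<^const>\<open>d_z\<close> and \<^const>\<open>d_zbar\<close>.\<close>
definition derivation :: "((complex \<Rightarrow> complex) \<Rightarrow> complex \<Rightarrow> complex) \<Rightarrow> bool" where
  "derivation D \<longleftrightarrow> (\<exists>a b. \<forall>f z. D f z = a * d_x f z + b * d_y f z)"

lemma derivation_d_x: "derivation d_x"
  unfolding derivation_def by (rule exI[of _ 1], rule exI[of _ 0]) auto

lemma derivation_d_y: "derivation d_y"
  unfolding derivation_def by (rule exI[of _ 0], rule exI[of _ 1]) auto

lemma derivation_d_z: "derivation d_z"
  unfolding derivation_def d_z_def by (rule exI[of _ "1/2"], rule exI[of _ "-\<i>/2"]) (auto simp: field_simps)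

lemma derivation_d_zbar: "derivation d_zbar"
  unfolding derivation_def d_zbar_def by (rule exI[of _ "1/2"], rule exI[of _ "\<i>/2"]) (auto simp: field_simps)

lemma derivation_mult:
  assumes "derivation D" "f differentiable at z" "g differentiable at z"
  shows "D (\<lambda>w. f w * g w) z = D f z * g z + f z * D g z"
proof -
  obtain a b where D: "\<And>f z. D f z = a * d_x f z + b * d_y f z"
    using assms(1) unfolding derivation_def by blast
  obtain f' g' where f: "(f has_derivative f') (at z)" and g: "(g has_derivative g') (at z)"
    using assms unfolding differentiable_def by blast
  have fg: "((\<lambda>w. f w * g w) has_derivative (\<lambda>h. f z * g' h + f' h * g z)) (at z)"
    by (rule has_derivative_mult[OF f g])
  show ?thesis
    unfolding D d_x_eqI[OF f] d_x_eqI[OF g] d_x_eqI[OF fg] d_y_eqI[OF f] d_y_eqI[OF g] d_y_eqI[OF fg]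
    by (simp add: algebra_simps)
qed

lemma derivation_add:
  assumes "derivation D" "f differentiable at z" "g differentiable at z"
  shows "D (\<lambda>w. f w + g w) z = D f z + D g z"
proof -
  obtain a b where D: "\<And>f z. D f z = a * d_x f z + b * d_y f z"
    using assms(1) unfolding derivation_def by blast
  obtain f' g' where f: "(f has_derivative f') (at z)" and g: "(g has_derivative g') (at z)"
    using assms unfolding differentiable_def by blast
  have fg: "((\<lambda>w. f w + g w) has_derivative (\<lambda>h. f' h + g' h)) (at z)"
    by (rule has_derivative_add[OF f g])
  show ?thesis
    unfolding D d_x_eqI[OF f] d_x_eqI[OF g] d_x_eqI[OF fg] d_y_eqI[OF f] d_y_eqI[OF g] d_y_eqI[OF fg]
    by (simp add: algebra_simps)
qed

lemma derivation_const:
  assumes "derivation D" shows "D (\<lambda>w. c) z = 0"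
  using assms unfolding derivation_def
  by (auto simp: d_x_eqI[OF has_derivative_const] d_y_eqI[OF has_derivative_const])

lemma derivation_cmult:
  assumes "derivation D" "f differentiable at z"
  shows "D (\<lambda>w. c * f w) z = c * D f z"
  using derivation_mult[OF assms(1) differentiable_const assms(2), of c] derivation_const[OF assms(1)]
  by simp

lemma derivation_sum:
  assumes "derivation D" "\<And>i. i \<in> S \<Longrightarrow> f i differentiable at z"
  shows "D (\<lambda>w. \<Sum>i\<in>S. f i w) z = (\<Sum>i\<in>S. D (f i) z)"
  using assms(2)
proof (induction S rule: infinite_finite_induct)
  case (insert i S)
  then show ?case
    using derivation_add[OF assms(1), of "f i" z "\<lambda>w. \<Sum>i\<in>S. f i w"] by simp
qed (simp_all add: derivation_const[OF assms(1)])

lemma differentiable_prod: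
  fixes f :: "'i \<Rightarrow> complex \<Rightarrow> complex"
  assumes "\<And>i. i \<in> S \<Longrightarrow> f i differentiable at z"
  shows "(\<lambda>w. \<Prod>i\<in>S. f i w) differentiable at z"
  using assms by (induction S rule: infinite_finite_induct) auto

text \<open>The summands are the products in which one factor is differentiated; in this form a derivative
  of a determinant is a sum of determinants with one differentiated row.\<close>
lemma derivation_prod:
  assumes "derivation D" "finite S" "\<And>i. i \<in> S \<Longrightarrow> f i differentiable at z"
  shows "D (\<lambda>w. \<Prod>i\<in>S. f i w) z = (\<Sum>i\<in>S. \<Prod>k\<in>S. if k = i then D (f k) z else f k z)"
  using assms(2,3)
proof (induction S rule: finite_induct)
  case empty
  then show ?case by (simp add: derivation_const[OF assms(1)])
next
  case (insert i S)
  have 1: "(\<Prod>k\<in>S. if k = i then D (f k) z else f k z) = (\<Prod>k\<in>S. f k z)"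
    using insert.hyps by (intro prod.cong) auto
  have 2: "(\<Sum>j\<in>S. \<Prod>k\<in>insert i S. if k = j then D (f k) z else f k z)
      = (\<Sum>j\<in>S. f i z * (\<Prod>k\<in>S. if k = j then D (f k) z else f k z))"
    using insert.hyps by (intro sum.cong refl) auto
  have "D (\<lambda>w. f i w * (\<Prod>i\<in>S. f i w)) z = D (f i) z * (\<Prod>k\<in>S. f k z)
      + f i z * D (\<lambda>w. \<Prod>i\<in>S. f i w) z"
    by (intro derivation_mult assms(1) differentiable_prod) (simp_all add: insert.prems)
  also have "\<dots> = (\<Sum>j\<in>insert i S. \<Prod>k\<in>insert i S. if k = j then D (f k) z else f k z)"
    using insert 1 2 by (simp add: sum_distrib_left)
  finally show ?case using insert.hyps by simp
qed

lemma derivation_power: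
  assumes D: "derivation D" and f: "f differentiable at z"
  shows "D (\<lambda>w. f w ^ n) z = of_nat n * f z ^ (n - 1) * D f z"
proof (induction n)
  case 0
  then show ?case by (simp add: derivation_const[OF D])
next
  case (Suc n)
  have "D (\<lambda>w. f w * f w ^ n) z = D f z * f z ^ n + f z * D (\<lambda>w. f w ^ n) z"
    using f by (intro derivation_mult D) auto
  also have "\<dots> = of_nat (Suc n) * f z ^ n * D f z"
    unfolding Suc.IH by (cases n) (simp_all add: derivation_const[OF D] algebra_simps)
  finally show ?case by simp
qed

lemma differentiable_cong_open:
  fixes f g :: "complex \<Rightarrow> complex"
  assumes "f differentiable at z" "open W" "z \<in> W" "\<And>w. w \<in> W \<Longrightarrow> f w = g w"
  shows "g differentiable at z"
  using assms unfolding differentiable_def by (meson has_derivative_transform_within_open)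

lemma derivation_cong_open:
  assumes "derivation D" "f differentiable at z" "open W" "z \<in> W" "\<And>w. w \<in> W \<Longrightarrow> f w = g w"
  shows "D f z = D g z"
proof -
  obtain f' where f: "(f has_derivative f') (at z)"
    using assms unfolding differentiable_def by blast
  have g: "(g has_derivative f') (at z)"
    by (rule has_derivative_transform_within_open[OF f assms(3-5)])
  obtain a b where D: "\<And>f z. D f z = a * d_x f z + b * d_y f z"
    using assms(1) unfolding derivation_def by blast
  show ?thesis
    unfolding D d_x_eqI[OF f] d_x_eqI[OF g] d_y_eqI[OF f] d_y_eqI[OF g] ..
qed


section \<open>Families of smooth functions with uniform bounds\<close>

definition unif_bounded :: "'h set \<Rightarrow> complex set \<Rightarrow> ('h \<Rightarrow> complex \<Rightarrow> complex) \<Rightarrow> bool" where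
  "unif_bounded H W F \<longleftrightarrow> (\<exists>C. \<forall>h\<in>H. \<forall>w\<in>W. norm (F h w) \<le> C)"

lemma unif_boundedI: "(\<And>h w. h \<in> H \<Longrightarrow> w \<in> W \<Longrightarrow> norm (F h w) \<le> C) \<Longrightarrow> unif_bounded H W F"
  unfolding unif_bounded_def by blast

lemma unif_boundedE:
  assumes "unif_bounded H W F"
  obtains C where "\<And>h w. h \<in> H \<Longrightarrow> w \<in> W \<Longrightarrow> norm (F h w) \<le> C"
  using assms unfolding unif_bounded_def by blast

lemma unif_bounded_add:
  assumes "unif_bounded H W F" "unif_bounded H W G"
  shows "unif_bounded H W (\<lambda>h w. F h w + G h w)"
proof -
  obtain C C' where "\<And>h w. h \<in> H \<Longrightarrow> w \<in> W \<Longrightarrow> norm (F h w) \<le> C"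
    "\<And>h w. h \<in> H \<Longrightarrow> w \<in> W \<Longrightarrow> norm (G h w) \<le> C'"
    using assms by (elim unif_boundedE) blast
  then show ?thesis by (intro unif_boundedI[of _ _ _ "C + C'"] norm_triangle_mono) auto
qed

lemma unif_bounded_mult:
  assumes "unif_bounded H W F" "unif_bounded H W G"
  shows "unif_bounded H W (\<lambda>h w. F h w * G h w)"
proof -
  obtain C C' where "\<And>h w. h \<in> H \<Longrightarrow> w \<in> W \<Longrightarrow> norm (F h w) \<le> C"
    "\<And>h w. h \<in> H \<Longrightarrow> w \<in> W \<Longrightarrow> norm (G h w) \<le> C'"
    using assms by (elim unif_boundedE) blast
  then show ?thesis
    by (intro unif_boundedI[of _ _ _ "C * C'"]) (auto simp: norm_mult intro!: mult_mono')
qed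

text \<open>The counterpart of \<^const>\<open>Ck_on\<close> for functions of \<open>z\<close> that depend on a parameter \<open>h\<close>: all
  derivatives up to order \<open>k\<close> are bounded uniformly in \<open>h\<close>. Taken for all \<open>k\<close>, the class is closed
  under sums, products and differentiation, so an error term \<open>h * R\<close> with \<open>R\<close> in it stays of that form when it is
  differentiated in \<open>z\<close>.\<close>
primrec Cfam :: "nat \<Rightarrow> 'h set \<Rightarrow> complex set \<Rightarrow> ('h \<Rightarrow> complex \<Rightarrow> complex) \<Rightarrow> bool" where
  "Cfam 0 H W F \<longleftrightarrow> unif_bounded H W F"
| "Cfam (Suc k) H W F \<longleftrightarrow> (\<forall>h\<in>H. \<forall>w\<in>W. F h differentiable (at w)) \<and>
     unif_bounded H W F \<and>
     Cfam k H W (\<lambda>h. d_x (F h)) \<and> Cfam k H W (\<lambda>h. d_y (F h))"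

definition smooth_family where
  "smooth_family H W F \<longleftrightarrow> (\<forall>k. Cfam k H W F)"

lemma smooth_familyD: "smooth_family H W F \<Longrightarrow> Cfam k H W F"
  unfolding smooth_family_def by blast

lemma Cfam_Suc_imp: "Cfam (Suc k) H W F \<Longrightarrow> Cfam k H W F"
proof (induction k arbitrary: F)
  case (Suc k)
  have "Cfam (Suc k) H W (\<lambda>h. d_x (F h))" "Cfam (Suc k) H W (\<lambda>h. d_y (F h))"
    using Suc.prems unfolding Cfam.simps(2)[of "Suc k"] by blast+
  then have "Cfam k H W (\<lambda>h. d_x (F h))" "Cfam k H W (\<lambda>h. d_y (F h))"
    by (blast intro: Suc.IH)+
  then show ?case using Suc.prems unfolding Cfam.simps(2) by blast
qed simp

lemma Cfam_mono: "Cfam k H W F \<Longrightarrow> H' \<subseteq> H \<Longrightarrow> W' \<subseteq> W \<Longrightarrow> Cfam k H' W' F"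
proof (induction k arbitrary: F)
  case 0
  then show ?case by (auto simp: unif_bounded_def subset_iff) blast
next
  case (Suc k)
  have "unif_bounded H' W' F" using Suc.prems by (auto simp: unif_bounded_def subset_iff) blast
  moreover have "\<forall>h\<in>H'. \<forall>w\<in>W'. F h differentiable (at w)" using Suc.prems
    unfolding Cfam.simps by blast
  ultimately show ?case using Suc by simp
qed

lemma smooth_family_mono:
  "smooth_family H W F \<Longrightarrow> H' \<subseteq> H \<Longrightarrow> W' \<subseteq> W \<Longrightarrow> smooth_family H' W' F"
  unfolding smooth_family_def using Cfam_mono by blast

lemma Cfam_cong:
  assumes "open W"
  shows "Cfam k H W F \<Longrightarrow> (\<And>h w. h \<in> H \<Longrightarrow> w \<in> W \<Longrightarrow> F h w = G h w) \<Longrightarrow> Cfam k H W G"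
proof (induction k arbitrary: F G)
  case 0
  then show ?case by (auto simp: unif_bounded_def)
next
  case (Suc k)
  have diff: "F h differentiable at w" if "h \<in> H" "w \<in> W" for h w
    using Suc.prems that by auto
  have "Cfam k H W (\<lambda>h. d_x (G h))"
    by (rule Suc.IH[of "\<lambda>h. d_x (F h)"])
      (use Suc.prems diff assms in \<open>auto intro!: derivation_cong_open[OF derivation_d_x]\<close>)
  moreover have "Cfam k H W (\<lambda>h. d_y (G h))"
    by (rule Suc.IH[of "\<lambda>h. d_y (F h)"])
      (use Suc.prems diff assms in \<open>auto intro!: derivation_cong_open[OF derivation_d_y]\<close>)
  moreover have "\<forall>h\<in>H. \<forall>w\<in>W. G h differentiable at w"
    using Suc.prems(2) diff assms by (blast intro: differentiable_cong_open)
  moreover have "unif_bounded H W G"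
    using Suc.prems by (auto simp: unif_bounded_def)
  ultimately show ?case by simp
qed

lemma smooth_family_cong:
  assumes "open W" "smooth_family H W F" "\<And>h w. h \<in> H \<Longrightarrow> w \<in> W \<Longrightarrow> F h w = G h w"
  shows "smooth_family H W G"
  using Cfam_cong[OF assms(1)] assms unfolding smooth_family_def by blast

lemma smooth_family_differentiable:
  "smooth_family H W F \<Longrightarrow> h \<in> H \<Longrightarrow> w \<in> W \<Longrightarrow> F h differentiable at w"
  using smooth_familyD[of H W F "Suc 0"] by auto

lemma smooth_family_bounded:
  assumes "smooth_family H W F"
  obtains C where "C > 0" "\<And>h w. h \<in> H \<Longrightarrow> w \<in> W \<Longrightarrow> norm (F h w) \<le> C"
proof -
  obtain C where C: "\<And>h w. h \<in> H \<Longrightarrow> w \<in> W \<Longrightarrow> norm (F h w) \<le> C"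
    using smooth_familyD[OF assms, of 0] unfolding Cfam.simps by (rule unif_boundedE) blast
  have "norm (F h w) \<le> \<bar>C\<bar> + 1" if "h \<in> H" "w \<in> W" for h w
    using C that by fastforce
  then show ?thesis using that[of "\<bar>C\<bar> + 1"] by force
qed

lemma unif_bounded_const: "unif_bounded H W (\<lambda>h w. c)"
  by (rule unif_boundedI[of _ _ _ "norm c"]) simp

lemma Cfam_const: "Cfam k H W (\<lambda>h w. c)"
proof (induction k arbitrary: c)
  case (Suc k)
  have "d_x (\<lambda>w. c) = (\<lambda>w. 0)" "d_y (\<lambda>w. c) = (\<lambda>w. 0)"
    using derivation_const[OF derivation_d_x] derivation_const[OF derivation_d_y] by blast+
  then show ?case using Suc by (simp add: unif_bounded_const)
qed (simp add: unif_bounded_const)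

lemma smooth_family_const [intro]: "smooth_family H W (\<lambda>h w. c)"
  unfolding smooth_family_def using Cfam_const by blast

lemma Cfam_param:
  assumes "bounded (c ` H)"
  shows "Cfam k H W (\<lambda>h w. c h)"
proof -
  obtain C where "\<forall>h\<in>H. norm (c h) \<le> C" using assms unfolding bounded_iff by auto
  then have C: "unif_bounded H W (\<lambda>h w. c h)" by (intro unif_boundedI) auto
  show ?thesis
  proof (cases k)
    case (Suc k')
    have "d_x (\<lambda>w. c h) = (\<lambda>w. 0)" "d_y (\<lambda>w. c h) = (\<lambda>w. 0)" for h
      using derivation_const[OF derivation_d_x] derivation_const[OF derivation_d_y] by blast+
    then show ?thesis using Suc C by (simp add: Cfam_const)
  qed (use C in auto)
qed

lemma smooth_family_param [intro]: "bounded (c ` H) \<Longrightarrow> smooth_family H W (\<lambda>h w. c h)"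
  unfolding smooth_family_def using Cfam_param by blast

lemma Cfam_add:
  assumes "open W"
  shows "Cfam k H W F \<Longrightarrow> Cfam k H W G \<Longrightarrow> Cfam k H W (\<lambda>h w. F h w + G h w)"
proof (induction k arbitrary: F G)
  case 0
  then show ?case by (simp add: unif_bounded_add)
next
  case (Suc k)
  have b: "unif_bounded H W (\<lambda>h w. F h w + G h w)"
    using Suc.prems by (simp add: unif_bounded_add)
  have "Cfam k H W (\<lambda>h. d_x (\<lambda>w. F h w + G h w))"
    by (rule Cfam_cong[OF assms Suc.IH[of "\<lambda>h. d_x (F h)" "\<lambda>h. d_x (G h)"]])
      (use Suc.prems in \<open>auto simp: derivation_add[OF derivation_d_x]\<close>)
  moreover have "Cfam k H W (\<lambda>h. d_y (\<lambda>w. F h w + G h w))"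
    by (rule Cfam_cong[OF assms Suc.IH[of "\<lambda>h. d_y (F h)" "\<lambda>h. d_y (G h)"]])
      (use Suc.prems in \<open>auto simp: derivation_add[OF derivation_d_y]\<close>)
  ultimately show ?case using Suc.prems b by auto
qed

lemma Cfam_mult:
  assumes "open W"
  shows "Cfam k H W F \<Longrightarrow> Cfam k H W G \<Longrightarrow> Cfam k H W (\<lambda>h w. F h w * G h w)"
proof (induction k arbitrary: F G)
  case 0
  then show ?case by (simp add: unif_bounded_mult)
next
  case (Suc k)
  have b: "unif_bounded H W (\<lambda>h w. F h w * G h w)"
    using Suc.prems by (simp add: unif_bounded_mult)
  note lower = Cfam_Suc_imp[OF Suc.prems(1)] Cfam_Suc_imp[OF Suc.prems(2)]
  have "Cfam k H W (\<lambda>h. d_x (\<lambda>w. F h w * G h w))"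
    by (rule Cfam_cong[OF assms Cfam_add[OF assms
          Suc.IH[of "\<lambda>h. d_x (F h)" "\<lambda>h. G h"] Suc.IH[of "\<lambda>h. F h" "\<lambda>h. d_x (G h)"]]])
      (use Suc.prems lower in \<open>auto simp: derivation_mult[OF derivation_d_x]\<close>)
  moreover have "Cfam k H W (\<lambda>h. d_y (\<lambda>w. F h w * G h w))"
    by (rule Cfam_cong[OF assms Cfam_add[OF assms
          Suc.IH[of "\<lambda>h. d_y (F h)" "\<lambda>h. G h"] Suc.IH[of "\<lambda>h. F h" "\<lambda>h. d_y (G h)"]]])
      (use Suc.prems lower in \<open>auto simp: derivation_mult[OF derivation_d_y]\<close>)
  ultimately show ?case using Suc.prems b by auto
qed

lemma smooth_family_add:
  "open W \<Longrightarrow> smooth_family H W F \<Longrightarrow> smooth_family H W G \<Longrightarrow> smooth_family H W (\<lambda>h w. F h w + G h w)"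
  by (simp add: smooth_family_def Cfam_add)

lemma smooth_family_mult:
  "open W \<Longrightarrow> smooth_family H W F \<Longrightarrow> smooth_family H W G \<Longrightarrow> smooth_family H W (\<lambda>h w. F h w * G h w)"
  by (simp add: smooth_family_def Cfam_mult)

lemma smooth_family_sum:
  "open W \<Longrightarrow> (\<And>i. i \<in> S \<Longrightarrow> smooth_family H W (F i)) \<Longrightarrow> smooth_family H W (\<lambda>h w. \<Sum>i\<in>S. F i h w)"
  by (induction S rule: infinite_finite_induct) (simp_all add: smooth_family_add smooth_family_const)

lemma smooth_family_prod:
  "open W \<Longrightarrow> (\<And>i. i \<in> S \<Longrightarrow> smooth_family H W (F i)) \<Longrightarrow> smooth_family H W (\<lambda>h w. \<Prod>i\<in>S. F i h w)"
  by (induction S rule: infinite_finite_induct) (simp_all add: smooth_family_mult smooth_family_const)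

lemma smooth_family_d_x: "smooth_family H W F \<Longrightarrow> smooth_family H W (\<lambda>h. d_x (F h))"
  and smooth_family_d_y: "smooth_family H W F \<Longrightarrow> smooth_family H W (\<lambda>h. d_y (F h))"
proof -
  assume F: "smooth_family H W F"
  have "Cfam k H W (\<lambda>h. d_x (F h)) \<and> Cfam k H W (\<lambda>h. d_y (F h))" for k
    using smooth_familyD[OF F, of "Suc k"] by simp
  then show "smooth_family H W (\<lambda>h. d_x (F h))" "smooth_family H W (\<lambda>h. d_y (F h))"
    unfolding smooth_family_def by blast+
qed

lemma smooth_family_derivation:
  assumes "open W" "derivation D" "smooth_family H W F"
  shows "smooth_family H W (\<lambda>h. D (F h))"
proof -
  obtain a b where D: "\<And>f z. D f z = a * d_x f z + b * d_y f z"
    using assms unfolding derivation_def by blast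
  show ?thesis
    by (rule smooth_family_cong[OF assms(1) smooth_family_add[OF assms(1)
            smooth_family_mult[OF assms(1) smooth_family_const[of _ _ a] smooth_family_d_x[OF assms(3)]]
            smooth_family_mult[OF assms(1) smooth_family_const[of _ _ b] smooth_family_d_y[OF assms(3)]]]])
      (simp add: D)
qed

lemma derivation_inverse:
  assumes "derivation D" "f differentiable at z" "f z \<noteq> 0"
  shows "D (\<lambda>w. inverse (f w)) z = - D f z * inverse (f z) * inverse (f z)"
proof -
  obtain a b where D: "\<And>f z. D f z = a * d_x f z + b * d_y f z"
    using assms(1) unfolding derivation_def by blast
  obtain f' where f: "(f has_derivative f') (at z)"
    using assms unfolding differentiable_def by blast
  have g: "((\<lambda>w. inverse (f w)) has_derivative (\<lambda>h. - (inverse (f z) * f' h * inverse (f z)))) (at z)"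
    by (rule Deriv.has_derivative_inverse[OF assms(3) f])
  show ?thesis
    unfolding D d_x_eqI[OF f] d_x_eqI[OF g] d_y_eqI[OF f] d_y_eqI[OF g] by (simp add: algebra_simps)
qed

text \<open>The derivative of \<open>1 / F\<close> is a polynomial in \<open>1 / F\<close> and the derivatives of \<open>F\<close>, so the bounds
  follow by induction on the order from the one for \<open>1 / F\<close> itself.\<close>
lemma smooth_family_inverse:
  assumes W: "open W" and F: "smooth_family H W F"
    and \<delta>: "\<delta> > 0" "\<And>h w. h \<in> H \<Longrightarrow> w \<in> W \<Longrightarrow> norm (F h w) \<ge> \<delta>"
  shows "smooth_family H W (\<lambda>h w. inverse (F h w))"
proof -
  have nz: "F h w \<noteq> 0" if "h \<in> H" "w \<in> W" for h w using \<delta> that by force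
  have b: "unif_bounded H W (\<lambda>h w. inverse (F h w))"
    using \<delta> by (intro unif_boundedI[of _ _ _ "inverse \<delta>"]) (auto simp: norm_inverse intro: le_imp_inverse_le)
  have diff: "F h differentiable at w" if "h \<in> H" "w \<in> W" for h w
    using smooth_family_differentiable[OF F] that by auto
  have "Cfam k H W (\<lambda>h w. inverse (F h w))" for k
  proof (induction k)
    case 0
    then show ?case using b by auto
  next
    case (Suc k)
    have m: "Cfam k H W (\<lambda>h. d_x (F h))" "Cfam k H W (\<lambda>h. d_y (F h))"
      using F smooth_family_d_x smooth_family_d_y unfolding smooth_family_def by blast+
    have "Cfam k H W (\<lambda>h. d_x (\<lambda>w. inverse (F h w)))"
      by (rule Cfam_cong[OF W Cfam_mult[OF W Cfam_mult[OF W Cfam_const[of _ _ _ "-1"] m(1)]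
              Cfam_mult[OF W Suc Suc]]])
        (simp add: derivation_inverse[OF derivation_d_x diff nz])
    moreover have "Cfam k H W (\<lambda>h. d_y (\<lambda>w. inverse (F h w)))"
      by (rule Cfam_cong[OF W Cfam_mult[OF W Cfam_mult[OF W Cfam_const[of _ _ _ "-1"] m(2)]
              Cfam_mult[OF W Suc Suc]]])
        (simp add: derivation_inverse[OF derivation_d_y diff nz])
    moreover have "(\<lambda>w. inverse (F h w)) differentiable at w" if "h \<in> H" "w \<in> W" for h w
      using differentiable_inverse[OF diff[OF that] nz[OF that]] by simp
    ultimately show ?case using b by auto
  qed
  then show ?thesis unfolding smooth_family_def by blast
qed

lemma smooth_on_imp_smooth_family:
  assumes "smooth_on D f" "compact K" "W \<subseteq> K" "K \<subseteq> D"
  shows "smooth_family H W (\<lambda>h. f)"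
proof -
  have "Ck_on k D f \<Longrightarrow> Cfam k H W (\<lambda>h. f)" for k
  proof (induction k arbitrary: f)
    case 0
    then have "bounded (f ` K)"
      using assms by (auto intro!: compact_imp_bounded compact_continuous_image continuous_on_subset[OF _ assms(4)])
    then show ?case using assms(3) by (fastforce simp: bounded_iff unif_bounded_def)
  next
    case (Suc k)
    then have "continuous_on K f"
      using assms(4) by (auto intro!: continuous_at_imp_continuous_on differentiable_imp_continuous_within)
    then have "bounded (f ` K)"
      using assms by (auto intro!: compact_imp_bounded compact_continuous_image)
    then have "unif_bounded H W (\<lambda>h. f)" using assms(3) by (fastforce simp: bounded_iff unif_bounded_def)
    then show ?case using Suc assms by auto
  qed
  then show ?thesis using assms(1) unfolding smooth_on_def smooth_family_def by blast
qed

lemma smooth_family_imp_smooth_on: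
  assumes "smooth_family H W F" "h \<in> H"
  shows "smooth_on W (F h)"
proof -
  have "Cfam (Suc k) H W F \<Longrightarrow> Ck_on k W (F h)" for k
  proof (induction k arbitrary: F)
    case 0
    then show ?case using assms(2)
      by (auto intro!: continuous_at_imp_continuous_on differentiable_imp_continuous_within)
  next
    case (Suc k)
    have "Ck_on k W (d_x (F h))" "Ck_on k W (d_y (F h))"
      using Suc.IH[of "\<lambda>h. d_x (F h)"] Suc.IH[of "\<lambda>h. d_y (F h)"] Suc.prems
      unfolding Cfam.simps(2)[of "Suc k"] by auto
    then show ?case using Suc.prems assms(2) by auto
  qed
  then show ?thesis using assms(1) unfolding smooth_on_def smooth_family_def by blast
qed

lemma smooth_on_differentiable: "smooth_on D f \<Longrightarrow> z \<in> D \<Longrightarrow> f differentiable at z"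
  unfolding smooth_on_def by (drule spec[of _ "Suc 0"]) auto


section \<open>The ideals of a higher complex structure\<close>

definition beltrami_poly :: "nat \<Rightarrow> (nat \<Rightarrow> complex) \<Rightarrow> complex poly" where
  "beltrami_poly n m = (\<Sum>k=2..n. Polynomial.monom (m k) (k - 1))"

lemma coeff_beltrami_poly:
  "poly.coeff (beltrami_poly n m) i = (if 1 \<le> i \<and> i < n then m (i + 1) else 0)"
proof -
  have "poly.coeff (beltrami_poly n m) i = (\<Sum>k=2..n. if k = i + 1 then m k else 0)"
    unfolding beltrami_poly_def Polynomial.coeff_sum Polynomial.coeff_monom by (intro sum.cong) auto
  then show ?thesis by (subst (asm) sum.delta) auto
qed

lemma p_var_power: "p_var ^ k = [:Polynomial.monom 1 k:]"
  by (induction k) (simp_all add: p_var_def monom_Suc one_pCons monom_0)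

lemma con_p_var: "con a * p_var ^ k = [:Polynomial.monom a k:]"
  by (simp add: con_def p_var_power smult_monom)

lemma const_poly_sum: "(\<Sum>k\<in>S. [:f k:]) = [:\<Sum>k\<in>S. f k:]"
  by (induction S rule: infinite_finite_induct) auto


lemma mem_ideal_generated_pair:
  "f \<in> ideal_generated {a, b} \<longleftrightarrow> (\<exists>u v. f - u * a = v * b)"
  by (auto simp: module.span_insert[OF module_times] module.span_empty[OF module_times])

text \<open>Modulo the second generator, \<open>pbar\<close> is a polynomial in \<open>p\<close>. Substituting this polynomial identifies
  the quotient by the ideal with the polynomials in \<open>p\<close> modulo \<open>p ^ n\<close>, and reduces every computation
  in the fibres of the bundle to coefficients of a polynomial in one variable.\<close>
lemma normal_form_iff:
  "f \<in> normal_form n m \<longleftrightarrow> Polynomial.monom 1 n dvd poly f (beltrami_poly n m)"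
proof -
  let ?Q = "beltrami_poly n m"
  have gen: "- pbar_var + (\<Sum>k=2..n. con (m k) * p_var ^ (k - 1)) = - [:- ?Q, 1:]"
    by (simp add: con_p_var const_poly_sum pbar_var_def beltrami_poly_def)
  have span: "f \<in> normal_form n m \<longleftrightarrow> (\<exists>u v. f - u * [:Polynomial.monom 1 n:] = v * - [:- ?Q, 1:])"
    unfolding normal_form_def gen unfolding p_var_power by (rule mem_ideal_generated_pair)
  show ?thesis
  proof
    assume "f \<in> normal_form n m"
    then obtain u v where "f - u * [:Polynomial.monom 1 n:] = v * - [:- ?Q, 1:]" using span by blast
    then have "f = u * [:Polynomial.monom 1 n:] + v * - [:- ?Q, 1:]" by (simp add: algebra_simps)
    then have "poly f ?Q = poly u ?Q * Polynomial.monom 1 n" by simp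
    then show "Polynomial.monom 1 n dvd poly f ?Q" by simp
  next
    assume "Polynomial.monom 1 n dvd poly f ?Q"
    then obtain r where r: "poly f ?Q = Polynomial.monom 1 n * r" by (rule dvdE)
    have "poly (f - [:poly f ?Q:]) ?Q = 0" by simp
    then have "[:- ?Q, 1:] dvd f - [:poly f ?Q:]" by (simp only: poly_eq_0_iff_dvd)
    then obtain v where v: "f - [:poly f ?Q:] = [:- ?Q, 1:] * v" by (rule dvdE)
    have "f - [:r:] * [:Polynomial.monom 1 n:] = (- v) * - [:- ?Q, 1:]"
      using v r by (simp add: mult.commute)
    then show "f \<in> normal_form n m" using span by blast
  qed
qed

lemma coords_normal_form:
  "coords n (normal_form n m) f = Matrix.vec n (\<lambda>i. poly.coeff (poly f (beltrami_poly n m)) i)"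
proof -
  let ?Q = "beltrami_poly n m"
  have "f - (\<Sum>i<n. con (vec_index v i) * p_var ^ i) \<in> normal_form n m \<longleftrightarrow>
      (\<forall>i<n. vec_index v i = poly.coeff (poly f ?Q) i)" for v
  proof -
    have "poly (\<Sum>i<n. con (vec_index v i) * p_var ^ i) ?Q = (\<Sum>i<n. Polynomial.monom (vec_index v i) i)"
      by (simp add: con_p_var const_poly_sum)
    moreover have "poly.coeff (\<Sum>i<n. Polynomial.monom (vec_index v i) i) k = vec_index v k" if "k < n" for k
      using that by (simp add: Polynomial.coeff_sum)
    ultimately show ?thesis
      unfolding normal_form_iff by (auto simp: monom_1_dvd_iff' poly_diff)
  qed
  then show ?thesis
    unfolding coords_def by (intro the_equality) (simp_all only:, auto intro!: eq_vecI)
qed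

lemma coords_one: "n > 0 \<Longrightarrow> coords n (normal_form n m) 1 = unit_vec n 0"
  by (auto simp: coords_normal_form unit_vec_def intro!: eq_vecI)

lemma mult_mat_p_var:
  "mult_mat n (normal_form n m) p_var = Matrix.mat n n (\<lambda>(i, j). if i = j + 1 then 1 else 0)"
proof -
  have "p_var * p_var ^ j = [:Polynomial.monom 1 (Suc j):]" for j
    using p_var_power[of "Suc j"] by simp
  then show ?thesis unfolding mult_mat_def by (intro eq_matI) (auto simp: coords_normal_form)
qed

lemma mult_mat_pbar_var:
  "mult_mat n (normal_form n m) pbar_var =
     Matrix.mat n n (\<lambda>(i, j). if j < i then m (i - j + 1) else 0)"
proof -
  have "poly (pbar_var * p_var ^ j) Q = Polynomial.monom 1 j * Q" for j Q
    by (simp add: p_var_power pbar_var_def)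
  then show ?thesis
    unfolding mult_mat_def
    by (intro eq_matI) (auto simp: coords_normal_form coeff_monom_mult coeff_beltrami_poly)
qed


section \<open>Traces against powers of a nilpotent matrix\<close>

text \<open>The \<open>q\<close>-th power of the nilpotent shift \<open>shift_mat n 1\<close>, given by its entries.\<close>
definition shift_mat :: "nat \<Rightarrow> nat \<Rightarrow> complex mat" where
  "shift_mat n q = Matrix.mat n n (\<lambda>(i, j). if i = j + q then 1 else 0)"

lemma shift_mat_carrier [simp]: "shift_mat n q \<in> carrier_mat n n"
  by (simp add: shift_mat_def)

lemma shift_mat_0: "shift_mat n 0 = 1\<^sub>m n"
  by (auto simp: shift_mat_def)

lemma mult_carrier_square [simp]:
  fixes A B :: "complex mat"
  shows "A \<in> carrier_mat n n \<Longrightarrow> B \<in> carrier_mat n n \<Longrightarrow> A * B \<in> carrier_mat n n"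
  by (rule mult_carrier_mat)

lemma minus_carrier_square [simp]:
  fixes A B :: "complex mat"
  shows "A \<in> carrier_mat n n \<Longrightarrow> B \<in> carrier_mat n n \<Longrightarrow> A - B \<in> carrier_mat n n"
  by (rule minus_carrier_mat)

lemma mat_mult_index:
  "A \<in> carrier_mat n n \<Longrightarrow> B \<in> carrier_mat n n \<Longrightarrow> i < n \<Longrightarrow> j < n \<Longrightarrow>
     (A * B) $$ (i, j) = (\<Sum>k<n. A $$ (i, k) * B $$ (k, j))"
  by (simp add: scalar_prod_def atLeast0LessThan)

lemma shift_mat_add: "shift_mat n q * shift_mat n r = shift_mat n (q + r)"
proof (rule eq_matI)
  fix i j assume "i < dim_row (shift_mat n (q + r))" "j < dim_col (shift_mat n (q + r))"
  then have ij: "i < n" "j < n" by (simp_all add: shift_mat_def)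
  have "(shift_mat n q * shift_mat n r) $$ (i, j) =
      (\<Sum>k<n. if k = j + r then (if i = k + q then 1 else 0) else 0)"
    using ij unfolding mat_mult_index[OF shift_mat_carrier shift_mat_carrier ij]
    by (intro sum.cong refl) (auto simp: shift_mat_def)
  also have "\<dots> = shift_mat n (q + r) $$ (i, j)"
    using ij by (subst sum.delta) (auto simp: shift_mat_def)
  finally show "(shift_mat n q * shift_mat n r) $$ (i, j) = shift_mat n (q + r) $$ (i, j)" .
qed (simp_all add: shift_mat_def)

lemma shift_mat_add_left:
  assumes "B \<in> carrier_mat n n"
  shows "shift_mat n q * (shift_mat n r * B) = shift_mat n (q + r) * B"
  unfolding shift_mat_add[symmetric] by (rule assoc_mult_mat[symmetric, OF shift_mat_carrier shift_mat_carrier assms])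

lemma trace_add:
  "A \<in> carrier_mat n n \<Longrightarrow> B \<in> carrier_mat n n \<Longrightarrow> mat_trace (A + B) = mat_trace A + mat_trace B"
  by (simp add: mat_trace_def sum.distrib)

lemma trace_minus:
  "A \<in> carrier_mat n n \<Longrightarrow> B \<in> carrier_mat n n \<Longrightarrow> mat_trace (A - B) = mat_trace A - mat_trace B"
  by (simp add: mat_trace_def sum_subtractf)

lemma trace_smult: "mat_trace (c \<cdot>\<^sub>m A) = c * mat_trace A" if "A \<in> carrier_mat n n"
  using that by (simp add: mat_trace_def sum_distrib_left)

lemma trace_mult_index:
  assumes "A \<in> carrier_mat n n" "B \<in> carrier_mat n n"
  shows "mat_trace (A * B) = (\<Sum>i<n. \<Sum>k<n. A $$ (i, k) * B $$ (k, i))"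
proof -
  have "mat_trace (A * B) = (\<Sum>i<n. (A * B) $$ (i, i))"
    using assms by (simp add: mat_trace_def)
  then show ?thesis by (simp add: mat_mult_index[OF assms] del: index_mult_mat)
qed

lemma trace_comm:
  assumes "A \<in> carrier_mat n n" "B \<in> carrier_mat n n"
  shows "mat_trace (A * B) = mat_trace (B * A)"
  unfolding trace_mult_index[OF assms] trace_mult_index[OF assms(2,1)]
  by (subst sum.swap) (simp add: mult.commute)

lemma trace_shift_mult:
  assumes "A \<in> carrier_mat n n"
  shows "mat_trace (shift_mat n q * A) = (\<Sum>i<n - q. A $$ (i, i + q))"
proof -
  have "mat_trace (shift_mat n q * A) = (\<Sum>k<n. \<Sum>i<n. shift_mat n q $$ (i, k) * A $$ (k, i))"
    by (subst sum.swap) (simp add: trace_mult_index[OF _ assms])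
  also have "\<dots> = (\<Sum>k<n. \<Sum>i<n. if i = k + q then A $$ (k, i) else 0)"
    by (intro sum.cong refl) (simp add: shift_mat_def)
  also have "\<dots> = (\<Sum>k<n. if k + q < n then A $$ (k, k + q) else 0)"
    by (intro sum.cong refl) simp
  also have "\<dots> = (\<Sum>k\<in>{k \<in> {..<n}. k + q < n}. A $$ (k, k + q))"
    by (subst sum.inter_filter) auto
  also have "{k \<in> {..<n}. k + q < n} = {..<n - q}" by auto
  finally show ?thesis .
qed

text \<open>The commutator \<open>[A, N ^ p]\<close> is the sum of the \<open>N ^ i [A, N] N ^ (p - 1 - i)\<close>, and the trace is
  cyclic. So traces against \<open>[A, N ^ p]\<close> can be computed from \<open>[A, N]\<close> alone, which \<open>d\<^sub>A \<Phi> = 0\<close>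
  determines for \<open>A = A\<^sub>2\<close>.\<close>

lemma trace_comm_power:
  assumes A: "A \<in> carrier_mat n n"
  shows "Y \<in> carrier_mat n n \<Longrightarrow> mat_trace (Y * (A * shift_mat n p - shift_mat n p * A)) =
    (\<Sum>i<p. mat_trace (shift_mat n (p - 1 - i) * Y * shift_mat n i * (A * shift_mat n 1 - shift_mat n 1 * A)))"
proof (induction p arbitrary: Y)
  case 0
  then show ?case using A by (simp add: shift_mat_0 mat_trace_def)
next
  case (Suc p)
  note Y = Suc.prems
  let ?N = "shift_mat n 1" and ?P = "shift_mat n p"
  have pow: "shift_mat n (Suc p) = ?N * ?P" by (simp add: shift_mat_add)
  note distr = assoc_mult_mat[of _ n n _ n _ n] mult_minus_distrib_mat[of _ n n _ n]
    minus_mult_distrib_mat[of _ n n _ _ n] trace_minus[of _ n]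
  have c: "mat_trace (Y * (A * (?N * ?P))) = mat_trace (?P * (Y * (A * ?N)))"
    using Y A trace_comm[of "Y * (A * ?N)" n "?P"] by (simp add: distr del: One_nat_def)
  have d: "mat_trace (Y * (?N * (A * ?P))) = mat_trace (?P * (Y * (?N * A)))"
    using Y A trace_comm[of "Y * (?N * A)" n "?P"] by (simp add: distr del: One_nat_def)
  have "mat_trace (Y * (A * shift_mat n (Suc p) - shift_mat n (Suc p) * A)) =
      mat_trace (?P * Y * (A * ?N - ?N * A)) + mat_trace (Y * ?N * (A * ?P - ?P * A))"
    unfolding pow using Y A c d by (simp add: distr del: One_nat_def)
  also have "mat_trace (Y * ?N * (A * ?P - ?P * A)) =
      (\<Sum>i<p. mat_trace (shift_mat n (p - 1 - i) * (Y * ?N) * shift_mat n i * (A * ?N - ?N * A)))"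
    using Y by (intro Suc.IH) simp
  also have "\<dots> = (\<Sum>i<p. mat_trace (shift_mat n (p - Suc i) * Y * shift_mat n (Suc i) * (A * ?N - ?N * A)))"
    using Y A by (intro sum.cong refl) (simp add: distr shift_mat_add shift_mat_add_left)
  also have "mat_trace (?P * Y * (A * ?N - ?N * A)) + \<dots> =
      (\<Sum>i<Suc p. mat_trace (shift_mat n (Suc p - 1 - i) * Y * shift_mat n i * (A * ?N - ?N * A)))"
    using Y by (subst sum.lessThan_Suc_shift) (simp add: distr shift_mat_0 right_mult_one_mat[of _ n n])
  finally show ?case .
qed

text \<open>For \<open>A = A\<^sub>1\<close> and \<open>q = k - 1\<close> this is the covector component \<open>t\<^sub>k\<close>.\<close>
definition tau :: "nat \<Rightarrow> nat \<Rightarrow> complex mat \<Rightarrow> complex" where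
  "tau n q A = mat_trace (shift_mat n q * A)"

definition grading_mat :: "nat \<Rightarrow> complex mat" where
  "grading_mat n = Matrix.mat n n (\<lambda>(i, j). if i = j then of_nat i else 0)"

lemma grading_mat_carrier [simp]: "grading_mat n \<in> carrier_mat n n"
  by (simp add: grading_mat_def)

text \<open>The degree operator makes every positive power of \<open>N\<close> a commutator with that power.\<close>
lemma grading_mat_comm:
  "grading_mat n * shift_mat n q - shift_mat n q * grading_mat n = of_nat q \<cdot>\<^sub>m shift_mat n q"
proof (rule eq_matI)
  fix i j assume "i < dim_row (of_nat q \<cdot>\<^sub>m shift_mat n q)" "j < dim_col (of_nat q \<cdot>\<^sub>m shift_mat n q)"
  then have ij: "i < n" "j < n" by (simp_all add: shift_mat_def)
  have "(grading_mat n * shift_mat n q) $$ (i, j) =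
      (\<Sum>k<n. if k = i then of_nat i * (if i = j + q then 1 else 0) else 0)"
    using ij unfolding mat_mult_index[OF grading_mat_carrier shift_mat_carrier ij]
    by (intro sum.cong refl) (auto simp: shift_mat_def grading_mat_def)
  moreover have "(shift_mat n q * grading_mat n) $$ (i, j) =
      (\<Sum>k<n. if k = j then of_nat j * (if i = j + q then 1 else 0) else 0)"
    using ij unfolding mat_mult_index[OF shift_mat_carrier grading_mat_carrier ij]
    by (intro sum.cong refl) (auto simp: shift_mat_def grading_mat_def)
  ultimately show "(grading_mat n * shift_mat n q - shift_mat n q * grading_mat n) $$ (i, j) =
      (of_nat q \<cdot>\<^sub>m shift_mat n q) $$ (i, j)"
    using ij by (simp add: shift_mat_def grading_mat_def del: index_mult_mat(1))
qed (simp_all add: shift_mat_def grading_mat_def)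

lemma trace_grading_shift: "q > 0 \<Longrightarrow> mat_trace (shift_mat n q * grading_mat n) = 0"
  by (simp add: trace_shift_mult grading_mat_def)

text \<open>The matrix \<open>\<Sum>\<^sub>k m\<^sub>k N ^ (k - 1)\<close>, which is constant along the diagonals.\<close>
definition shift_poly :: "nat \<Rightarrow> (nat \<Rightarrow> complex) \<Rightarrow> complex mat" where
  "shift_poly n m = Matrix.mat n n (\<lambda>(i, j). if j < i then m (i - j + 1) else 0)"

lemma shift_poly_carrier [simp]: "shift_poly n m \<in> carrier_mat n n"
  by (simp add: shift_poly_def)

lemma shift_poly_index:
  assumes "i < n" "j < n"
  shows "shift_poly n m $$ (i, j) = (\<Sum>k=2..n. m k * shift_mat n (k - 1) $$ (i, j))"
proof -
  have "(\<Sum>k=2..n. m k * shift_mat n (k - 1) $$ (i, j)) =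
      (\<Sum>k=2..n. if k = i - j + 1 then (if j < i then m k else 0) else 0)"
    using assms by (intro sum.cong refl) (auto simp: shift_mat_def)
  also have "\<dots> = shift_poly n m $$ (i, j)"
    using assms by (subst sum.delta) (auto simp: shift_poly_def)
  finally show ?thesis ..
qed

lemma trace_mult_shift_poly:
  assumes "Y \<in> carrier_mat n n"
  shows "mat_trace (Y * shift_poly n m) = (\<Sum>k=2..n. m k * mat_trace (Y * shift_mat n (k - 1)))"
proof -
  have "(\<Sum>k=2..n. m k * mat_trace (Y * shift_mat n (k - 1))) =
      (\<Sum>k=2..n. \<Sum>i<n. \<Sum>j<n. m k * (Y $$ (i, j) * shift_mat n (k - 1) $$ (j, i)))"
    unfolding trace_mult_index[OF assms shift_mat_carrier] by (simp add: sum_distrib_left)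
  also have "\<dots> = (\<Sum>i<n. \<Sum>k=2..n. \<Sum>j<n. m k * (Y $$ (i, j) * shift_mat n (k - 1) $$ (j, i)))"
    by (rule sum.swap)
  also have "\<dots> = (\<Sum>i<n. \<Sum>j<n. \<Sum>k=2..n. m k * (Y $$ (i, j) * shift_mat n (k - 1) $$ (j, i)))"
    by (intro sum.cong refl sum.swap)
  also have "\<dots> = mat_trace (Y * shift_poly n m)"
    unfolding trace_mult_index[OF assms shift_poly_carrier]
    by (intro sum.cong refl) (simp add: shift_poly_index sum_distrib_left algebra_simps)
  finally show ?thesis ..
qed

lemmas mat_distr = assoc_mult_mat[of _ n n _ n _ n] mult_minus_distrib_mat[of _ n n _ n]
    minus_mult_distrib_mat[of _ n n _ _ n] add_mult_distrib_mat[of _ n n _ _ n]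
    mult_add_distrib_mat[of _ n n _ n] for n

lemma trace_comm_shift_poly:
  assumes "Y \<in> carrier_mat n n" "A \<in> carrier_mat n n"
  shows "mat_trace (Y * (A * shift_poly n m - shift_poly n m * A)) =
    (\<Sum>k=2..n. m k * mat_trace (Y * (A * shift_mat n (k - 1) - shift_mat n (k - 1) * A)))"
proof -
  have *: "mat_trace (Y * (A * F - F * A)) = mat_trace ((Y * A) * F) - mat_trace ((A * Y) * F)"
    if "F \<in> carrier_mat n n" for F
    using assms that trace_comm[of "Y * F" n A] by (simp add: mat_distr[where n=n] trace_minus[of _ n])
  show ?thesis
    using assms by (simp only: *[OF shift_poly_carrier] *[OF shift_mat_carrier] trace_mult_shift_poly
        mult_carrier_square right_diff_distrib sum_subtractf)
qed

text \<open>With \<open>q N ^ q = [H, N ^ q]\<close>, where \<open>H\<close> is the degree operator, the trace of \<open>q N ^ q A\<^sub>2\<close> becomes a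
  trace of \<open>H\<close> against \<open>[A\<^sub>2, N ^ q]\<close>, hence of conjugates of \<open>H\<close> by powers of \<open>N\<close> against
  \<open>[A\<^sub>2, N] = dF + [A\<^sub>1, F]\<close>. Here \<open>dF\<close> contributes nothing, because \<open>H\<close> is orthogonal to the positive
  powers of \<open>N\<close>, and in \<open>[A\<^sub>1, F]\<close> the commutator can be moved back onto \<open>H\<close>.\<close>

lemma tau_second_component:
  assumes A1: "A1 \<in> carrier_mat n n" and A2: "A2 \<in> carrier_mat n n" and q: "q > 0"
    and comm: "A2 * shift_mat n 1 - shift_mat n 1 * A2 =
      shift_poly n dm + (A1 * shift_poly n m - shift_poly n m * A1)"
  shows "tau n q A2 = (\<Sum>k=2..n. of_nat (k - 1) * m k * tau n (q + k - 2) A1)"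
proof -
  let ?H = "grading_mat n" and ?S = "shift_mat n"
  have summand: "mat_trace (?S (q - 1 - i) * ?H * ?S i *
      (shift_poly n dm + (A1 * shift_poly n m - shift_poly n m * A1))) =
      - (\<Sum>k=2..n. of_nat (k - 1) * m k * tau n (q + k - 2) A1)" if i: "i < q" for i
  proof -
    define Y where "Y = ?S (q - 1 - i) * ?H * ?S i"
    have Y: "Y \<in> carrier_mat n n" by (simp add: Y_def)
    have 1: "mat_trace (Y * ?S (k - 1)) = 0" if "k \<in> {2..n}" for k
    proof -
      have "mat_trace (Y * ?S (k - 1)) = mat_trace (?S (q - 1 - i) * (?H * ?S (i + (k - 1))))"
        by (simp add: Y_def mat_distr[where n=n] shift_mat_add)
      also have "\<dots> = mat_trace (?S (i + (k - 1) + (q - 1 - i)) * ?H)"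
        using trace_comm[of "?S (q - 1 - i) * ?H" n "?S (i + (k - 1))"]
        by (simp add: mat_distr[where n=n] shift_mat_add_left)
      also have "\<dots> = 0" using that by (intro trace_grading_shift) auto
      finally show ?thesis .
    qed
    have 2: "mat_trace (Y * (A1 * ?S r - ?S r * A1)) = - (of_nat r * tau n (q - 1 + r) A1)" for r
    proof -
      have "mat_trace (Y * (A1 * ?S r - ?S r * A1)) = - mat_trace ((Y * ?S r - ?S r * Y) * A1)"
        using Y A1 trace_comm[of "Y * A1" n "?S r"] by (simp add: mat_distr[where n=n] trace_minus[of _ n])
      also have "Y * ?S r - ?S r * Y = ?S (q - 1 - i) * (?H * ?S r - ?S r * ?H) * ?S i"
        by (simp add: Y_def mat_distr[where n=n] shift_mat_add shift_mat_add_left add.commute)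
      also have "\<dots> = of_nat r \<cdot>\<^sub>m ?S (q - 1 + r)"
        unfolding grading_mat_comm using i
        by (simp add: mult_smult_distrib[of _ n n _ n] mult_smult_assoc_mat[of _ n n _ n] shift_mat_add)
      finally show ?thesis
        using A1 by (simp add: tau_def mult_smult_assoc_mat[of _ n n _ n] trace_smult[of _ n])
    qed
    have "mat_trace (Y * (shift_poly n dm + (A1 * shift_poly n m - shift_poly n m * A1))) =
        mat_trace (Y * shift_poly n dm) + mat_trace (Y * (A1 * shift_poly n m - shift_poly n m * A1))"
      using Y A1 by (simp add: mat_distr[where n=n] trace_add[of _ n] trace_minus[of _ n])
    also have "\<dots> = (\<Sum>k=2..n. m k * - (of_nat (k - 1) * tau n (q - 1 + (k - 1)) A1))"
      using Y A1 by (simp add: trace_mult_shift_poly trace_comm_shift_poly 1 2 del: One_nat_def)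
    also have "\<dots> = - (\<Sum>k=2..n. of_nat (k - 1) * m k * tau n (q + k - 2) A1)"
      unfolding sum_negf[symmetric]
    proof (intro sum.cong refl)
      fix k assume "k \<in> {2..n}"
      then have "q - 1 + (k - 1) = q + k - 2" using q by auto
      then show "m k * - (of_nat (k - 1) * tau n (q - 1 + (k - 1)) A1) =
          - (of_nat (k - 1) * m k * tau n (q + k - 2) A1)" by simp
    qed
    finally show ?thesis unfolding Y_def .
  qed
  have "of_nat q * tau n q A2 = mat_trace ((?H * ?S q - ?S q * ?H) * A2)"
    unfolding grading_mat_comm tau_def using A2
    by (simp add: mult_smult_assoc_mat[of _ n n _ n] trace_smult[of _ n])
  also have "\<dots> = - mat_trace (?H * (A2 * ?S q - ?S q * A2))"
    using A2 trace_comm[of "?H * A2" n "?S q"] by (simp add: mat_distr[where n=n] trace_minus[of _ n])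
  also have "\<dots> = of_nat q * (\<Sum>k=2..n. of_nat (k - 1) * m k * tau n (q + k - 2) A1)"
    unfolding trace_comm_power[OF A2 grading_mat_carrier] comm
    by (subst sum.cong[OF refl summand]) auto
  finally show ?thesis using q by simp
qed

text \<open>The trace of \<open>N ^ q [A\<^sub>1, A\<^sub>2]\<close> is that of \<open>A\<^sub>1 [A\<^sub>2, N ^ q]\<close>, hence a sum of traces against
  \<open>[A\<^sub>2, N] = dF + [A\<^sub>1, F]\<close>. The part with \<open>dF\<close> is the right hand side; the part with \<open>[A\<^sub>1, F]\<close>
  is a sum of differences of \<open>W a b = tr (N ^ a A\<^sub>1 N ^ b A\<^sub>1)\<close> that cancel since \<open>W\<close> is symmetric.\<close>
lemma tau_commutator:
  assumes A1: "A1 \<in> carrier_mat n n" and A2: "A2 \<in> carrier_mat n n" and q: "q > 0"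
    and comm: "A2 * shift_mat n 1 - shift_mat n 1 * A2 =
      shift_poly n dm + (A1 * shift_poly n m - shift_poly n m * A1)"
  shows "tau n q (A1 * A2 - A2 * A1) = of_nat q * (\<Sum>k=2..n. dm k * tau n (q + k - 2) A1)"
proof -
  let ?S = "shift_mat n"
  define W where "W a b = mat_trace (?S a * (A1 * (?S b * A1)))" for a b
  have W_sym: "W a b = W b a" for a b
    using A1 trace_comm[of "?S a * A1" n "?S b * A1"] by (simp add: W_def mat_distr[where n=n])
  have summand: "mat_trace (?S (q - 1 - i) * A1 * ?S i *
      (shift_poly n dm + (A1 * shift_poly n m - shift_poly n m * A1))) =
      (\<Sum>k=2..n. dm k * tau n (q + k - 2) A1) +
      (\<Sum>k=2..n. m k * (W (q - 1 - i + (k - 1)) i - W (q - 1 - i) (i + (k - 1))))" if i: "i < q" for i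
  proof -
    define Y where "Y = ?S (q - 1 - i) * A1 * ?S i"
    have Y: "Y \<in> carrier_mat n n" using A1 by (simp add: Y_def)
    have 1: "mat_trace (Y * ?S (k - 1)) = tau n (q + k - 2) A1" if "k \<in> {2..n}" for k
    proof -
      have "mat_trace (Y * ?S (k - 1)) = mat_trace (?S (i + (k - 1) + (q - 1 - i)) * A1)"
        using A1 trace_comm[of "?S (q - 1 - i) * A1" n "?S (i + (k - 1))"]
        by (simp add: Y_def mat_distr[where n=n] shift_mat_add shift_mat_add_left)
      also have "i + (k - 1) + (q - 1 - i) = q + k - 2" using i that by auto
      finally show ?thesis by (simp add: tau_def)
    qed
    have 2: "mat_trace (Y * (A1 * ?S r - ?S r * A1)) = W (q - 1 - i + r) i - W (q - 1 - i) (i + r)" for r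
      using A1 trace_comm[of "?S (q - 1 - i) * (A1 * (?S i * A1))" n "?S r"]
      by (simp add: Y_def W_def mat_distr[where n=n] shift_mat_add shift_mat_add_left trace_minus[of _ n] add.commute)
    have "mat_trace (Y * (shift_poly n dm + (A1 * shift_poly n m - shift_poly n m * A1))) =
        mat_trace (Y * shift_poly n dm) + mat_trace (Y * (A1 * shift_poly n m - shift_poly n m * A1))"
      using Y A1 by (simp add: mat_distr[where n=n] trace_add[of _ n] trace_minus[of _ n])
    then show ?thesis
      using Y A1 unfolding Y_def[symmetric]
      by (simp add: trace_mult_shift_poly trace_comm_shift_poly 1 2 del: One_nat_def)
  qed
  have cancel: "(\<Sum>i<q. W (q - 1 - i + r) i - W (q - 1 - i) (i + r)) = 0" for r
  proof -
    have "(\<Sum>i<q. W (q - 1 - i) (i + r)) = (\<Sum>i<q. W (q - 1 - (q - Suc i)) (q - Suc i + r))"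
      by (rule sum.nat_diff_reindex[symmetric])
    also have "\<dots> = (\<Sum>i<q. W (q - 1 - i + r) i)"
      by (intro sum.cong refl) (simp add: W_sym)
    finally show ?thesis by (simp add: sum_subtractf)
  qed
  have "tau n q (A1 * A2 - A2 * A1) = mat_trace (A1 * (A2 * ?S q - ?S q * A2))"
    using A1 A2 trace_comm[of "A1 * A2" n "?S q"] trace_comm[of "A1" n "?S q * A2"]
    by (simp add: tau_def mat_distr[where n=n] trace_minus[of _ n])
  also have "\<dots> = (\<Sum>i<q. (\<Sum>k=2..n. dm k * tau n (q + k - 2) A1) +
      (\<Sum>k=2..n. m k * (W (q - 1 - i + (k - 1)) i - W (q - 1 - i) (i + (k - 1)))))"
    unfolding trace_comm_power[OF A2 A1] comm by (intro sum.cong refl summand) simp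
  also have "\<dots> = of_nat q * (\<Sum>k=2..n. dm k * tau n (q + k - 2) A1) +
      (\<Sum>k=2..n. m k * (\<Sum>i<q. W (q - 1 - i + (k - 1)) i - W (q - 1 - i) (i + (k - 1))))"
    unfolding sum.distrib by (subst sum.swap[of _ "{2..n}"]) (simp add: sum_distrib_left)
  finally show ?thesis unfolding cancel by simp
qed

text \<open>\<open>B1\<close> and \<open>B2\<close> stand for \<open>dbar A\<^sub>1\<close> and \<open>\<partial> A\<^sub>2\<close>. Since \<open>N ^ q\<close> commutes with \<open>N\<close> and with every
  polynomial in \<open>N\<close>, the two commutators that involve \<open>\<Psi>\<close> have trace zero against it.\<close>
lemma tau_dbar:
  assumes carr: "A1 \<in> carrier_mat n n" "A2 \<in> carrier_mat n n" "P1 \<in> carrier_mat n n"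
      "P2 \<in> carrier_mat n n" "B1 \<in> carrier_mat n n" "B2 \<in> carrier_mat n n" and q: "q > 0"
    and comm: "A2 * shift_mat n 1 - shift_mat n 1 * A2 =
      shift_poly n dm + (A1 * shift_poly n m - shift_poly n m * A1)"
    and curv: "B2 - B1 + (A1 * A2 - A2 * A1) + (shift_mat n 1 * P2 - P2 * shift_mat n 1)
      + (P1 * shift_poly n m - shift_poly n m * P1) = 0\<^sub>m n n"
  shows "tau n q B1 = tau n q B2 + of_nat q * (\<Sum>k=2..n. dm k * tau n (q + k - 2) A1)"
proof -
  let ?S = "shift_mat n" and ?F = "shift_poly n m"
  have "0 = tau n q (B2 - B1 + (A1 * A2 - A2 * A1) + (?S 1 * P2 - P2 * ?S 1) + (P1 * ?F - ?F * P1))"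
    unfolding curv tau_def right_mult_zero_mat[OF shift_mat_carrier] by (simp add: mat_trace_def)
  also have "\<dots> = tau n q B2 - tau n q B1 + tau n q (A1 * A2 - A2 * A1)
      + tau n q (?S 1 * P2 - P2 * ?S 1) + tau n q (P1 * ?F - ?F * P1)"
    using carr by (simp add: tau_def mat_distr[where n=n] trace_add[of _ n] trace_minus[of _ n])
  also have "tau n q (?S 1 * P2 - P2 * ?S 1) = 0"
    using carr trace_comm[of "?S q * P2" n "?S 1"]
    by (simp add: tau_def mat_distr[where n=n] trace_minus[of _ n] shift_mat_add_left)
  also have "tau n q (P1 * ?F - ?F * P1) = 0"
  proof -
    have "tau n q (P1 * ?F - ?F * P1) =
        (\<Sum>k=2..n. m k * mat_trace (?S q * (P1 * ?S (k - 1) - ?S (k - 1) * P1)))"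
      unfolding tau_def by (rule trace_comm_shift_poly) (use carr in auto)
    also have "\<dots> = 0"
    proof (intro sum.neutral ballI)
      fix k
      show "m k * mat_trace (?S q * (P1 * ?S (k - 1) - ?S (k - 1) * P1)) = 0"
        using carr trace_comm[of "?S q * P1" n "?S (k - 1)"]
        by (simp add: mat_distr[where n=n] trace_minus[of _ n] shift_mat_add_left add.commute)
    qed
    finally show ?thesis .
  qed
  finally show ?thesis using tau_commutator[OF carr(1,2) q comm] by (simp add: algebra_simps)
qed


section \<open>The local pencil and its rescaled frame\<close>

lemma permutes_less: "p permutes {0..<n} \<Longrightarrow> i < n \<Longrightarrow> p i < (n :: nat)"
  using permutes_in_image[of p "{0..<n}" i] by simp

text \<open>The situation over one chart with image \<open>D\<close>: \<open>e\<close> spans the line subbundle, \<open>F1, F2\<close> are the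
  components of \<open>\<Phi>\<close>, and \<open>P1, P2\<close> those of \<open>\<Psi>\<close>. The values of these functions are prescribed on \<open>D\<close>
  only, as are those of \<^const>\<open>unit_section\<close>, \<^const>\<open>\<Phi>1\<close> and \<^const>\<open>\<Phi>2\<close>.\<close>
locale local_pencil =
  fixes n :: nat and D :: "complex set" and e :: "complex \<Rightarrow> complex vec"
    and \<omega> :: "complex \<Rightarrow> complex" and m :: "nat \<Rightarrow> complex \<Rightarrow> complex"
    and F1 F2 A1 A2 P1 P2 :: "complex \<Rightarrow> complex mat"
  assumes n: "n \<ge> 2" and D: "open D"
    and e: "\<And>w. w \<in> D \<Longrightarrow> e w = unit_vec n 0"
    and F1: "\<And>w. w \<in> D \<Longrightarrow> F1 w = shift_mat n 1"
    and F2: "\<And>w. w \<in> D \<Longrightarrow> F2 w = shift_poly n (\<lambda>k. m k w)"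
    and A1: "smooth_mat_on n D A1" and A2: "smooth_mat_on n D A2"
    and P1: "smooth_mat_on n D P1" and P2: "smooth_mat_on n D P2"
    and vol: "smooth_on D \<omega>" "\<And>w. w \<in> D \<Longrightarrow> \<omega> w \<noteq> 0"
      "\<And>w. w \<in> D \<Longrightarrow> d_z \<omega> w = mat_trace (A1 w) * \<omega> w"
    and trace_P1: "\<And>w. w \<in> D \<Longrightarrow> mat_trace (P1 w) = 0"
begin

text \<open>The entries of \<open>h\<close> times the \<open>dz\<close> component of the pencil at \<open>\<lambda> = 1 / h\<close>.\<close>
definition conn :: "nat \<Rightarrow> nat \<Rightarrow> complex \<Rightarrow> complex \<Rightarrow> complex" where
  "conn i l h w = (if i = l + 1 then 1 else 0) + h * A1 w $$ (i, l) + h\<^sup>2 * P1 w $$ (i, l)"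

text \<open>The \<open>i\<close>-th component of \<open>(h \<nabla> + h a) ^ j e\<close>. For \<open>a = 0\<close> these are the rescaled derivatives of
  \<open>e\<close>; the derivatives of \<open>f e\<close> are those for \<open>a = \<partial> f / f\<close>, up to the factor \<open>f\<close>.\<close>
primrec frame :: "(complex \<Rightarrow> complex \<Rightarrow> complex) \<Rightarrow> nat \<Rightarrow> nat \<Rightarrow> complex \<Rightarrow> complex \<Rightarrow> complex" where
  "frame a 0 = (\<lambda>i h w. if i = 0 then 1 else 0)"
| "frame a (Suc j) = (\<lambda>i h w. h * d_z (frame a j i h) w + (\<Sum>l<n. conn i l h w * frame a j l h w)
     + h * a h w * frame a j i h w)"

abbreviation "frame0 \<equiv> frame (\<lambda>h w. 0)"

definition wronskian :: "complex \<Rightarrow> complex \<Rightarrow> complex" where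
  "wronskian h w = \<omega> w * Determinant.det (Matrix.mat n n (\<lambda>(i, j). frame0 j i h w))"

text \<open>The coefficient of \<open>h\<close> in \<open>frame a j i\<close>: the \<open>i\<close>-th component of
  \<open>\<Sum>\<^sub>q\<^sub><\<^sub>j N ^ q (A\<^sub>1 + a) N ^ (j - 1 - q) e\<close>.\<close>
definition slope :: "(complex \<Rightarrow> complex \<Rightarrow> complex) \<Rightarrow> nat \<Rightarrow> nat \<Rightarrow> complex \<Rightarrow> complex \<Rightarrow> complex" where
  "slope a j i h w = (\<Sum>q<j. if q \<le> i then A1 w $$ (i - q, j - 1 - q) else 0)
     + (if i + 1 = j then of_nat j * a h w else 0)"

end

text \<open>\<open>H\<close> is the range of \<open>h = 1 / \<lambda>\<close> and \<open>W\<close> a neighbourhood on which the coefficients are bounded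
  with all their derivatives.\<close>
locale pencil_on = local_pencil +
  fixes H W :: "complex set"
  assumes H: "bounded H" and W: "open W" "W \<subseteq> D"
    and A1_family: "i < n \<Longrightarrow> l < n \<Longrightarrow> smooth_family H W (\<lambda>h w. A1 w $$ (i, l))"
    and P1_family: "i < n \<Longrightarrow> l < n \<Longrightarrow> smooth_family H W (\<lambda>h w. P1 w $$ (i, l))"
    and vol_family: "smooth_family H W (\<lambda>h. \<omega>)"
begin

lemma h_family: "smooth_family H W (\<lambda>h w. h)"
  using smooth_family_param[of "\<lambda>h. h" H W] H by simp

lemma h2_family: "smooth_family H W (\<lambda>h w. h\<^sup>2)"
  using smooth_family_mult[OF W(1) h_family h_family] by (simp add: power2_eq_square)

lemmas fam = smooth_family_add[OF W(1)] smooth_family_mult[OF W(1)] smooth_family_sum[OF W(1)]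
  smooth_family_const h_family h2_family smooth_family_derivation[OF W(1) derivation_d_z]
  smooth_family_derivation[OF W(1) derivation_d_zbar]

lemma conn_family: "i < n \<Longrightarrow> l < n \<Longrightarrow> smooth_family H W (conn i l)"
  unfolding conn_def by (intro fam A1_family P1_family)

lemma frame_family:
  assumes a: "smooth_family H W a"
  shows "i < n \<Longrightarrow> smooth_family H W (frame a j i)"
proof (induction j arbitrary: i)
  case (Suc j)
  show ?case unfolding frame.simps by (intro fam Suc conn_family a) auto
qed (simp add: fam)

lemma slope_family:
  assumes a: "smooth_family H W a" and "i < n" "j \<le> n"
  shows "smooth_family H W (slope a j i)"
proof -
  have 1: "smooth_family H W (\<lambda>h w. if q \<le> i then A1 w $$ (i - q, j - 1 - q) else 0)" if "q < j" for q
    using assms that by (cases "q \<le> i") (auto intro!: A1_family fam)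
  have 2: "smooth_family H W (\<lambda>h w. if i + 1 = j then of_nat j * a h w else 0)"
    by (cases "i + 1 = j") (auto intro!: fam a)
  show ?thesis unfolding slope_def by (intro fam 1 2) auto
qed

lemma slope_Suc:
  assumes "i < n" "j < n"
  shows "(\<Sum>l<n. (if i = l + 1 then 1 else 0) * slope a j l h w)
      + A1 w $$ (i, j) + a h w * (if i = j then 1 else 0) = slope a (Suc j) i h w"
proof (cases i)
  case 0
  have "(\<Sum>q<Suc j. if q \<le> 0 then A1 w $$ (0 - q, Suc j - 1 - q) else 0) = A1 w $$ (0, j)"
    by (subst sum.lessThan_Suc_shift) simp
  then show ?thesis using 0 by (simp add: slope_def)
next
  case (Suc i')
  have "(\<Sum>l<n. (if i = l + 1 then 1 else 0) * slope a j l h w) =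
      (\<Sum>l<n. if l = i' then slope a j l h w else 0)"
    using Suc by (intro sum.cong) auto
  also have "\<dots> = slope a j i' h w" using Suc assms by (subst sum.delta) auto
  finally have *: "(\<Sum>l<n. (if i = l + 1 then 1 else 0) * slope a j l h w) = slope a j i' h w" .
  have "(\<Sum>q<Suc j. if q \<le> i then A1 w $$ (i - q, Suc j - 1 - q) else 0) =
     A1 w $$ (i, j) + (\<Sum>q<j. if q \<le> i' then A1 w $$ (i' - q, j - 1 - q) else 0)"
    using Suc by (subst sum.lessThan_Suc_shift) (auto intro!: sum.cong)
  then show ?thesis unfolding * using Suc by (auto simp: slope_def algebra_simps)
qed

text \<open>The derivative in the recursion for \<^const>\<open>frame\<close> enters with a factor \<open>h\<close>, and the leading term
  \<open>N ^ j e\<close> is constant. So the first order term is purely algebraic, and the derivatives of \<open>a\<close>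
  and \<open>A\<^sub>1\<close> are confined to the remainder.\<close>
lemma frame_expansion:
  assumes a: "smooth_family H W a"
  shows "j \<le> n \<Longrightarrow> \<exists>R. \<forall>i<n. smooth_family H W (R i) \<and> (\<forall>h\<in>H. \<forall>w\<in>W.
     frame a j i h w = (if i = j then 1 else 0) + h * slope a j i h w + h\<^sup>2 * R i h w)"
proof (induction j)
  case 0
  show ?case by (rule exI[of _ "\<lambda>i h w. 0"]) (auto simp: slope_def fam)
next
  case (Suc j)
  then obtain R where R: "\<And>i. i < n \<Longrightarrow> smooth_family H W (R i)"
    and eq: "\<And>i h w. i < n \<Longrightarrow> h \<in> H \<Longrightarrow> w \<in> W \<Longrightarrow>
      frame a j i h w = (if i = j then 1 else 0) + h * slope a j i h w + h\<^sup>2 * R i h w"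
    by (metis Suc_leD)
  have j: "j < n" using Suc.prems by simp
  have S: "smooth_family H W (slope a j i)" if "i < n" for i
    using that j by (intro slope_family a) auto
  define R' where "R' i h w = d_z (slope a j i h) w + h * d_z (R i h) w
    + (\<Sum>l<n. (if i = l + 1 then 1 else 0) * R l h w + A1 w $$ (i, l) * slope a j l h w
        + h * (A1 w $$ (i, l) * R l h w) + P1 w $$ (i, l) * frame a j l h w)
    + a h w * slope a j i h w + h * (a h w * R i h w)" for i h w
  have "smooth_family H W (R' i)" if "i < n" for i
    unfolding R'_def using that by (intro fam a R S A1_family P1_family frame_family) auto
  moreover have "frame a (Suc j) i h w =
      (if i = Suc j then 1 else 0) + h * slope a (Suc j) i h w + h\<^sup>2 * R' i h w"
    if i: "i < n" and h: "h \<in> H" and w: "w \<in> W" for i h w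
  proof -
    have diff: "slope a j i h differentiable at w" "R i h differentiable at w"
      using smooth_family_differentiable[OF S[OF i] h w] smooth_family_differentiable[OF R[OF i] h w] .
    have "d_z (frame a j i h) w =
        d_z (\<lambda>w. (if i = j then 1 else 0) + (h * slope a j i h w + h\<^sup>2 * R i h w)) w"
      using smooth_family_differentiable[OF frame_family[OF a i] h w] eq[OF i h]
      by (intro derivation_cong_open[OF derivation_d_z _ W(1) w]) (auto simp: add.assoc)
    also have "\<dots> = h * d_z (slope a j i h) w + h\<^sup>2 * d_z (R i h) w"
      using diff by (simp add: derivation_add[OF derivation_d_z] derivation_const[OF derivation_d_z]
          derivation_cmult[OF derivation_d_z])
    finally have d: "d_z (frame a j i h) w = h * d_z (slope a j i h) w + h\<^sup>2 * d_z (R i h) w" .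
    have "(\<Sum>l<n. conn i l h w * frame a j l h w) =
      (\<Sum>l<n. (if i = l + 1 then 1 else 0) * (if l = j then 1 else 0)
        + h * ((if i = l + 1 then 1 else 0) * slope a j l h w)
        + h * (A1 w $$ (i, l) * (if l = j then 1 else 0))
        + h\<^sup>2 * ((if i = l + 1 then 1 else 0) * R l h w + A1 w $$ (i, l) * slope a j l h w
        + h * (A1 w $$ (i, l) * R l h w) + P1 w $$ (i, l) * frame a j l h w))"
      unfolding conn_def
      by (intro sum.cong refl) (simp add: eq[OF _ h w] algebra_simps power2_eq_square)
    also have "\<dots> = (\<Sum>l<n. (if i = l + 1 then 1 else 0) * (if l = j then 1 else 0))
        + h * (\<Sum>l<n. (if i = l + 1 then 1 else 0) * slope a j l h w)
        + h * (\<Sum>l<n. A1 w $$ (i, l) * (if l = j then 1 else 0))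
        + h\<^sup>2 * (\<Sum>l<n. (if i = l + 1 then 1 else 0) * R l h w + A1 w $$ (i, l) * slope a j l h w
        + h * (A1 w $$ (i, l) * R l h w) + P1 w $$ (i, l) * frame a j l h w)"
      by (simp only: sum_distrib_left sum.distrib[symmetric])
    also have "(\<Sum>l<n. (if i = l + 1 then 1 else 0) * (if l = j then 1 else 0)) =
        (if i = Suc j then 1 else (0::complex))"
    proof -
      have "(\<Sum>l<n. (if i = l + 1 then 1 else 0) * (if l = j then 1 else 0)) =
        (\<Sum>l<n. if l = j then (if i = Suc j then 1 else (0::complex)) else 0)"
        by (intro sum.cong) auto
      then show ?thesis using j by simp
    qed
    also have "(\<Sum>l<n. A1 w $$ (i, l) * (if l = j then 1 else 0)) = A1 w $$ (i, j)"
    proof -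
      have "(\<Sum>l<n. A1 w $$ (i, l) * (if l = j then 1 else 0)) = (\<Sum>l<n. if l = j then A1 w $$ (i, l) else 0)"
        by (intro sum.cong) auto
      then show ?thesis using j by simp
    qed
    finally show ?thesis
      unfolding frame.simps d R'_def slope_Suc[OF i j, symmetric] eq[OF i h w]
      by (simp add: algebra_simps power2_eq_square)
  qed
  ultimately show ?case by blast
qed

lemma det_family:
  assumes "\<And>i j. i < n \<Longrightarrow> j < n \<Longrightarrow> smooth_family H W (F i j)"
  shows "smooth_family H W (\<lambda>h w. Determinant.det (Matrix.mat n n (\<lambda>(i, j). F i j h w)))"
proof -
  have "Determinant.det (Matrix.mat n n (\<lambda>(i, j). F i j h w)) =
      (\<Sum>p\<in>{p. p permutes {0..<n}}. signof p * (\<Prod>i=0..<n. F i (p i) h w))" for h w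
    by (subst det_def'[of _ n]) (auto intro!: sum.cong prod.cong simp: permutes_less)
  moreover have "smooth_family H W (\<lambda>h w. \<Sum>p\<in>{p. p permutes {0..<n}}. signof p * (\<Prod>i=0..<n. F i (p i) h w))"
    by (intro fam smooth_family_prod[OF W(1)] assms) (auto simp: permutes_less)
  ultimately show ?thesis by simp
qed

lemma prod_expansion:
  assumes "finite S" "\<And>i. i \<in> S \<Longrightarrow> \<exists>R. smooth_family H W R \<and> (\<forall>h\<in>H. \<forall>w\<in>W. F i h w = c i + h * R h w)"
  shows "\<exists>R. smooth_family H W R \<and> (\<forall>h\<in>H. \<forall>w\<in>W. (\<Prod>i\<in>S. F i h w) = (\<Prod>i\<in>S. c i) + h * R h w)"
  using assms
proof (induction S rule: finite_induct)
  case empty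
  show ?case by (rule exI[of _ "\<lambda>h w. 0"]) (auto simp: fam)
next
  case (insert x S)
  obtain R where R: "smooth_family H W R" "\<forall>h\<in>H. \<forall>w\<in>W. (\<Prod>i\<in>S. F i h w) = (\<Prod>i\<in>S. c i) + h * R h w"
    using insert.IH insert.prems by blast
  obtain Q where Q: "smooth_family H W Q" "\<forall>h\<in>H. \<forall>w\<in>W. F x h w = c x + h * Q h w"
    using insert.prems[of x] by blast
  show ?case
    by (rule exI[of _ "\<lambda>h w. c x * R h w + Q h w * (\<Prod>i\<in>S. c i) + h * (Q h w * R h w)"])
      (use R Q insert.hyps in \<open>auto intro!: fam simp: algebra_simps\<close>)
qed

lemma sum_expansion:
  assumes "\<And>i. i \<in> S \<Longrightarrow> \<exists>R. smooth_family H W R \<and> (\<forall>h\<in>H. \<forall>w\<in>W. F i h w = c i + h * R h w)"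
  shows "\<exists>R. smooth_family H W R \<and> (\<forall>h\<in>H. \<forall>w\<in>W. (\<Sum>i\<in>S. F i h w) = (\<Sum>i\<in>S. c i) + h * R h w)"
proof -
  obtain R where "\<forall>i\<in>S. smooth_family H W (R i) \<and> (\<forall>h\<in>H. \<forall>w\<in>W. F i h w = c i + h * R i h w)"
    using bchoice[of S "\<lambda>i R. smooth_family H W R \<and> (\<forall>h\<in>H. \<forall>w\<in>W. F i h w = c i + h * R h w)"] assms by blast
  then show ?thesis
    by (intro exI[of _ "\<lambda>h w. \<Sum>i\<in>S. R i h w"])
      (auto intro!: fam simp: sum.distrib sum_distrib_left)
qed

lemma det_expansion:
  assumes "\<And>i j. i < n \<Longrightarrow> j < n \<Longrightarrow> \<exists>R. smooth_family H W R \<and>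
    (\<forall>h\<in>H. \<forall>w\<in>W. F i j h w = (if i = j then 1 else 0) + h * R h w)"
  shows "\<exists>R. smooth_family H W R \<and> (\<forall>h\<in>H. \<forall>w\<in>W.
    Determinant.det (Matrix.mat n n (\<lambda>(i, j). F i j h w)) = 1 + h * R h w)"
proof -
  have det: "Determinant.det (Matrix.mat n n (\<lambda>(i, j). F i j h w)) =
      (\<Sum>p\<in>{p. p permutes {0..<n}}. signof p * (\<Prod>i=0..<n. F i (p i) h w))" for F :: "nat \<Rightarrow> nat \<Rightarrow> complex \<Rightarrow> complex \<Rightarrow> complex" and h w
    by (subst det_def'[of _ n]) (auto intro!: sum.cong prod.cong simp: permutes_less)
  have "\<exists>R. smooth_family H W R \<and> (\<forall>h\<in>H. \<forall>w\<in>W. signof p * (\<Prod>i=0..<n. F i (p i) h w) =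
      signof p * (\<Prod>i=0..<n. if i = p i then 1 else 0) + h * R h w)" if p: "p permutes {0..<n}" for p
  proof -
    obtain R where R: "smooth_family H W R" "\<forall>h\<in>H. \<forall>w\<in>W. (\<Prod>i=0..<n. F i (p i) h w) =
      (\<Prod>i=0..<n. if i = p i then 1 else 0) + h * R h w"
      using prod_expansion[of "{0..<n}" "\<lambda>i. F i (p i)" "\<lambda>i. if i = p i then 1 else 0"] assms p
      by (auto simp: permutes_less)
    show ?thesis
      by (rule exI[of _ "\<lambda>h w. signof p * R h w"]) (use R in \<open>auto intro!: fam simp: algebra_simps\<close>)
  qed
  then obtain R where R: "smooth_family H W R" "\<forall>h\<in>H. \<forall>w\<in>W.
      (\<Sum>p\<in>{p. p permutes {0..<n}}. signof p * (\<Prod>i=0..<n. F i (p i) h w)) =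
      (\<Sum>p\<in>{p. p permutes {0..<n}}. signof p * (\<Prod>i=0..<n. if i = p i then 1 else 0)) + h * R h w"
    using sum_expansion[of "{p. p permutes {0..<n}}" "\<lambda>p h w. signof p * (\<Prod>i=0..<n. F i (p i) h w)"
        "\<lambda>p. signof p * (\<Prod>i=0..<n. if i = p i then 1 else 0)"] by auto
  have "(\<Sum>p\<in>{p. p permutes {0..<n}}. signof p * (\<Prod>i=0..<n. if i = p i then 1 else (0::complex))) =
      Determinant.det (Matrix.mat n n (\<lambda>(i, j). if i = j then 1 else 0))"
    by (subst det[of "\<lambda>i j h w. if i = j then 1 else 0"]) rule
  also have "\<dots> = 1" using det_one[of n] by (simp add: one_mat_def)
  finally show ?thesis using R unfolding det by auto
qed

lemma wronskian_family: "smooth_family H W wronskian"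
  unfolding wronskian_def by (intro fam vol_family det_family frame_family) auto

lemma wronskian_expansion:
  "\<exists>R. smooth_family H W R \<and> (\<forall>h\<in>H. \<forall>w\<in>W. wronskian h w = \<omega> w * (1 + h * R h w))"
proof -
  have "\<exists>R. smooth_family H W R \<and>
    (\<forall>h\<in>H. \<forall>w\<in>W. frame0 j i h w = (if i = j then 1 else 0) + h * R h w)" if ij: "i < n" "j < n" for i j
  proof -
    have z: "smooth_family H W (\<lambda>h w. 0)" by (rule fam)
    obtain R where R: "\<forall>i<n. smooth_family H W (R i) \<and> (\<forall>h\<in>H. \<forall>w\<in>W.
       frame0 j i h w = (if i = j then 1 else 0) + h * slope (\<lambda>h w. 0) j i h w + h\<^sup>2 * R i h w)"
      using frame_expansion[OF z, of j] ij by auto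
    show ?thesis
      by (rule exI[of _ "\<lambda>h w. slope (\<lambda>h w. 0) j i h w + h * R i h w"])
        (use R ij in \<open>auto intro!: fam slope_family simp: algebra_simps power2_eq_square\<close>)
  qed
  then obtain R where "smooth_family H W R" "\<forall>h\<in>H. \<forall>w\<in>W.
    Determinant.det (Matrix.mat n n (\<lambda>(i, j). frame0 j i h w)) = 1 + h * R h w"
    using det_expansion[of "\<lambda>i j. frame0 j i"] by auto
  then show ?thesis unfolding wronskian_def by auto
qed

end


section \<open>Linear algebra near the identity and the derivative of a determinant\<close>

text \<open>A system whose matrix is within \<open>\<kappa>\<close> of the identity, with \<open>\<kappa> n \<le> 1 / 2\<close>, has its solution within a
  multiple of \<open>\<kappa>\<close> of the right hand side. With \<open>v = 0\<close> this also gives uniqueness.\<close>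
lemma near_identity_solution:
  fixes E :: "nat \<Rightarrow> nat \<Rightarrow> complex"
  assumes E: "\<And>i j. i < n \<Longrightarrow> j < n \<Longrightarrow> norm (E j i - (if i = j then 1 else 0)) \<le> \<kappa>"
    and \<kappa>: "\<kappa> * n \<le> 1 / 2"
    and eq: "\<And>i. i < n \<Longrightarrow> v i = (\<Sum>j<n. x j * E j i)"
    and i: "i < n"
  shows "norm (x i - v i) \<le> 2 * \<kappa> * (\<Sum>j<n. norm (v j))"
proof -
  have \<kappa>0: "\<kappa> \<ge> 0" using E[OF i i] norm_ge_zero order_trans by blast
  let ?X = "\<Sum>j<n. norm (x j)" and ?V = "\<Sum>j<n. norm (v j)"
  have dev: "norm (x i - v i) \<le> \<kappa> * ?X" if i: "i < n" for i
  proof -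
    have "v i - x i = (\<Sum>j<n. x j * E j i) - (\<Sum>j<n. if j = i then x j else 0)"
      using eq[OF i] i by simp
    also have "\<dots> = (\<Sum>j<n. x j * (E j i - (if i = j then 1 else 0)))"
      unfolding sum_subtractf[symmetric] by (intro sum.cong) (auto simp: algebra_simps)
    finally have "norm (x i - v i) = norm (\<Sum>j<n. x j * (E j i - (if i = j then 1 else 0)))"
      by (metis norm_minus_commute)
    also have "\<dots> \<le> (\<Sum>j<n. norm (x j) * \<kappa>)"
      by (intro sum_norm_le order_trans[OF eq_refl[OF norm_mult]] mult_left_mono E i) auto
    finally show ?thesis by (simp add: sum_distrib_left mult.commute)
  qed
  have "?X \<le> (\<Sum>i<n. norm (v i) + \<kappa> * ?X)"
  proof (rule sum_mono)
    fix i assume "i \<in> {..<n}"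
    then have "norm (x i - v i) \<le> \<kappa> * ?X" by (intro dev) auto
    then show "norm (x i) \<le> norm (v i) + \<kappa> * ?X"
      using norm_triangle_ineq2[of "x i" "v i"] by linarith
  qed
  also have "\<dots> = ?V + \<kappa> * n * ?X" by (simp add: sum.distrib)
  also have "\<dots> \<le> ?V + 1 / 2 * ?X"
    using \<kappa> by (intro add_left_mono mult_right_mono sum_nonneg) auto
  finally have "?X \<le> 2 * ?V" by simp
  then have "\<kappa> * ?X \<le> \<kappa> * (2 * ?V)" using \<kappa>0 by (rule mult_left_mono)
  then show ?thesis using dev[OF i] by simp
qed

lemma det_nonzero_solution:
  fixes S :: "nat \<Rightarrow> nat \<Rightarrow> complex"
  assumes "Determinant.det (Matrix.mat n n (\<lambda>(i, j). S j i)) \<noteq> 0"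
  shows "\<exists>x. \<forall>i<n. v i = (\<Sum>j<n. x j * S j i)"
proof -
  let ?M = "Matrix.mat n n (\<lambda>(i, j). S j i)" and ?d = "Determinant.det (Matrix.mat n n (\<lambda>(i, j). S j i))"
  have M: "?M \<in> carrier_mat n n" by simp
  have adj: "(\<Sum>j<n. S j i * adj_mat ?M $$ (j, k)) = (if i = k then ?d else 0)" if "i < n" "k < n" for i k
    using mat_mult_index[OF M adj_mat(1)[OF M] that] adj_mat(2)[OF M] that
    by (cases "i = k") simp_all
  define x where "x j = inverse ?d * (\<Sum>k<n. adj_mat ?M $$ (j, k) * v k)" for j
  have "(\<Sum>j<n. x j * S j i) = v i" if i: "i < n" for i
  proof -
    have "(\<Sum>j<n. x j * S j i) = (\<Sum>j<n. \<Sum>k<n. inverse ?d * v k * (S j i * adj_mat ?M $$ (j, k)))"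
      unfolding x_def by (simp add: sum_distrib_left sum_distrib_right algebra_simps)
    also have "\<dots> = (\<Sum>k<n. inverse ?d * v k * (\<Sum>j<n. S j i * adj_mat ?M $$ (j, k)))"
      by (subst sum.swap) (simp add: sum_distrib_left)
    also have "\<dots> = (\<Sum>k<n. if k = i then v k else 0)"
      using assms i by (intro sum.cong) (auto simp: adj)
    finally show ?thesis using i by simp
  qed
  then have "\<forall>i<n. v i = (\<Sum>j<n. x j * S j i)" by simp
  then show ?thesis by (rule exI[of "\<lambda>x. \<forall>i<n. v i = (\<Sum>j<n. x j * S j i)"])
qed

text \<open>Jacobi's formula, by differentiating the rows one at a time and expanding along the
  differentiated row.\<close>
lemma derivation_det:
  assumes D: "derivation D" and F: "\<And>i j. i < n \<Longrightarrow> j < n \<Longrightarrow> F i j differentiable at z"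
  shows "D (\<lambda>w. Determinant.det (Matrix.mat n n (\<lambda>(i, j). F i j w))) z =
    (\<Sum>i<n. \<Sum>j<n. D (F i j) z * cofactor (Matrix.mat n n (\<lambda>(i, j). F i j z)) i j)"
proof -
  let ?P = "{p. p permutes {0..<n}}"
  have det: "Determinant.det (Matrix.mat n n (\<lambda>(i, j). G i j)) =
      (\<Sum>p\<in>?P. signof p * (\<Prod>i=0..<n. G i (p i)))" for G :: "nat \<Rightarrow> nat \<Rightarrow> complex"
    by (subst det_def'[of _ n]) (auto intro!: sum.cong prod.cong simp: permutes_less)
  have diff: "(\<lambda>w. \<Prod>i=0..<n. F i (p i) w) differentiable at z" if "p \<in> ?P" for p
    using that by (intro differentiable_prod F) (auto simp: permutes_less)
  let ?R = "\<lambda>i. Matrix.mat n n (\<lambda>(k, j). if k = i then D (F k j) z else F k j z)"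
  have "D (\<lambda>w. Determinant.det (Matrix.mat n n (\<lambda>(i, j). F i j w))) z =
      (\<Sum>p\<in>?P. D (\<lambda>w. signof p * (\<Prod>i=0..<n. F i (p i) w)) z)"
    unfolding det by (rule derivation_sum[OF D]) (use diff in auto)
  also have "\<dots> = (\<Sum>p\<in>?P. signof p *
      (\<Sum>i=0..<n. \<Prod>k=0..<n. if k = i then D (F k (p k)) z else F k (p k) z))"
  proof (intro sum.cong refl)
    fix p assume p: "p \<in> ?P"
    show "D (\<lambda>w. signof p * (\<Prod>i=0..<n. F i (p i) w)) z = signof p *
      (\<Sum>i=0..<n. \<Prod>k=0..<n. if k = i then D (F k (p k)) z else F k (p k) z)"
      unfolding derivation_cmult[OF D diff[OF p]]
      by (subst derivation_prod[OF D]) (use p in \<open>auto intro!: F simp: permutes_less\<close>)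
  qed
  also have "\<dots> = (\<Sum>i=0..<n. \<Sum>p\<in>?P. signof p *
      (\<Prod>k=0..<n. if k = i then D (F k (p k)) z else F k (p k) z))"
    unfolding sum_distrib_left by (rule sum.swap)
  also have "\<dots> = (\<Sum>i=0..<n. Determinant.det (?R i))"
    unfolding det ..
  also have "\<dots> = (\<Sum>i<n. \<Sum>j<n. D (F i j) z * cofactor (Matrix.mat n n (\<lambda>(i, j). F i j z)) i j)"
    unfolding atLeast0LessThan
  proof (intro sum.cong refl)
    fix i assume i: "i \<in> {..<n}"
    have cof: "cofactor (?R i) i j = cofactor (Matrix.mat n n (\<lambda>(i, j). F i j z)) i j" for j
      unfolding cofactor_def mat_delete_def
      by (rule arg_cong[of _ _ "\<lambda>M. _ * Determinant.det M"]) (rule eq_matI, use i in auto)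
    show "Determinant.det (?R i) = (\<Sum>j<n. D (F i j) z * cofactor (Matrix.mat n n (\<lambda>(i, j). F i j z)) i j)"
      using i by (subst laplace_expansion_row[of _ n i]) (auto simp: cof intro!: sum.cong)
  qed
  finally show ?thesis .
qed

text \<open>Liouville's argument. The columns of \<open>S\<close> are \<open>s, \<nabla>s, \<dots>, \<nabla> ^ (n - 1) s\<close> and \<open>M\<close> is the
  connection matrix. Jacobi's formula gives the logarithmic derivative \<open>y\<^sub>n\<^sub>-\<^sub>1 - tr M\<close> for \<open>det S\<close>,
  that of the volume form is \<open>tr M\<close>, and the product of the two is constant. This is why \<open>\<nabla> ^ n s\<close>
  has no component along \<open>\<nabla> ^ (n - 1) s\<close>.\<close>
lemma last_coefficient_zero:
  fixes S :: "nat \<Rightarrow> nat \<Rightarrow> complex \<Rightarrow> complex"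
  assumes n: "n > 0" and V: "open V" "z \<in> V"
    and diff: "\<omega> differentiable at z" "\<And>i j. i < n \<Longrightarrow> j < n \<Longrightarrow> S j i differentiable at z"
    and unit: "\<And>w. w \<in> V \<Longrightarrow> \<omega> w * Determinant.det (Matrix.mat n n (\<lambda>(i, j). S j i w)) = 1"
    and step: "\<And>i j. i < n \<Longrightarrow> j < n \<Longrightarrow> S (Suc j) i z = d_z (S j i) z + (\<Sum>l<n. M i l * S j l z)"
    and tr: "d_z \<omega> z = (\<Sum>i<n. M i i) * \<omega> z"
    and y: "\<And>i. i < n \<Longrightarrow> S n i z = (\<Sum>j<n. y j * S j i z)"
  shows "y (n - 1) = 0"
proof -
  let ?B = "\<lambda>w. Matrix.mat n n (\<lambda>(i, j). S j i w)"
  let ?d = "Determinant.det (?B z)" and ?c = "cofactor (?B z)"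
  have B: "?B z \<in> carrier_mat n n" by simp
  have adj1: "(\<Sum>j<n. S j l z * ?c i j) = (if l = i then ?d else 0)" if "l < n" "i < n" for i l
  proof -
    have "(\<Sum>j<n. S j l z * ?c i j) = (?B z * adj_mat (?B z)) $$ (l, i)"
      unfolding mat_mult_index[OF B adj_mat(1)[OF B] that]
      by (intro sum.cong) (use that in \<open>auto simp: adj_mat_def\<close>)
    then show ?thesis using adj_mat(2)[OF B] that by simp
  qed
  have adj2: "(\<Sum>i<n. S k i z * ?c i j) = (if j = k then ?d else 0)" if "j < n" "k < n" for j k
  proof -
    have "(\<Sum>i<n. S k i z * ?c i j) = (adj_mat (?B z) * ?B z) $$ (j, k)"
      unfolding mat_mult_index[OF adj_mat(1)[OF B] B that]
      by (intro sum.cong) (use that in \<open>auto simp: adj_mat_def\<close>)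
    then show ?thesis using adj_mat(3)[OF B] that by simp
  qed
  \<comment> \<open>column \<open>j\<close> of \<open>\<nabla>S\<close> is column \<open>j + 1\<close> of \<open>S\<close>, orthogonal to the cofactors of column \<open>j\<close>, except for the last one\<close>
  have next_col: "(\<Sum>i<n. S (Suc j) i z * ?c i j) = (if j = n - 1 then y (n - 1) * ?d else 0)" if j: "j < n" for j
  proof (cases "Suc j < n")
    case True
    then show ?thesis using adj2[OF j, of "Suc j"] by auto
  next
    case False
    then have jn: "Suc j = n" "j = n - 1" using j by auto
    have "(\<Sum>i<n. S (Suc j) i z * ?c i j) = (\<Sum>i<n. \<Sum>k<n. y k * (S k i z * ?c i j))"
      using y jn by (simp add: sum_distrib_right mult.assoc)
    also have "\<dots> = (\<Sum>k<n. y k * (\<Sum>i<n. S k i z * ?c i j))"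
      by (subst sum.swap) (simp add: sum_distrib_left)
    also have "\<dots> = (\<Sum>k<n. if k = j then y k * ?d else 0)"
      using j by (intro sum.cong) (auto simp: adj2)
    finally show ?thesis using jn j by simp
  qed
  have "d_z (\<lambda>w. Determinant.det (?B w)) z = (\<Sum>i<n. \<Sum>j<n. d_z (S j i) z * ?c i j)"
    using derivation_det[OF derivation_d_z, of n "\<lambda>i j. S j i" z] diff(2) by simp
  also have "\<dots> = (\<Sum>i<n. \<Sum>j<n. S (Suc j) i z * ?c i j - (\<Sum>l<n. M i l * S j l z) * ?c i j)"
    using step by (intro sum.cong refl) (auto simp: algebra_simps)
  also have "\<dots> = (\<Sum>i<n. \<Sum>j<n. S (Suc j) i z * ?c i j) - (\<Sum>i<n. \<Sum>j<n. \<Sum>l<n. M i l * (S j l z * ?c i j))"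
    by (simp add: sum_subtractf sum_distrib_right mult.assoc)
  also have "(\<Sum>i<n. \<Sum>j<n. S (Suc j) i z * ?c i j) = (\<Sum>j<n. \<Sum>i<n. S (Suc j) i z * ?c i j)"
    by (rule sum.swap)
  also have "\<dots> = (\<Sum>j<n. if j = n - 1 then y (n - 1) * ?d else 0)"
    by (intro sum.cong refl next_col) auto
  also have "\<dots> = y (n - 1) * ?d" using n by simp
  also have "(\<Sum>i<n. \<Sum>j<n. \<Sum>l<n. M i l * (S j l z * ?c i j)) = (\<Sum>i<n. M i i * ?d)"
  proof (intro sum.cong refl)
    fix i assume i: "i \<in> {..<n}"
    have "(\<Sum>j<n. \<Sum>l<n. M i l * (S j l z * ?c i j)) = (\<Sum>l<n. M i l * (\<Sum>j<n. S j l z * ?c i j))"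
      by (subst sum.swap) (simp add: sum_distrib_left)
    also have "\<dots> = (\<Sum>l<n. if l = i then M i l * ?d else 0)"
      using i by (intro sum.cong) (auto simp: adj1)
    finally show "(\<Sum>j<n. \<Sum>l<n. M i l * (S j l z * ?c i j)) = M i i * ?d" using i by simp
  qed
  finally have dd: "d_z (\<lambda>w. Determinant.det (?B w)) z = (y (n - 1) - (\<Sum>i<n. M i i)) * ?d"
    by (simp add: sum_distrib_right algebra_simps)
  have det_diff: "(\<lambda>w. Determinant.det (?B w)) differentiable at z"
  proof -
    have "Determinant.det (?B w) = (\<Sum>p\<in>{p. p permutes {0..<n}}. signof p * (\<Prod>i=0..<n. S (p i) i w))" for w
      by (subst det_def'[of _ n]) (auto intro!: sum.cong prod.cong simp: permutes_less)
    moreover have "(\<lambda>w. \<Prod>i=0..<n. S (p i) i w) differentiable at z" if "p permutes {0..<n}" for p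
      using that by (intro differentiable_prod diff(2)) (auto simp: permutes_less)
    then have "(\<lambda>w. \<Sum>p\<in>{p. p permutes {0..<n}}. signof p * (\<Prod>i=0..<n. S (p i) i w)) differentiable at z"
      by (intro differentiable_sum differentiable_mult differentiable_const) (auto simp: finite_permutations)
    ultimately show ?thesis by simp
  qed
  have "0 = d_z (\<lambda>w. \<omega> w * Determinant.det (?B w)) z"
    using derivation_cong_open[OF derivation_d_z _ V, of "\<lambda>w. \<omega> w * Determinant.det (?B w)" "\<lambda>w. 1"]
      unit diff(1) det_diff derivation_const[OF derivation_d_z] by (simp add: differentiable_mult)
  also have "\<dots> = y (n - 1) * (\<omega> z * ?d)"
    unfolding derivation_mult[OF derivation_d_z diff(1) det_diff] tr dd by (simp add: algebra_simps)
  finally show ?thesis using unit[OF V(2)] by simp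
qed


section \<open>Iterated covariant derivatives of a rescaled section\<close>

lemma det_upper_triangular_prod:
  fixes U :: "complex mat"
  assumes U: "U \<in> carrier_mat n n" and z: "\<And>i j. i < n \<Longrightarrow> j < i \<Longrightarrow> U $$ (i, j) = 0"
  shows "Determinant.det U = (\<Prod>i<n. U $$ (i, i))"
proof -
  have "upper_triangular U" using U z by (auto simp: upper_triangular_def)
  then have "Determinant.det U = prod_list (diag_mat U)" by (rule det_upper_triangular[OF _ U])
  also have "\<dots> = (\<Prod>i<n. U $$ (i, i))"
    using U by (simp add: diag_mat_def prod.list_conv_set_nth atLeast0LessThan)
  finally show ?thesis .
qed

lemma log_derivative:
  assumes D: "derivation D" and V: "open V" "w \<in> V" and n: "n > 0"
    and f: "f differentiable at w" and G: "G differentiable at w"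
    and eq: "\<And>w. w \<in> V \<Longrightarrow> c * f w ^ n * G w = 1"
  shows "D f w = - D G w * inverse (of_nat n * G w) * f w"
proof -
  have nz: "c \<noteq> 0" "f w \<noteq> 0" "G w \<noteq> 0" using eq[OF V(2)] n by (auto simp: power_0_left)
  have fn: "(\<lambda>w. f w ^ n) differentiable at w" using f by simp
  have cfn: "(\<lambda>w. c * f w ^ n) differentiable at w" using fn by simp
  have "0 = D (\<lambda>w. c * f w ^ n * G w) w"
    using derivation_cong_open[OF D _ V, of "\<lambda>w. c * f w ^ n * G w" "\<lambda>w. 1"] eq cfn G
    by (simp add: derivation_const[OF D])
  also have "\<dots> = c * (of_nat n * f w ^ (n - 1) * D f w) * G w + c * f w ^ n * D G w"
    by (simp add: derivation_mult[OF D cfn G] derivation_cmult[OF D fn] derivation_power[OF D f])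
  also have "f w ^ n = f w ^ (n - 1) * f w" using n by (simp flip: power_Suc2)
  finally have "c * f w ^ (n - 1) * (of_nat n * G w * D f w + f w * D G w) = 0"
    by (simp add: algebra_simps)
  then have "of_nat n * G w * D f w + f w * D G w = 0" using nz by simp
  then have "of_nat n * G w * D f w = - f w * D G w" by (simp add: add_eq_0_iff2)
  moreover have "of_nat n * G w \<noteq> 0" using nz n by simp
  ultimately show ?thesis by (simp add: field_simps)
qed

text \<open>The root \<open>exp (- Ln G / n)\<close> exists where \<open>G / G z\<close> avoids the cut of the logarithm. Its
  smoothness follows from its logarithmic derivatives: they are smooth in terms of \<open>G\<close>, so each
  derivative of \<open>f\<close> is \<open>f\<close> times a smooth function.\<close>
lemma smooth_root:
  assumes n: "n > 0" and W: "open W" "z \<in> W" and G: "smooth_family {h} W G"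
    and inv: "smooth_family {h} W (\<lambda>h w. inverse (G h w))"
    and nz: "\<And>w. w \<in> W \<Longrightarrow> G h w \<noteq> 0"
  obtains r f where "r > 0" "ball z r \<subseteq> W" "smooth_family {h} (ball z r) (\<lambda>_. f)"
    "\<And>w. w \<in> ball z r \<Longrightarrow> f w ^ n * G h w = 1"
proof -
  have diff: "G h differentiable at w" if "w \<in> W" for w
    using smooth_family_differentiable[OF G _ that] by simp
  then have "isCont (G h) z" using W(2) by (simp add: differentiable_imp_continuous_within)
  then have "\<exists>d>0. \<forall>w. dist w z < d \<longrightarrow> dist (G h w) (G h z) < norm (G h z)"
    using nz[OF W(2)] by (simp add: continuous_at_eps_delta)
  then obtain d where d: "d > 0" "\<And>w. dist w z < d \<Longrightarrow> dist (G h w) (G h z) < norm (G h z)"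
    by blast
  obtain r0 where r0: "r0 > 0" "ball z r0 \<subseteq> W" using W open_contains_ball by blast
  define r where "r = min d r0"
  have r: "r > 0" "ball z r \<subseteq> W" using d(1) r0 by (auto simp: r_def)
  define V where "V = ball z r"
  have V: "open V" "V \<subseteq> W" using r by (auto simp: V_def)
  have q: "G h w / G h z \<notin> \<real>\<^sub>\<le>\<^sub>0" if "w \<in> V" for w
  proof
    assume "G h w / G h z \<in> \<real>\<^sub>\<le>\<^sub>0"
    then obtain t where t: "G h w / G h z = of_real t" "t \<le> 0" by (auto elim: nonpos_Reals_cases)
    have "norm (G h w - G h z) < norm (G h z)"
      using d(2)[of w] that by (auto simp: V_def r_def dist_commute dist_norm)
    moreover have "G h w - G h z = (of_real t - 1) * G h z"
      using t(1) nz[OF W(2)] by (simp add: field_simps)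
    moreover have "norm (of_real t - 1 :: complex) = \<bar>t - 1\<bar>"
      by (metis norm_of_real of_real_1 of_real_diff)
    then have "norm (of_real t - 1 :: complex) \<ge> 1" using t(2) by simp
    ultimately show False using mult_right_mono[of 1 "norm (of_real t - 1 :: complex)" "norm (G h z)"]
      by (simp add: norm_mult)
  qed
  \<comment> \<open>splitting off the value at \<open>z\<close> keeps the argument of the first \<open>Ln\<close> near \<open>1\<close>, away from the cut\<close>
  define g where "g u = exp (- Ln (u / G h z) / of_nat n) * exp (- Ln (G h z) / of_nat n)" for u
  define f where "f w = g (G h w)" for w
  have root: "f w ^ n * G h w = 1" if w: "w \<in> V" for w
  proof -
    have "f w ^ n = exp (- Ln (G h w / G h z)) * exp (- Ln (G h z))"
      using n by (simp add: f_def g_def power_mult_distrib flip: exp_of_nat_mult)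
    also have "\<dots> = inverse (G h w)"
      using nz[OF W(2)] nz[of w] w V(2) by (auto simp: exp_minus field_simps)
    finally show ?thesis using nz[of w] w V(2) by auto
  qed
  have f_diff: "f differentiable at w" if w: "w \<in> V" for w
  proof -
    have "g field_differentiable at (G h w)"
      unfolding g_def using q[OF w] nz[OF W(2)] n
      by (auto simp: field_differentiable_def intro!: exI derivative_eq_intros)
    then have "g differentiable at (G h w)"
      by (rule field_differentiable_imp_differentiable)
    then show ?thesis
      using differentiable_chain_at[OF diff, of w g] w V(2) by (auto simp: f_def[abs_def] comp_def)
  qed
  have Gv: "smooth_family {h} V G" and Iv: "smooth_family {h} V (\<lambda>h w. inverse (G h w))"
    using smooth_family_mono[OF G, of "{h}" V] smooth_family_mono[OF inv, of "{h}" V] V(2) by auto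
  have log: "D f w = - D (G h) w * inverse (of_nat n * G h w) * f w" if "derivation D" "w \<in> V" for D w
    using that V root n by (intro log_derivative[of D V w n f "G h" 1] f_diff diff) auto
  have fam: "smooth_family {h} V (\<lambda>h w. - D (G h) w * inverse (of_nat n * G h w))" if "derivation D" for D
  proof -
    have "smooth_family {h} V (\<lambda>h w. (- inverse (of_nat n)) * D (G h) w * inverse (G h w))"
      by (intro smooth_family_mult[OF V(1)] smooth_family_const smooth_family_derivation[OF V(1) that] Gv Iv)
    then show ?thesis by (rule smooth_family_cong[OF V(1)]) (simp add: field_simps)
  qed
  have bnd: "unif_bounded {h} V (\<lambda>_. f)"
  proof -
    obtain C where C: "\<And>w. w \<in> V \<Longrightarrow> norm (inverse (G h w)) \<le> C"
      by (rule smooth_family_bounded[OF Iv]) auto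
    have "norm (f w) \<le> 1 + C" if w: "w \<in> V" for w
    proof -
      have "f w ^ n = inverse (G h w)" using root[OF w] by (metis inverse_unique mult.commute)
      then have "norm (f w) ^ n \<le> C" using C[OF w] by (metis norm_power)
      moreover have "norm (f w) \<le> 1 + norm (f w) ^ n"
      proof (cases "norm (f w) \<le> 1")
        case True
        then show ?thesis by (simp add: add_increasing2)
      next
        case False
        then have "norm (f w) ^ 1 \<le> norm (f w) ^ n" using n by (intro power_increasing) auto
        then show ?thesis by simp
      qed
      ultimately show ?thesis by linarith
    qed
    then show ?thesis by (intro unif_boundedI) auto
  qed
  have "Cfam k {h} V (\<lambda>_. f)" for k
  proof (induction k)
    case (Suc k)
    have "Cfam k {h} V (\<lambda>_. D f)" if "derivation D" for D
      by (rule Cfam_cong[OF V(1) Cfam_mult[OF V(1) smooth_familyD[OF fam[OF that]] Suc]])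
        (use log[OF that] in auto)
    then show ?case using bnd f_diff derivation_d_x derivation_d_y by auto
  qed (use bnd in simp)
  then have "smooth_family {h} V (\<lambda>_. f)" unfolding smooth_family_def by blast
  then show ?thesis using that[of r f] r root unfolding V_def by blast
qed

text \<open>The coefficient \<open>binomial j k * \<partial> ^ (j - k) f\<close> of \<open>\<nabla> ^ k e\<close> in \<open>\<nabla> ^ j (f e)\<close>, defined by
  Pascal's recursion.\<close>
primrec leibniz :: "(complex \<Rightarrow> complex) \<Rightarrow> nat \<Rightarrow> nat \<Rightarrow> complex \<Rightarrow> complex" where
  "leibniz f 0 = (\<lambda>k w. if k = 0 then f w else 0)"
| "leibniz f (Suc j) = (\<lambda>k w. d_z (leibniz f j k) w + (case k of 0 \<Rightarrow> 0 | Suc k' \<Rightarrow> leibniz f j k' w))"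

lemma leibniz_zero: "j < k \<Longrightarrow> leibniz f j k = (\<lambda>w. 0)"
  by (induction j arbitrary: k) (auto simp: derivation_const[OF derivation_d_z] split: nat.split)

lemma leibniz_diag: "leibniz f j j w = f w"
  by (induction j) (auto simp: leibniz_zero derivation_const[OF derivation_d_z])

lemma leibniz_family:
  assumes "open V" "smooth_family H V (\<lambda>_. f)"
  shows "smooth_family H V (\<lambda>_. leibniz f j k)"
proof (induction j arbitrary: k)
  case 0
  then show ?case using assms by (cases k) (auto intro: smooth_family_const)
next
  case (Suc j)
  have d: "smooth_family H V (\<lambda>_. d_z (leibniz f j k))" for k
    by (rule smooth_family_derivation[OF assms(1) derivation_d_z Suc])
  show ?case
    using d Suc by (cases k) (auto intro!: smooth_family_add[OF assms(1)])
qed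

context local_pencil
begin

abbreviation "conn1 \<equiv> pencil F1 A1 P1"
abbreviation "conn2 \<equiv> pencil F2 A2 P2"

lemma carrier:
  assumes "w \<in> D"
  shows "F1 w \<in> carrier_mat n n" "F2 w \<in> carrier_mat n n" "A1 w \<in> carrier_mat n n"
    "A2 w \<in> carrier_mat n n" "P1 w \<in> carrier_mat n n" "P2 w \<in> carrier_mat n n"
  using assms A1 A2 P1 P2 by (auto simp: F1 F2 smooth_mat_on_def)

lemma conn1_carrier: "w \<in> D \<Longrightarrow> conn1 lam w \<in> carrier_mat n n"
  and conn2_carrier: "w \<in> D \<Longrightarrow> conn2 lam w \<in> carrier_mat n n"
  using carrier[of w] by (simp_all add: pencil_def)

lemma conn1_index:
  assumes "w \<in> D" "i < n" "l < n" "lam \<noteq> 0"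
  shows "conn1 lam w $$ (i, l) = lam * conn i l (inverse lam) w"
  using carrier[OF assms(1)] assms
  by (simp add: pencil_def conn_def F1 shift_mat_def field_simps power2_eq_square)

lemma conn2_index:
  assumes "w \<in> D" "i < n" "l < n"
  shows "conn2 lam w $$ (i, l) = lam * F2 w $$ (i, l) + A2 w $$ (i, l) + inverse lam * P2 w $$ (i, l)"
  using carrier[OF assms(1)] assms by (simp add: pencil_def)

end

lemma nabla_index:
  assumes "M w \<in> carrier_mat n n" "s w \<in> carrier_vec n" "i < n"
  shows "vec_index (nabla n dd M s w) i =
    dd (\<lambda>u. vec_index (s u) i) w + (\<Sum>l<n. M w $$ (i, l) * vec_index (s w) l)"
  using assms by (auto simp: nabla_def vec_deriv_def scalar_prod_def atLeast0LessThan)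

lemma nabla_carrier: "M w \<in> carrier_mat n n \<Longrightarrow> nabla n dd M s w \<in> carrier_vec n"
  by (intro carrier_vecI) (simp add: nabla_def)

context pencil_on
begin

text \<open>If \<open>\<partial> f = a f\<close>, then \<open>\<nabla>\<close> acts on multiples of \<open>f\<close> as \<open>\<nabla> + a\<close> acts on their quotients by \<open>f\<close>.\<close>
lemma nabla_iterate:
  assumes a: "smooth_family H W a" and lam: "lam \<noteq> 0" "inverse lam \<in> H"
    and V: "open V" "V \<subseteq> W"
    and f: "\<And>w. w \<in> V \<Longrightarrow> f differentiable at w" "\<And>w. w \<in> V \<Longrightarrow> d_z f w = a (inverse lam) w * f w"
    and s: "\<And>w. w \<in> V \<Longrightarrow> s w = f w \<cdot>\<^sub>v e w"
  shows "w \<in> V \<Longrightarrow> (nabla n d_z (conn1 lam) ^^ j) s w =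
    Matrix.vec n (\<lambda>i. f w * lam ^ j * frame a j i (inverse lam) w)"
proof (induction j arbitrary: w)
  case 0
  then have "w \<in> D" using V W by auto
  then show ?case using s[OF 0] by (intro eq_vecI) (auto simp: e)
next
  case (Suc j)
  note w = Suc.prems
  have wD: "w \<in> D" and wW: "w \<in> W" using w V W by auto
  let ?s = "(nabla n d_z (conn1 lam) ^^ j) s" and ?h = "inverse lam"
  have "nabla n d_z (conn1 lam) ?s w = Matrix.vec n (\<lambda>i. f w * lam ^ Suc j * frame a (Suc j) i ?h w)"
  proof (rule eq_vecI)
    fix i assume "i < dim_vec (Matrix.vec n (\<lambda>i. f w * lam ^ Suc j * frame a (Suc j) i ?h w))"
    then have i: "i < n" by simp
    have fr: "frame a j i ?h differentiable at w"
      by (rule smooth_family_differentiable[OF frame_family[OF a i] lam(2) wW])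
    have diff: "(\<lambda>u. (lam ^ j * f u) * frame a j i ?h u) differentiable at w"
      using f(1)[OF w] fr by simp
    have "d_z (\<lambda>u. vec_index (?s u) i) w = d_z (\<lambda>u. (lam ^ j * f u) * frame a j i ?h u) w"
      using i Suc.IH by (intro derivation_cong_open[OF derivation_d_z diff V(1) w, symmetric]) auto
    also have "\<dots> = lam ^ j * (a ?h w * f w) * frame a j i ?h w + lam ^ j * f w * d_z (frame a j i ?h) w"
      using f(1)[OF w] fr
      by (simp add: derivation_mult[OF derivation_d_z] derivation_const[OF derivation_d_z] f(2)[OF w])
    finally have dz: "d_z (\<lambda>u. vec_index (?s u) i) w =
      lam ^ j * (a ?h w * f w) * frame a j i ?h w + lam ^ j * f w * d_z (frame a j i ?h) w" .
    have "(\<Sum>l<n. conn1 lam w $$ (i, l) * vec_index (?s w) l) =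
        f w * lam ^ Suc j * (\<Sum>l<n. conn i l ?h w * frame a j l ?h w)"
      unfolding sum_distrib_left
      by (intro sum.cong refl) (simp add: conn1_index[OF wD i _ lam(1)] Suc.IH[OF w])
    then have "vec_index (nabla n d_z (conn1 lam) ?s w) i =
      lam ^ j * (a ?h w * f w) * frame a j i ?h w + lam ^ j * f w * d_z (frame a j i ?h) w
      + f w * lam ^ Suc j * (\<Sum>l<n. conn i l ?h w * frame a j l ?h w)"
      using nabla_index[of "conn1 lam" w n ?s i d_z, OF conn1_carrier[OF wD]] i dz by (simp add: Suc.IH[OF w])
    also have "\<dots> = f w * lam ^ Suc j * frame a (Suc j) i ?h w"
      using lam(1) by (simp add: field_simps)
    finally show "vec_index (nabla n d_z (conn1 lam) ?s w) i =
      vec_index (Matrix.vec n (\<lambda>i. f w * lam ^ Suc j * frame a (Suc j) i ?h w)) i" using i by simp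
  qed (use nabla_carrier[of "conn1 lam" w, OF conn1_carrier[OF wD]] in auto)
  then show ?case by simp
qed

lemma nabla_leibniz:
  assumes lam: "lam \<noteq> 0" "inverse lam \<in> H" and V: "open V" "V \<subseteq> W"
    and f: "smooth_family {inverse lam} V (\<lambda>_. f)"
    and s: "\<And>w. w \<in> V \<Longrightarrow> s w = f w \<cdot>\<^sub>v e w"
  shows "w \<in> V \<Longrightarrow> (nabla n d_z (conn1 lam) ^^ j) s w =
    Matrix.vec n (\<lambda>i. \<Sum>k\<le>j. leibniz f j k w * (lam ^ k * frame0 k i (inverse lam) w))"
proof (induction j arbitrary: w)
  case 0
  then have "w \<in> D" using V W by auto
  then show ?case using s[OF 0] by (intro eq_vecI) (auto simp: e)
next
  case (Suc j)
  note w = Suc.prems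
  have wD: "w \<in> D" and wW: "w \<in> W" using w V W by auto
  let ?s = "(nabla n d_z (conn1 lam) ^^ j) s" and ?h = "inverse lam"
  let ?fr = "\<lambda>k i. frame0 k i ?h"
  have L: "leibniz f j k differentiable at w" for k
    using smooth_family_differentiable[OF leibniz_family[OF V(1) f] _ w] by simp
  have "nabla n d_z (conn1 lam) ?s w =
      Matrix.vec n (\<lambda>i. \<Sum>k\<le>Suc j. leibniz f (Suc j) k w * (lam ^ k * ?fr k i w))" (is "_ = ?rhs")
  proof (rule eq_vecI)
    fix i assume "i < dim_vec ?rhs"
    then have i: "i < n" by simp
    have fr: "?fr k i differentiable at w" for k
      by (rule smooth_family_differentiable[OF frame_family[OF smooth_family_const i] lam(2) wW])
    have summand: "(\<lambda>u. leibniz f j k u * (lam ^ k * ?fr k i u)) differentiable at w" for k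
      using L fr by simp
    then have diff: "(\<lambda>u. \<Sum>k\<le>j. leibniz f j k u * (lam ^ k * ?fr k i u)) differentiable at w"
      by (intro differentiable_sum) auto
    have "d_z (\<lambda>u. vec_index (?s u) i) w = d_z (\<lambda>u. \<Sum>k\<le>j. leibniz f j k u * (lam ^ k * ?fr k i u)) w"
      using i Suc.IH by (intro derivation_cong_open[OF derivation_d_z diff V(1) w, symmetric]) auto
    also have "\<dots> = (\<Sum>k\<le>j. d_z (leibniz f j k) w * (lam ^ k * ?fr k i w)
        + leibniz f j k w * (lam ^ k * d_z (?fr k i) w))"
      using L fr summand by (simp add: derivation_sum[OF derivation_d_z] derivation_mult[OF derivation_d_z]
          derivation_const[OF derivation_d_z])
    finally have dz: "d_z (\<lambda>u. vec_index (?s u) i) w = (\<Sum>k\<le>j. d_z (leibniz f j k) w * (lam ^ k * ?fr k i w)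
        + leibniz f j k w * (lam ^ k * d_z (?fr k i) w))" .
    have "(\<Sum>l<n. conn1 lam w $$ (i, l) * vec_index (?s w) l) =
        (\<Sum>l<n. \<Sum>k\<le>j. leibniz f j k w * (lam ^ Suc k * (conn i l ?h w * ?fr k l w)))"
      by (intro sum.cong refl)
        (simp add: conn1_index[OF wD i _ lam(1)] Suc.IH[OF w] sum_distrib_left algebra_simps)
    also have "\<dots> = (\<Sum>k\<le>j. leibniz f j k w * (lam ^ Suc k * (\<Sum>l<n. conn i l ?h w * ?fr k l w)))"
      by (subst sum.swap) (simp add: sum_distrib_left)
    finally have "vec_index (nabla n d_z (conn1 lam) ?s w) i =
      (\<Sum>k\<le>j. d_z (leibniz f j k) w * (lam ^ k * ?fr k i w) + leibniz f j k w * (lam ^ k * d_z (?fr k i) w)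
        + leibniz f j k w * (lam ^ Suc k * (\<Sum>l<n. conn i l ?h w * ?fr k l w)))"
      using nabla_index[of "conn1 lam" w n ?s i d_z, OF conn1_carrier[OF wD]] i dz
      by (simp add: Suc.IH[OF w] sum.distrib)
    also have "\<dots> = (\<Sum>k\<le>j. d_z (leibniz f j k) w * (lam ^ k * ?fr k i w)
        + leibniz f j k w * (lam ^ Suc k * ?fr (Suc k) i w))"
      using lam(1) by (intro sum.cong refl) (simp add: field_simps)
    also have "\<dots> = (\<Sum>k\<le>Suc j. d_z (leibniz f j k) w * (lam ^ k * ?fr k i w))
        + (\<Sum>k\<le>Suc j. (case k of 0 \<Rightarrow> 0 | Suc k' \<Rightarrow> leibniz f j k' w) * (lam ^ k * ?fr k i w))"
      unfolding sum.distrib sum.atMost_Suc_shift[of "\<lambda>k. (case k of 0 \<Rightarrow> 0 | Suc k' \<Rightarrow> leibniz f j k' w) * (lam ^ k * ?fr k i w)"]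
      by (simp add: leibniz_zero derivation_const[OF derivation_d_z])
    also have "\<dots> = (\<Sum>k\<le>Suc j. leibniz f (Suc j) k w * (lam ^ k * ?fr k i w))"
      unfolding sum.distrib[symmetric] leibniz.simps by (intro sum.cong refl) (simp add: algebra_simps)
    finally show "vec_index (nabla n d_z (conn1 lam) ?s w) i = vec_index ?rhs i" using i by simp
  qed (use nabla_carrier[of "conn1 lam" w, OF conn1_carrier[OF wD]] in auto)
  then show ?case by simp
qed

text \<open>The change from the derivatives of \<open>e\<close> to those of \<open>f e\<close> is triangular with \<open>f\<close> on the diagonal.
  So a section \<open>f e\<close> has unit volume iff the right hand side is \<open>1\<close>, which determines \<open>f\<close> up to a root
  of unity.\<close>
lemma adapted_det:
  assumes lam: "lam \<noteq> 0" "inverse lam \<in> H" and V: "open V" "V \<subseteq> W"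
    and f: "smooth_family {inverse lam} V (\<lambda>_. f)"
    and s: "\<And>w. w \<in> V \<Longrightarrow> s w = f w \<cdot>\<^sub>v e w" and w: "w \<in> V"
  shows "\<omega> w * Determinant.det (mat_of_cols n (map (\<lambda>j. (nabla n d_z (conn1 lam) ^^ j) s w) [0..<n])) =
    (\<Prod>j<n. lam ^ j) * f w ^ n * wronskian (inverse lam) w"
proof -
  let ?h = "inverse lam"
  let ?B = "Matrix.mat n n (\<lambda>(i, j). frame0 j i ?h w)"
  let ?U = "Matrix.mat n n (\<lambda>(k, j). leibniz f j k w * lam ^ k)"
  have "mat_of_cols n (map (\<lambda>j. (nabla n d_z (conn1 lam) ^^ j) s w) [0..<n]) = ?B * ?U"
  proof (rule eq_matI)
    fix i j assume "i < dim_row (?B * ?U)" "j < dim_col (?B * ?U)"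
    then have ij: "i < n" "j < n" by simp_all
    have "(?B * ?U) $$ (i, j) = (\<Sum>k<n. leibniz f j k w * (lam ^ k * frame0 k i ?h w))"
      using ij by (simp add: mat_mult_index[of _ n] algebra_simps del: index_mult_mat)
    also have "\<dots> = (\<Sum>k\<le>j. leibniz f j k w * (lam ^ k * frame0 k i ?h w))"
      using ij by (intro sum.mono_neutral_right) (auto simp: leibniz_zero)
    finally show "mat_of_cols n (map (\<lambda>j. (nabla n d_z (conn1 lam) ^^ j) s w) [0..<n]) $$ (i, j) = (?B * ?U) $$ (i, j)"
      using ij by (simp add: mat_of_cols_index nabla_leibniz[OF lam V f s w])
  qed simp_all
  moreover have "Determinant.det (?B * ?U) = Determinant.det ?B * Determinant.det ?U"
    by (rule det_mult[of _ n]) simp_all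
  moreover have "Determinant.det ?U = (\<Prod>j<n. lam ^ j) * f w ^ n"
    by (subst det_upper_triangular_prod[of _ n]) (auto simp: leibniz_zero leibniz_diag prod.distrib)
  ultimately show ?thesis by (simp add: wronskian_def)
qed

end


section \<open>Sections of unit volume over a neighbourhood\<close>

text \<open>\<open>H\<close> is so small, i.e. \<open>\<lambda>\<close> is so large, that the derivatives of \<open>e\<close> form a basis throughout \<open>W\<close>,
  uniformly in \<open>h\<close>.\<close>
locale regular_pencil = pencil_on +
  assumes wronskian_nz: "h \<in> H \<Longrightarrow> w \<in> W \<Longrightarrow> wronskian h w \<noteq> 0"
    and inverse_family: "smooth_family H W (\<lambda>h w. inverse (wronskian h w))"
begin

text \<open>The logarithmic derivative of \<open>f\<close> when \<open>f ^ n * wronskian\<close> is constant. It does not depend on the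
  choice of the root \<open>f\<close>, and neither do the parameters, which see \<open>f\<close> only through it.\<close>
definition log_factor :: "((complex \<Rightarrow> complex) \<Rightarrow> complex \<Rightarrow> complex) \<Rightarrow> complex \<Rightarrow> complex \<Rightarrow> complex" where
  "log_factor dd h w = - dd (wronskian h) w * inverse (of_nat n * wronskian h w)"

lemma log_factor_family:
  assumes "derivation dd"
  shows "smooth_family H W (log_factor dd)"
proof -
  have "smooth_family H W (\<lambda>h w. (- inverse (of_nat n)) * dd (wronskian h) w * inverse (wronskian h w))"
    by (intro fam smooth_family_derivation[OF W(1) assms] wronskian_family inverse_family)
  then show ?thesis
    by (rule smooth_family_cong[OF W(1)]) (simp add: log_factor_def field_simps)
qed

abbreviation "frame1 \<equiv> frame (log_factor d_z)"

text \<open>\<open>f e\<close> is a section of unit volume over \<open>V\<close>.\<close>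
definition unit_root :: "complex \<Rightarrow> complex set \<Rightarrow> (complex \<Rightarrow> complex) \<Rightarrow> bool" where
  "unit_root lam V f \<longleftrightarrow> open V \<and> V \<subseteq> W \<and> smooth_family {inverse lam} V (\<lambda>_. f) \<and>
     (\<forall>w\<in>V. (\<Prod>j<n. lam ^ j) * f w ^ n * wronskian (inverse lam) w = 1)"

lemma unit_root_exists:
  assumes lam: "lam \<noteq> 0" "inverse lam \<in> H" and z: "z \<in> W"
  shows "\<exists>V f. z \<in> V \<and> unit_root lam V f"
proof -
  let ?h = "inverse lam" and ?c = "\<Prod>j<n. lam ^ j"
  have c: "?c \<noteq> 0" using lam(1) by simp
  have n0: "n > 0" using n by simp
  have nz: "?c * wronskian ?h w \<noteq> 0" if "w \<in> W" for w
    using c wronskian_nz[OF lam(2) that] by (rule no_zero_divisors)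
  have sub: "smooth_family {?h} W F" if "smooth_family H W F" for F
    by (rule smooth_family_mono[OF that]) (use lam in auto)
  have 1: "smooth_family {?h} W (\<lambda>h w. ?c * wronskian h w)"
    by (intro smooth_family_mult[OF W(1)] smooth_family_const sub wronskian_family)
  have 2: "smooth_family {?h} W (\<lambda>h w. inverse (?c * wronskian h w))"
    unfolding inverse_mult_distrib
    by (intro smooth_family_mult[OF W(1)] smooth_family_const sub inverse_family)
  obtain r f where "r > 0" "ball z r \<subseteq> W" "smooth_family {?h} (ball z r) (\<lambda>_. f)"
    "\<And>w. w \<in> ball z r \<Longrightarrow> f w ^ n * (?c * wronskian ?h w) = 1"
    by (rule smooth_root[OF n0 W(1) z 1 2 nz]) auto
  then show ?thesis
    unfolding unit_root_def by (intro exI[of _ "ball z r"] exI[of _ f]) (auto simp: algebra_simps)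
qed

lemma adapted_sectionI:
  assumes lam: "lam \<noteq> 0" "inverse lam \<in> H" and f: "unit_root lam V f"
  shows "adapted_section n e \<omega> (conn1 lam) V (\<lambda>w. f w \<cdot>\<^sub>v e w)"
proof -
  have V: "open V" "V \<subseteq> W" and fam: "smooth_family {inverse lam} V (\<lambda>_. f)"
    and eq: "\<And>w. w \<in> V \<Longrightarrow> (\<Prod>j<n. lam ^ j) * f w ^ n * wronskian (inverse lam) w = 1"
    using f unfolding unit_root_def by auto
  have "smooth_on V f" using smooth_family_imp_smooth_on[OF fam] by simp
  then show ?thesis
    unfolding adapted_section_def using adapted_det[OF lam V fam] eq by auto
qed

lemma adapted_section_unit_root:
  assumes lam: "lam \<noteq> 0" "inverse lam \<in> H" and z: "z \<in> W"
    and U: "open U" "z \<in> U" and s: "adapted_section n e \<omega> (conn1 lam) U s"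
  shows "\<exists>V f. z \<in> V \<and> unit_root lam V f \<and> (\<forall>w\<in>V. s w = f w \<cdot>\<^sub>v e w)"
proof -
  obtain f where f: "smooth_on U f" "\<And>w. w \<in> U \<Longrightarrow> s w = f w \<cdot>\<^sub>v e w"
    and unit: "\<And>w. w \<in> U \<Longrightarrow> \<omega> w *
      Determinant.det (mat_of_cols n (map (\<lambda>j. (nabla n d_z (conn1 lam) ^^ j) s w) [0..<n])) = 1"
    using s unfolding adapted_section_def by blast
  obtain r where r: "r > 0" "cball z r \<subseteq> W \<inter> U"
    using open_contains_cball[of "W \<inter> U"] W(1) U z by blast
  have V: "open (ball z r)" "ball z r \<subseteq> W" "ball z r \<subseteq> U" using r ball_subset_cball[of z r] by auto
  have fam: "smooth_family {inverse lam} (ball z r) (\<lambda>_. f)"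
    by (rule smooth_on_imp_smooth_family[OF f(1), of "cball z r"]) (use r in auto)
  have "(\<Prod>j<n. lam ^ j) * f w ^ n * wronskian (inverse lam) w = 1" if w: "w \<in> ball z r" for w
    using adapted_det[OF lam V(1,2) fam, of s w] unit[of w] f(2) V(3) w by (simp add: subset_iff)
  then have "unit_root lam (ball z r) f" unfolding unit_root_def using V fam by blast
  moreover have "s w = f w \<cdot>\<^sub>v e w" if "w \<in> ball z r" for w using f(2) V(3) that by blast
  ultimately show ?thesis using r by (intro exI[of _ "ball z r"] exI[of _ f]) auto
qed

lemma unit_root_derivation:
  assumes lam: "lam \<noteq> 0" "inverse lam \<in> H" and f: "unit_root lam V f" and w: "w \<in> V"
    and D: "derivation dd"
  shows "dd f w = log_factor dd (inverse lam) w * f w"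
proof -
  have V: "open V" "V \<subseteq> W" and fam: "smooth_family {inverse lam} V (\<lambda>_. f)"
    and eq: "\<And>w. w \<in> V \<Longrightarrow> (\<Prod>j<n. lam ^ j) * f w ^ n * wronskian (inverse lam) w = 1"
    using f unfolding unit_root_def by auto
  have G: "wronskian (inverse lam) differentiable at w"
    using smooth_family_differentiable[OF wronskian_family lam(2)] V w by auto
  show ?thesis
    unfolding log_factor_def using n eq smooth_family_differentiable[OF fam _ w]
    by (intro log_derivative[OF D V(1) w _ _ G]) auto
qed

lemma unit_root_nabla:
  assumes lam: "lam \<noteq> 0" "inverse lam \<in> H" and f: "unit_root lam V f" and w: "w \<in> V"
    and s: "\<And>w. w \<in> V \<Longrightarrow> s w = f w \<cdot>\<^sub>v e w"
  shows "(nabla n d_z (conn1 lam) ^^ j) s w =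
    Matrix.vec n (\<lambda>i. f w * lam ^ j * frame1 j i (inverse lam) w)"
proof (rule nabla_iterate[OF log_factor_family[OF derivation_d_z] lam _ _ _ _ s w])
  show "f differentiable at w" if "w \<in> V" for w
    using smooth_family_differentiable[of "{inverse lam}" V "\<lambda>_. f"] that f unfolding unit_root_def by auto
  show "d_z f w = log_factor d_z (inverse lam) w * f w" if "w \<in> V" for w
    by (rule unit_root_derivation[OF lam f that derivation_d_z])
qed (use f in \<open>auto simp: unit_root_def\<close>)

lemma unit_root_nz: "unit_root lam V f \<Longrightarrow> w \<in> V \<Longrightarrow> f w \<noteq> 0"
  using n by (fastforce simp: unit_root_def power_0_left)

text \<open>The components of \<open>h\<close> times the \<open>dzbar\<close> covariant derivative of \<open>f e\<close>, divided by \<open>f\<close>.\<close>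
definition zbar_column :: "nat \<Rightarrow> complex \<Rightarrow> complex \<Rightarrow> complex" where
  "zbar_column i h w = F2 w $$ (i, 0) + h * (A2 w $$ (i, 0)
     + (if i = 0 then log_factor d_zbar h w else 0) + h * P2 w $$ (i, 0))"

lemma unit_root_nabla_zbar:
  assumes lam: "lam \<noteq> 0" "inverse lam \<in> H" and f: "unit_root lam V f" and w: "w \<in> V"
    and s: "\<And>w. w \<in> V \<Longrightarrow> s w = f w \<cdot>\<^sub>v e w" and i: "i < n"
  shows "vec_index (nabla n d_zbar (conn2 lam) s w) i = f w * lam * zbar_column i (inverse lam) w"
proof -
  have V: "open V" "V \<subseteq> W" and fam: "smooth_family {inverse lam} V (\<lambda>_. f)"
    using f unfolding unit_root_def by auto
  have wD: "w \<in> D" using V w W by auto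
  have s_index: "vec_index (s u) l = (if l = 0 then f u else 0)" if "u \<in> V" "l < n" for u l
    using s[OF that(1)] that V W by (auto simp: e subset_iff)
  have fd: "f differentiable at w" using smooth_family_differentiable[OF fam _ w] by simp
  have "(\<lambda>u. if i = 0 then f u else 0) differentiable at w" using fd by (cases "i = 0") auto
  then have "d_zbar (\<lambda>u. vec_index (s u) i) w = d_zbar (\<lambda>u. if i = 0 then f u else 0) w"
    using s_index i by (intro derivation_cong_open[OF derivation_d_zbar _ V(1) w, symmetric]) auto
  also have "\<dots> = (if i = 0 then log_factor d_zbar (inverse lam) w * f w else 0)"
    using unit_root_derivation[OF lam f w derivation_d_zbar]
    by (cases "i = 0") (auto simp: derivation_const[OF derivation_d_zbar])
  finally have 1: "d_zbar (\<lambda>u. vec_index (s u) i) w =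
    (if i = 0 then log_factor d_zbar (inverse lam) w * f w else 0)" .
  have "(\<Sum>l<n. conn2 lam w $$ (i, l) * vec_index (s w) l) = (\<Sum>l<n. if l = 0 then conn2 lam w $$ (i, l) * f w else 0)"
    using s_index[OF w] by (intro sum.cong) auto
  also have "\<dots> = conn2 lam w $$ (i, 0) * f w" using n by simp
  finally have 2: "(\<Sum>l<n. conn2 lam w $$ (i, l) * vec_index (s w) l) = conn2 lam w $$ (i, 0) * f w" .
  have "s w \<in> carrier_vec n" using s[OF w] wD by (simp add: e)
  then show ?thesis
    using nabla_index[of "conn2 lam" w n s i d_zbar, OF conn2_carrier[OF wD]] i 1 2 conn2_index[OF wD i] n lam(1)
    by (simp add: zbar_column_def field_simps)
qed

lemma frame1_solution:
  assumes lam: "lam \<noteq> 0" "inverse lam \<in> H" and f: "unit_root lam V f" and z: "z \<in> V"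
  shows "\<exists>x. \<forall>i<n. v i = (\<Sum>j<n. x j * frame1 j i (inverse lam) z)"
proof -
  let ?h = "inverse lam" and ?s = "\<lambda>w. f w \<cdot>\<^sub>v e w"
  let ?S = "\<lambda>j i w. vec_index ((nabla n d_z (conn1 lam) ^^ j) ?s w) i"
  have ad: "adapted_section n e \<omega> (conn1 lam) V ?s" by (rule adapted_sectionI[OF lam f])
  have "mat_of_cols n (map (\<lambda>j. (nabla n d_z (conn1 lam) ^^ j) ?s z) [0..<n]) = Matrix.mat n n (\<lambda>(i, j). ?S j i z)"
    by (intro eq_matI) (auto simp: mat_of_cols_index)
  then have "Determinant.det (Matrix.mat n n (\<lambda>(i, j). ?S j i z)) \<noteq> 0"
    using ad z unfolding adapted_section_def by fastforce
  then obtain y where y: "\<forall>i<n. v i = (\<Sum>j<n. y j * ?S j i z)"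
    using det_nonzero_solution[of n "\<lambda>j i. ?S j i z" v] by blast
  have "?S j i z = f z * lam ^ j * frame1 j i ?h z" if "i < n" for i j
    using that by (simp add: unit_root_nabla[OF lam f z])
  then have "\<forall>i<n. v i = (\<Sum>j<n. (y j * (f z * lam ^ j)) * frame1 j i ?h z)"
    using y by (simp add: mult.assoc)
  then show ?thesis by (rule exI[of "\<lambda>x. \<forall>i<n. v i = (\<Sum>j<n. x j * frame1 j i ?h z)"])
qed

text \<open>This is \<open>last_coefficient_zero\<close> for the section of unit volume: undoing the rescaling, the
  coefficient of \<open>\<nabla> ^ j s\<close> in \<open>\<nabla> ^ n s\<close> is \<open>x j * \<lambda> ^ (n - j)\<close>. The traces of \<open>N\<close> and \<open>\<Psi>\<^sub>1\<close> vanish, so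
  the volume form is parallel for the whole pencil.\<close>
lemma top_frame_last_zero:
  assumes lam: "lam \<noteq> 0" "inverse lam \<in> H" and f: "unit_root lam V f" and z: "z \<in> V"
    and x: "\<And>i. i < n \<Longrightarrow> frame1 n i (inverse lam) z = (\<Sum>j<n. x j * frame1 j i (inverse lam) z)"
  shows "x (n - 1) = 0"
proof -
  let ?h = "inverse lam" and ?s = "\<lambda>w. f w \<cdot>\<^sub>v e w"
  let ?S = "\<lambda>j i w. vec_index ((nabla n d_z (conn1 lam) ^^ j) ?s w) i"
  have V: "open V" "V \<subseteq> W" and fam: "smooth_family {inverse lam} V (\<lambda>_. f)"
    using f unfolding unit_root_def by auto
  have zD: "z \<in> D" and zW: "z \<in> W" using V W z by auto
  have ad: "adapted_section n e \<omega> (conn1 lam) V ?s" by (rule adapted_sectionI[OF lam f])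
  have S: "?S j i w = f w * lam ^ j * frame1 j i ?h w" if "i < n" "w \<in> V" for i j w
    using that by (simp add: unit_root_nabla[OF lam f that(2)])
  have mat: "mat_of_cols n (map (\<lambda>j. (nabla n d_z (conn1 lam) ^^ j) ?s w) [0..<n]) = Matrix.mat n n (\<lambda>(i, j). ?S j i w)" for w
    by (intro eq_matI) (auto simp: mat_of_cols_index)
  have fd: "f differentiable at z" using smooth_family_differentiable[OF fam _ z] by simp
  have S_diff: "?S j i differentiable at z" if "i < n" for i j
  proof (rule differentiable_cong_open[OF _ V(1) z])
    show "(\<lambda>w. f w * lam ^ j * frame1 j i ?h w) differentiable at z"
      using fd smooth_family_differentiable[OF frame_family[OF log_factor_family[OF derivation_d_z] that] lam(2) zW]
      by simp
  qed (use S[OF that] in auto)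
  have "x (n - 1) * lam ^ (n - (n - 1)) = 0"
  proof (rule last_coefficient_zero[where S = ?S and V = V and z = z and \<omega> = \<omega> and n = n
        and M = "\<lambda>i l. conn1 lam z $$ (i, l)" and y = "\<lambda>j. x j * lam ^ (n - j)"])
    show "n > 0" using n by simp
    show "open V" "z \<in> V" using V z by auto
    show "\<omega> differentiable at z" by (rule smooth_on_differentiable[OF vol(1) zD])
    show "?S j i differentiable at z" if "i < n" for i j by (rule S_diff[OF that])
    show "\<omega> w * Determinant.det (Matrix.mat n n (\<lambda>(i, j). ?S j i w)) = 1" if "w \<in> V" for w
      using ad that unfolding adapted_section_def mat by blast
    show "?S (Suc j) i z = d_z (?S j i) z + (\<Sum>l<n. conn1 lam z $$ (i, l) * ?S j l z)" if "i < n" for i j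
      using nabla_index[of "conn1 lam" z n "(nabla n d_z (conn1 lam) ^^ j) ?s" i d_z] that
      by (simp add: unit_root_nabla[OF lam f z] conn1_carrier zD)
    have "(\<Sum>i<n. conn1 lam z $$ (i, i)) = (\<Sum>i<n. A1 z $$ (i, i)) + inverse lam * (\<Sum>i<n. P1 z $$ (i, i))"
      unfolding sum_distrib_left sum.distrib[symmetric]
      using lam(1) by (intro sum.cong refl) (simp add: conn1_index[OF zD] conn_def field_simps power2_eq_square)
    also have "\<dots> = mat_trace (A1 z)"
      using trace_P1[OF zD] carrier[OF zD] by (simp add: mat_trace_def)
    finally show "d_z \<omega> z = (\<Sum>i<n. conn1 lam z $$ (i, i)) * \<omega> z" using vol(3)[OF zD] by simp
    show "?S n i z = (\<Sum>j<n. x j * lam ^ (n - j) * ?S j i z)" if i: "i < n" for i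
    proof -
      have "?S n i z = (\<Sum>j<n. x j * (f z * lam ^ n * frame1 j i ?h z))"
        by (simp add: S[OF i z] x[OF i] sum_distrib_left algebra_simps)
      also have "\<dots> = (\<Sum>j<n. x j * lam ^ (n - j) * ?S j i z)"
      proof (intro sum.cong refl)
        fix j assume "j \<in> {..<n}"
        then have "lam ^ n = lam ^ (n - j) * lam ^ j" by (simp flip: power_add)
        then show "x j * (f z * lam ^ n * frame1 j i ?h z) = x j * lam ^ (n - j) * ?S j i z"
          by (simp add: S[OF i z])
      qed
      finally show ?thesis .
    qed
  qed
  then show ?thesis using lam(1) by simp
qed

end


section \<open>The parameters as solutions of linear systems\<close>
lemma uniform_constant:
  fixes F :: "'a \<Rightarrow> 'b \<Rightarrow> complex"
  assumes "finite S" "\<And>h. h \<in> H \<Longrightarrow> g h \<ge> (0 :: real)"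
    and "\<And>x. x \<in> S \<Longrightarrow> \<exists>C. \<forall>h\<in>H. norm (F x h) \<le> C * g h"
  shows "\<exists>C>0. \<forall>x\<in>S. \<forall>h\<in>H. norm (F x h) \<le> C * g h"
  using assms(1,3)
proof (induction S rule: finite_induct)
  case empty
  show ?case by (intro exI[of _ 1]) auto
next
  case (insert x S)
  obtain C where C: "C > 0" "\<forall>x\<in>S. \<forall>h\<in>H. norm (F x h) \<le> C * g h"
    using insert.IH insert.prems by blast
  obtain B where B: "\<forall>h\<in>H. norm (F x h) \<le> B * g h" using insert.prems[of x] by blast
  have "norm (F y h) \<le> max C B * g h" if "y \<in> insert x S" "h \<in> H" for y h
  proof (cases "y = x")
    case True
    then have "norm (F y h) \<le> B * g h" using B that by simp
    also have "\<dots> \<le> max C B * g h" using assms(2)[OF that(2)] by (intro mult_right_mono) auto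
    finally show ?thesis .
  next
    case False
    then have "norm (F y h) \<le> C * g h" using C that by simp
    also have "\<dots> \<le> max C B * g h" using assms(2)[OF that(2)] by (intro mult_right_mono) auto
    finally show ?thesis .
  qed
  then show ?case using C(1) by (intro exI[of _ "max C B"]) auto
qed

lemma sum_reverse:
  fixes g :: "nat \<Rightarrow> complex"
  assumes "n \<ge> 2" "g (n - 1) = 0"
  shows "(\<Sum>j=2..n. g (n - j)) = (\<Sum>l<n. g l)"
proof -
  have "(\<Sum>l<n. g l) = (\<Sum>i<n. g (n - Suc i))" by (rule sum.nat_diff_reindex[symmetric])
  also have "\<dots> = (\<Sum>j=1..n. g (n - j))" by (simp add: sum.atLeast1_atMost_eq)
  also have "\<dots> = g (n - 1) + (\<Sum>j=2..n. g (n - j))"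
    using assms(1) by (subst sum.atLeast_Suc_atMost) (simp_all add: numeral_2_eq_2)
  finally show ?thesis using assms(2) by simp
qed

text \<open>Two values with this property differ by \<open>\<lambda> ^ d\<close> times a constant that is \<open>O(\<lambda> ^ (d - 1))\<close>, which
  forces the constant to vanish.\<close>
lemma top_coeffI:
  assumes f: "\<And>lam. norm lam \<ge> B \<Longrightarrow> norm (f lam - lam powi d * x) \<le> C * norm (lam powi (d - 1))"
  shows "top_coeff d f = x"
  unfolding top_coeff_def
proof (rule the_equality)
  show "(\<lambda>lam. f lam - lam powi d * x) \<in> O[at_infinity](\<lambda>lam. lam powi (d - 1))"
    by (rule bigoI[where c = C]) (use f in \<open>auto simp: eventually_at_infinity\<close>)
  fix y assume y: "(\<lambda>lam. f lam - lam powi d * y) \<in> O[at_infinity](\<lambda>lam. lam powi (d - 1))"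
  then obtain K where K: "K > 0"
    "eventually (\<lambda>lam. norm (f lam - lam powi d * y) \<le> K * norm (lam powi (d - 1))) at_infinity"
    by (rule landau_o.bigE)
  then obtain B' where B': "\<And>lam. norm lam \<ge> B' \<Longrightarrow> norm (f lam - lam powi d * y) \<le> K * norm (lam powi (d - 1))"
    unfolding eventually_at_infinity by blast
  show "y = x"
  proof (rule ccontr)
    assume "y \<noteq> x"
    then have pos: "norm (y - x) > 0" by simp
    define r where "r = max 1 (max B (max B' ((\<bar>C\<bar> + K) / norm (y - x) + 1)))"
    define lam where "lam = complex_of_real r"
    have r: "r \<ge> 1" "r \<ge> B" "r \<ge> B'" "r > (\<bar>C\<bar> + K) / norm (y - x)" by (auto simp: r_def)
    then have lam: "norm lam = r" "lam \<noteq> 0" by (auto simp: lam_def)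
    have step: "lam powi d = lam powi (d - 1) * lam"
      using lam(2) power_int_add[of lam "d - 1" 1] by simp
    have "norm (lam powi d * (y - x)) =
        norm ((f lam - lam powi d * x) - (f lam - lam powi d * y))" by (simp add: algebra_simps)
    also have "\<dots> \<le> C * norm (lam powi (d - 1)) + K * norm (lam powi (d - 1))"
      using r lam by (intro order_trans[OF norm_triangle_ineq4] add_mono f B') auto
    also have "\<dots> \<le> (\<bar>C\<bar> + K) * norm (lam powi (d - 1))"
      by (simp add: distrib_right mult_right_mono)
    finally have "norm (lam powi (d - 1)) * (r * norm (y - x)) \<le> norm (lam powi (d - 1)) * (\<bar>C\<bar> + K)"
      by (simp add: step norm_mult lam(1) mult_ac)
    then have "r * norm (y - x) \<le> \<bar>C\<bar> + K"
      using lam(2) by (simp add: mult_le_cancel_left_pos)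
    moreover have "\<bar>C\<bar> + K < r * norm (y - x)" using r(4) pos by (simp add: divide_less_eq)
    ultimately show False by simp
  qed
qed

context regular_pencil
begin

text \<open>In the component \<open>n - k\<close> of the \<open>n\<close>-th derivative the zeroth order term is absent, and the scalar
  \<open>a\<close> contributes to the first order term only for \<open>k = 1\<close>. What remains for \<open>k \<ge> 2\<close> is the sum along
  a diagonal of \<open>A\<^sub>1\<close>, a trace against a power of \<open>N\<close>.\<close>
lemma frame_estimates:
  assumes z: "z \<in> W"
  shows "\<exists>C>0. \<forall>h\<in>H. (\<forall>i<n. \<forall>j<n. norm (frame1 j i h z - (if i = j then 1 else 0)) \<le> C * norm h) \<and>
    (\<forall>i<n. norm (frame1 n i h z) \<le> C * norm h) \<and>
    (\<forall>k\<in>{2..n}. norm (frame1 n (n - k) h z - h * tau n (k - 1) (A1 z)) \<le> C * (norm h)\<^sup>2)"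
proof -
  let ?a = "log_factor d_z"
  have a: "smooth_family H W ?a" by (rule log_factor_family[OF derivation_d_z])
  have first: "\<exists>C. \<forall>h\<in>H. norm (frame1 j i h z - (if i = j then 1 else 0)) \<le> C * norm h"
    if i: "i < n" and j: "j \<le> n" for i j
  proof -
    obtain R where R: "smooth_family H W (R i)" and eq: "\<forall>h\<in>H. \<forall>w\<in>W.
       frame1 j i h w = (if i = j then 1 else 0) + h * slope ?a j i h w + h\<^sup>2 * R i h w"
      using frame_expansion[OF a j] i by blast
    have "smooth_family H W (\<lambda>h w. slope ?a j i h w + h * R i h w)"
      using i j by (intro fam slope_family a R)
    then obtain C where C: "\<And>h. h \<in> H \<Longrightarrow> norm (slope ?a j i h z + h * R i h z) \<le> C"
      by (rule smooth_family_bounded) (use z in auto)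
    have "norm (frame1 j i h z - (if i = j then 1 else 0)) \<le> C * norm h" if h: "h \<in> H" for h
    proof -
      have "frame1 j i h z - (if i = j then 1 else 0) = (slope ?a j i h z + h * R i h z) * h"
        using eq h z by (simp add: algebra_simps power2_eq_square)
      then show ?thesis using C[OF h] by (simp add: norm_mult mult_right_mono)
    qed
    then show ?thesis by blast
  qed
  have second: "\<exists>C. \<forall>h\<in>H. norm (frame1 n (n - k) h z - h * tau n (k - 1) (A1 z)) \<le> C * (norm h)\<^sup>2"
    if k: "k \<in> {2..n}" for k
  proof -
    have i: "n - k < n" using k by auto
    obtain R where R: "smooth_family H W (R (n - k))" and eq: "\<forall>h\<in>H. \<forall>w\<in>W.
       frame1 n (n - k) h w = (if n - k = n then 1 else 0) + h * slope ?a n (n - k) h w + h\<^sup>2 * R (n - k) h w"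
      using frame_expansion[OF a, of n] i by blast
    obtain C where C: "\<And>h. h \<in> H \<Longrightarrow> norm (R (n - k) h z) \<le> C"
      by (rule smooth_family_bounded[OF R]) (use z in auto)
    \<comment> \<open>reversing the order of summation turns the slope into the trace\<close>
    have slope: "slope ?a n (n - k) h z = tau n (k - 1) (A1 z)" for h
    proof -
      have "z \<in> D" using z W by auto
      then have "tau n (k - 1) (A1 z) = (\<Sum>i<n - (k - 1). A1 z $$ (i, i + (k - 1)))"
        unfolding tau_def by (rule trace_shift_mult[OF carrier(3)])
      also have "\<dots> = (\<Sum>i<n - (k - 1). A1 z $$ (n - (k - 1) - Suc i, n - (k - 1) - Suc i + (k - 1)))"
        by (rule sum.nat_diff_reindex[symmetric])
      also have "\<dots> = (\<Sum>q\<in>{q \<in> {..<n}. q \<le> n - k}. A1 z $$ (n - k - q, n - 1 - q))"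
        using k by (intro sum.cong) auto
      also have "\<dots> = (\<Sum>q<n. if q \<le> n - k then A1 z $$ (n - k - q, n - 1 - q) else 0)"
        by (rule sum.inter_filter) simp
      finally show ?thesis using k by (auto simp: slope_def)
    qed
    have "norm (frame1 n (n - k) h z - h * tau n (k - 1) (A1 z)) \<le> C * (norm h)\<^sup>2" if h: "h \<in> H" for h
    proof -
      have "frame1 n (n - k) h z - h * tau n (k - 1) (A1 z) = R (n - k) h z * h\<^sup>2"
        using eq h z slope i by simp
      then show ?thesis using C[OF h] by (simp add: norm_mult norm_power mult_right_mono)
    qed
    then show ?thesis by blast
  qed
  obtain C1 where C1: "C1 > 0" "\<forall>x\<in>{..<n} \<times> {..n}. \<forall>h\<in>H.
      norm (frame1 (snd x) (fst x) h z - (if fst x = snd x then 1 else 0)) \<le> C1 * norm h"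
    using uniform_constant[of "{..<n} \<times> {..n}" H norm
        "\<lambda>x h. frame1 (snd x) (fst x) h z - (if fst x = snd x then 1 else 0)"] first by auto
  obtain C2 where C2: "C2 > 0" "\<forall>k\<in>{2..n}. \<forall>h\<in>H.
      norm (frame1 n (n - k) h z - h * tau n (k - 1) (A1 z)) \<le> C2 * (norm h)\<^sup>2"
    using uniform_constant[of "{2..n}" H "\<lambda>h. (norm h)\<^sup>2"
        "\<lambda>k h. frame1 n (n - k) h z - h * tau n (k - 1) (A1 z)"] second by auto
  let ?C = "max C1 C2"
  have le: "C1 * t \<le> ?C * t" "C2 * t \<le> ?C * t" if "t \<ge> 0" for t :: real
    using that by (auto intro: mult_right_mono)
  show ?thesis
  proof (intro exI[of _ ?C] conjI ballI allI impI)
    fix h i j assume h: "h \<in> H" and i: "i < n"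
    show "norm (frame1 j i h z - (if i = j then 1 else 0)) \<le> ?C * norm h" if "j < n"
      using C1(2)[rule_format, of "(i, j)" h] h i that le(1)[of "norm h"] by auto
    show "norm (frame1 n i h z) \<le> ?C * norm h"
      using C1(2)[rule_format, of "(i, n)" h] h i le(1)[of "norm h"] by auto
  next
    fix h k assume "h \<in> H" "k \<in> {2..n}"
    then show "norm (frame1 n (n - k) h z - h * tau n (k - 1) (A1 z)) \<le> ?C * (norm h)\<^sup>2"
      using C2(2) le(2)[of "(norm h)\<^sup>2"] order_trans by fastforce
  qed (use C1 in auto)
qed

definition independent_at :: "complex \<Rightarrow> complex \<Rightarrow> bool" where
  "independent_at h z \<longleftrightarrow> (\<forall>x y. (\<forall>i<n. (\<Sum>j<n. x j * frame1 j i h z) = (\<Sum>j<n. y j * frame1 j i h z)) \<longrightarrow>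
     (\<forall>j<n. x j = y j))"

text \<open>Dividing the relation for \<open>\<nabla> ^ n s\<close> by \<open>f \<lambda> ^ n\<close> gives a linear system in the rescaled frame that
  does not refer to the section any more; so all adapted sections yield the same coefficients.\<close>
lemma hat_t_eq:
  assumes lam: "lam \<noteq> 0" "inverse lam \<in> H" and z: "z \<in> W" and ind: "independent_at (inverse lam) z"
    and x: "\<And>i. i < n \<Longrightarrow> frame1 n i (inverse lam) z = (\<Sum>j<n. x j * frame1 j i (inverse lam) z)"
    and k: "k \<in> {2..n}"
  shows "hat_t n D e \<omega> (conn1 lam) k z = lam ^ k * x (n - k)"
proof -
  let ?h = "inverse lam"
  obtain V f where V: "z \<in> V" and f: "unit_root lam V f" using unit_root_exists[OF lam z] by blast
  have VW: "open V" "V \<subseteq> W" using f unfolding unit_root_def by auto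
  have x0: "x (n - 1) = 0" by (rule top_frame_last_zero[OF lam f V x])
  have lam_pow: "lam ^ n = lam ^ j * lam ^ (n - j)" if "j \<le> n" for j
    using that by (simp flip: power_add)
  show ?thesis unfolding hat_t_def
  proof (rule the_equality)
    let ?s = "\<lambda>w. f w \<cdot>\<^sub>v e w" and ?a = "\<lambda>j. lam ^ j * x (n - j)"
    have rel: "vec_index ((nabla n d_z (conn1 lam) ^^ n) ?s z) i =
        (\<Sum>j = 2..n. ?a j * vec_index ((nabla n d_z (conn1 lam) ^^ (n - j)) ?s z) i)" if i: "i < n" for i
    proof -
      have "(\<Sum>j = 2..n. ?a j * vec_index ((nabla n d_z (conn1 lam) ^^ (n - j)) ?s z) i) =
          (\<Sum>j = 2..n. f z * lam ^ n * (x (n - j) * frame1 (n - j) i ?h z))"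
        using i by (intro sum.cong refl) (simp add: unit_root_nabla[OF lam f V] flip: lam_pow)
      also have "\<dots> = f z * lam ^ n * (\<Sum>j = 2..n. x (n - j) * frame1 (n - j) i ?h z)"
        by (simp add: sum_distrib_left)
      also have "(\<Sum>j = 2..n. x (n - j) * frame1 (n - j) i ?h z) = frame1 n i ?h z"
        unfolding x[OF i] by (rule sum_reverse[OF n, of "\<lambda>l. x l * frame1 l i ?h z"]) (use x0 in simp)
      finally show ?thesis using i by (simp add: unit_root_nabla[OF lam f V])
    qed
    show "\<exists>U s a. open U \<and> U \<subseteq> D \<and> z \<in> U \<and> adapted_section n e \<omega> (conn1 lam) U s \<and>
      (\<forall>i<n. vec_index ((nabla n d_z (conn1 lam) ^^ n) s z) i =
        (\<Sum>j = 2..n. a j * vec_index ((nabla n d_z (conn1 lam) ^^ (n - j)) s z) i)) \<and>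
      lam ^ k * x (n - k) = a k"
      by (rule exI[of _ V], rule exI[of _ ?s], rule exI[of _ ?a])
        (use V VW W rel adapted_sectionI[OF lam f] in auto)
  next
    fix t
    assume "\<exists>U s a. open U \<and> U \<subseteq> D \<and> z \<in> U \<and> adapted_section n e \<omega> (conn1 lam) U s \<and>
      (\<forall>i<n. vec_index ((nabla n d_z (conn1 lam) ^^ n) s z) i =
        (\<Sum>j = 2..n. a j * vec_index ((nabla n d_z (conn1 lam) ^^ (n - j)) s z) i)) \<and> t = a k"
    then obtain U s a where U: "open U" "z \<in> U" and s: "adapted_section n e \<omega> (conn1 lam) U s"
      and rel: "\<And>i. i < n \<Longrightarrow> vec_index ((nabla n d_z (conn1 lam) ^^ n) s z) i =
        (\<Sum>j = 2..n. a j * vec_index ((nabla n d_z (conn1 lam) ^^ (n - j)) s z) i)" and t: "t = a k"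
      by blast
    obtain V f where V: "z \<in> V" and f: "unit_root lam V f" and s_eq: "\<And>w. w \<in> V \<Longrightarrow> s w = f w \<cdot>\<^sub>v e w"
      using adapted_section_unit_root[OF lam z U s] by blast
    note nab = unit_root_nabla[OF lam f V s_eq]
    \<comment> \<open>the relation has no term with \<open>\<nabla> ^ (n - 1) s\<close>, which is the coefficient with index \<open>n - 1\<close>\<close>
    define y where "y l = (if l = n - 1 then 0 else a (n - l) * ?h ^ (n - l))" for l
    have "(\<Sum>j<n. x j * frame1 j i ?h z) = (\<Sum>j<n. y j * frame1 j i ?h z)" if i: "i < n" for i
    proof -
      have "f z * lam ^ n * frame1 n i ?h z = (\<Sum>j = 2..n. a j * (f z * lam ^ (n - j) * frame1 (n - j) i ?h z))"
        using rel[OF i] i by (simp add: nab)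
      also have "\<dots> = (\<Sum>j = 2..n. f z * lam ^ n * (y (n - j) * frame1 (n - j) i ?h z))"
      proof (intro sum.cong refl)
        fix j assume j: "j \<in> {2..n}"
        then have "y (n - j) = a j * ?h ^ j" by (auto simp: y_def)
        moreover have "lam ^ n * ?h ^ j = lam ^ (n - j)"
          using lam_pow[of j] j lam(1) by (simp add: power_inverse field_simps)
        ultimately show "a j * (f z * lam ^ (n - j) * frame1 (n - j) i ?h z) =
            f z * lam ^ n * (y (n - j) * frame1 (n - j) i ?h z)"
          by (simp add: mult_ac)
      qed
      also have "\<dots> = f z * lam ^ n * (\<Sum>j = 2..n. y (n - j) * frame1 (n - j) i ?h z)"
        by (simp add: sum_distrib_left)
      also have "(\<Sum>j = 2..n. y (n - j) * frame1 (n - j) i ?h z) = (\<Sum>j<n. y j * frame1 j i ?h z)"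
        by (rule sum_reverse[OF n, of "\<lambda>l. y l * frame1 l i ?h z"]) (use n in \<open>simp add: y_def\<close>)
      finally have "frame1 n i ?h z = (\<Sum>j<n. y j * frame1 j i ?h z)"
        using lam(1) unit_root_nz[OF f V] by simp
      then show ?thesis using x[OF i] by simp
    qed
    then have "x (n - k) = y (n - k)" using ind k n unfolding independent_at_def by auto
    also have "\<dots> = a k * ?h ^ k" using k by (auto simp: y_def)
    finally show "t = lam ^ k * x (n - k)" using t lam(1) by (simp add: power_inverse field_simps)
  qed
qed

lemma hat_mu_eq:
  assumes lam: "lam \<noteq> 0" "inverse lam \<in> H" and z: "z \<in> W" and ind: "independent_at (inverse lam) z"
    and x: "\<And>i. i < n \<Longrightarrow> zbar_column i (inverse lam) z = (\<Sum>j<n. x j * frame1 j i (inverse lam) z)"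
    and k: "k \<in> {1..n}"
  shows "hat_mu n D e \<omega> (conn1 lam) (conn2 lam) k z = lam * inverse lam ^ (k - 1) * x (k - 1)"
proof -
  let ?h = "inverse lam"
  obtain V f where V: "z \<in> V" and f: "unit_root lam V f" using unit_root_exists[OF lam z] by blast
  have VW: "open V" "V \<subseteq> W" using f unfolding unit_root_def by auto
  have shift: "(\<Sum>j = 1..n. g j) = (\<Sum>l<n. g (Suc l))" for g :: "nat \<Rightarrow> complex"
    by (simp add: sum.atLeast1_atMost_eq)
  show ?thesis unfolding hat_mu_def
  proof (rule the_equality)
    let ?s = "\<lambda>w. f w \<cdot>\<^sub>v e w" and ?a = "\<lambda>j. lam * ?h ^ (j - 1) * x (j - 1)"
    have rel: "vec_index (nabla n d_zbar (conn2 lam) ?s z) i =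
        (\<Sum>j = 1..n. ?a j * vec_index ((nabla n d_z (conn1 lam) ^^ (j - 1)) ?s z) i)" if i: "i < n" for i
    proof -
      have "(\<Sum>j = 1..n. ?a j * vec_index ((nabla n d_z (conn1 lam) ^^ (j - 1)) ?s z) i) =
          (\<Sum>l<n. f z * lam * (x l * frame1 l i ?h z))"
        unfolding shift using i lam(1)
        by (intro sum.cong refl) (simp add: unit_root_nabla[OF lam f V] power_inverse field_simps)
      also have "\<dots> = f z * lam * zbar_column i ?h z"
        by (simp add: sum_distrib_left x[OF i])
      finally show ?thesis using unit_root_nabla_zbar[OF lam f V _ i, of ?s] by simp
    qed
    show "\<exists>U s a. open U \<and> U \<subseteq> D \<and> z \<in> U \<and> adapted_section n e \<omega> (conn1 lam) U s \<and>
      (\<forall>i<n. vec_index (nabla n d_zbar (conn2 lam) s z) i =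
        (\<Sum>j = 1..n. a j * vec_index ((nabla n d_z (conn1 lam) ^^ (j - 1)) s z) i)) \<and>
      lam * ?h ^ (k - 1) * x (k - 1) = a k"
      by (rule exI[of _ V], rule exI[of _ ?s], rule exI[of _ ?a])
        (use V VW W rel adapted_sectionI[OF lam f] in auto)
  next
    fix t
    assume "\<exists>U s a. open U \<and> U \<subseteq> D \<and> z \<in> U \<and> adapted_section n e \<omega> (conn1 lam) U s \<and>
      (\<forall>i<n. vec_index (nabla n d_zbar (conn2 lam) s z) i =
        (\<Sum>j = 1..n. a j * vec_index ((nabla n d_z (conn1 lam) ^^ (j - 1)) s z) i)) \<and> t = a k"
    then obtain U s a where U: "open U" "z \<in> U" and s: "adapted_section n e \<omega> (conn1 lam) U s"
      and rel: "\<And>i. i < n \<Longrightarrow> vec_index (nabla n d_zbar (conn2 lam) s z) i =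
        (\<Sum>j = 1..n. a j * vec_index ((nabla n d_z (conn1 lam) ^^ (j - 1)) s z) i)" and t: "t = a k"
      by blast
    obtain V f where V: "z \<in> V" and f: "unit_root lam V f" and s_eq: "\<And>w. w \<in> V \<Longrightarrow> s w = f w \<cdot>\<^sub>v e w"
      using adapted_section_unit_root[OF lam z U s] by blast
    define y where "y l = ?h * lam ^ l * a (Suc l)" for l
    have "(\<Sum>j<n. x j * frame1 j i ?h z) = (\<Sum>j<n. y j * frame1 j i ?h z)" if i: "i < n" for i
    proof -
      have "f z * lam * zbar_column i ?h z = (\<Sum>j = 1..n. a j * (f z * lam ^ (j - 1) * frame1 (j - 1) i ?h z))"
        using rel[OF i] i unit_root_nabla_zbar[OF lam f V s_eq i] by (simp add: unit_root_nabla[OF lam f V s_eq])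
      also have "\<dots> = (\<Sum>l<n. f z * lam * (y l * frame1 l i ?h z))"
        unfolding shift using lam(1) by (intro sum.cong refl) (simp add: y_def)
      also have "\<dots> = f z * lam * (\<Sum>l<n. y l * frame1 l i ?h z)"
        by (simp add: sum_distrib_left)
      finally have "zbar_column i ?h z = (\<Sum>l<n. y l * frame1 l i ?h z)"
        using lam(1) unit_root_nz[OF f V] by simp
      then show ?thesis using x[OF i] by simp
    qed
    then have "x (k - 1) = y (k - 1)" using ind k n unfolding independent_at_def by auto
    also have "\<dots> = ?h * lam ^ (k - 1) * a k" using k by (simp add: y_def)
    finally show "t = lam * ?h ^ (k - 1) * x (k - 1)" using t lam(1) by (simp add: power_inverse field_simps)
  qed
qed

end


section \<open>Asymptotics of the parameters\<close>
context regular_pencil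
begin

lemma zbar_column_estimate:
  assumes z: "z \<in> W"
  shows "\<exists>C>0. \<forall>i\<in>{..<n}. \<forall>h\<in>H. norm (zbar_column i h z - F2 z $$ (i, 0)) \<le> C * norm h"
proof (rule uniform_constant)
  fix i assume "i \<in> {..<n}"
  have "smooth_family H W (\<lambda>h w. A2 z $$ (i, 0) + (if i = 0 then log_factor d_zbar h w else 0) + h * P2 z $$ (i, 0))"
    using log_factor_family[OF derivation_d_zbar] by (cases "i = 0") (auto intro!: fam)
  then obtain C where C: "\<And>h. h \<in> H \<Longrightarrow> norm (A2 z $$ (i, 0) + (if i = 0 then log_factor d_zbar h z else 0) + h * P2 z $$ (i, 0)) \<le> C"
    by (rule smooth_family_bounded) (use z in auto)
  have "norm (zbar_column i h z - F2 z $$ (i, 0)) \<le> C * norm h" if h: "h \<in> H" for h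
    using mult_left_mono[OF C[OF h], of "norm h"] by (simp add: zbar_column_def norm_mult mult.commute)
  then show "\<exists>C. \<forall>h\<in>H. norm (zbar_column i h z - F2 z $$ (i, 0)) \<le> C * norm h" by blast
qed auto

text \<open>Both parameters are, up to powers of \<open>\<lambda>\<close>, solutions of a linear system whose matrix is
  \<open>1 + O(h)\<close>. The right hand side for \<open>\<nabla> ^ n s\<close> is itself \<open>O(h)\<close>, so the solution agrees with it
  up to \<open>O(h\<^sup>2)\<close> and its first order term \<open>h * tau\<close> survives; for the \<open>dzbar\<close> derivative the
  right hand side is \<open>\<Phi>\<^sub>2 e + O(h)\<close>, with components \<open>\<mu>\<^sub>k\<close>.\<close>
lemma hat_asymptotics:
  assumes z: "z \<in> W" and \<epsilon>: "\<epsilon> > 0" "ball 0 \<epsilon> \<subseteq> H"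
  shows "\<exists>B K. B > 0 \<and> (\<forall>lam. norm lam \<ge> B \<longrightarrow> (\<forall>k\<in>{2..n}.
    norm (hat_t n D e \<omega> (conn1 lam) k z - lam ^ k * inverse lam * tau n (k - 1) (A1 z))
      \<le> K * norm (lam ^ k * (inverse lam)\<^sup>2) \<and>
    norm (hat_mu n D e \<omega> (conn1 lam) (conn2 lam) k z - lam * inverse lam ^ (k - 1) * m k z)
      \<le> K * norm (inverse lam ^ (k - 1))))"
proof -
  obtain C where C: "C > 0"
    and near: "\<And>h i j. h \<in> H \<Longrightarrow> i < n \<Longrightarrow> j < n \<Longrightarrow> norm (frame1 j i h z - (if i = j then 1 else 0)) \<le> C * norm h"
    and small: "\<And>h i. h \<in> H \<Longrightarrow> i < n \<Longrightarrow> norm (frame1 n i h z) \<le> C * norm h"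
    and expand: "\<And>h k. h \<in> H \<Longrightarrow> k \<in> {2..n} \<Longrightarrow>
      norm (frame1 n (n - k) h z - h * tau n (k - 1) (A1 z)) \<le> C * (norm h)\<^sup>2"
    using frame_estimates[OF z] by blast
  obtain Z where Z: "Z > 0"
    and column: "\<And>i h. i < n \<Longrightarrow> h \<in> H \<Longrightarrow> norm (zbar_column i h z - F2 z $$ (i, 0)) \<le> Z * norm h"
    using zbar_column_estimate[OF z] by auto
  define S where "S = (\<Sum>i<n. Z + norm (F2 z $$ (i, 0)))"
  have S0: "S \<ge> 0" unfolding S_def using Z by (intro sum_nonneg) auto
  define K where "K = max (2 * C * (n * C) + C) (2 * C * S + Z)"
  \<comment> \<open>the first bound gives \<open>norm h \<le> 1\<close>, the second one closeness to the identity, the third one \<open>h \<in> H\<close>\<close>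
  define B where "B = max 1 (max (2 * C * n) (2 / \<epsilon>))"
  have B: "B > 0" by (simp add: B_def)
  have main: "norm (hat_t n D e \<omega> (conn1 lam) k z - lam ^ k * inverse lam * tau n (k - 1) (A1 z))
      \<le> K * norm (lam ^ k * (inverse lam)\<^sup>2) \<and>
    norm (hat_mu n D e \<omega> (conn1 lam) (conn2 lam) k z - lam * inverse lam ^ (k - 1) * m k z)
      \<le> K * norm (inverse lam ^ (k - 1))"
    if lamB: "norm lam \<ge> B" and k: "k \<in> {2..n}" for lam k
  proof -
    let ?h = "inverse lam"
    have lamB': "norm lam \<ge> 1" "norm lam \<ge> 2 * C * n" "norm lam \<ge> 2 / \<epsilon>" using lamB by (auto simp: B_def)
    have lam0: "lam \<noteq> 0" using lamB' by auto
    have h_norm: "norm ?h = 1 / norm lam" by (simp add: norm_divide inverse_eq_divide)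
    have lam_pos: "norm lam > 0" using lam0 by simp
    have h1: "norm ?h \<le> 1" unfolding h_norm using lamB'(1) lam_pos by (simp only: divide_le_eq_1_pos)
    have "norm lam * \<epsilon> \<ge> 2" using lamB'(3) \<epsilon>(1) by (simp add: divide_le_eq)
    then have "norm ?h < \<epsilon>" unfolding h_norm using lam_pos by (simp add: divide_less_eq mult.commute)
    then have hH: "?h \<in> H" using \<epsilon>(2) by auto
    have \<kappa>: "C * norm ?h * n \<le> 1 / 2" unfolding h_norm using lamB'(2) lam_pos by (simp add: field_simps)
    note solve = near_identity_solution[of n "\<lambda>j i. frame1 j i ?h z", OF near[OF hH] \<kappa>]
    have ind: "independent_at ?h z"
      unfolding independent_at_def
    proof (intro allI impI)
      fix x y :: "nat \<Rightarrow> complex" and j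
      assume eq: "\<forall>i<n. (\<Sum>j<n. x j * frame1 j i ?h z) = (\<Sum>j<n. y j * frame1 j i ?h z)" and j: "j < n"
      have "norm ((x j - y j) - 0) \<le> 2 * (C * norm ?h) * (\<Sum>j<n. norm (0 :: complex))"
        by (rule solve) (use eq j in \<open>auto simp: left_diff_distrib sum_subtractf\<close>)
      then show "x j = y j" by simp
    qed
    obtain V f where V: "z \<in> V" and f: "unit_root lam V f"
      using unit_root_exists[OF lam0 hH z] by blast
    obtain x where x: "\<And>i. i < n \<Longrightarrow> frame1 n i ?h z = (\<Sum>j<n. x j * frame1 j i ?h z)"
      using frame1_solution[OF lam0 hH f V, of "\<lambda>i. frame1 n i ?h z"] by blast
    obtain y where y: "\<And>i. i < n \<Longrightarrow> zbar_column i ?h z = (\<Sum>j<n. y j * frame1 j i ?h z)"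
      using frame1_solution[OF lam0 hH f V, of "\<lambda>i. zbar_column i ?h z"] by blast
    have nk: "n - k < n" "k - 1 < n" using k by auto
    have "norm (x (n - k) - frame1 n (n - k) ?h z) \<le> 2 * (C * norm ?h) * (\<Sum>j<n. norm (frame1 n j ?h z))"
      by (rule solve) (use x nk in auto)
    also have "\<dots> \<le> 2 * (C * norm ?h) * (\<Sum>j<n. C * norm ?h)"
      using C small[OF hH] by (intro mult_left_mono sum_mono) auto
    also have "\<dots> = 2 * C * (n * C) * (norm ?h)\<^sup>2" by (simp add: power2_eq_square)
    finally have "norm (x (n - k) - ?h * tau n (k - 1) (A1 z)) \<le> 2 * C * (n * C) * (norm ?h)\<^sup>2 + C * (norm ?h)\<^sup>2"
      by (rule norm_diff_triangle_le[OF _ expand[OF hH k]])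
    also have "\<dots> \<le> K * (norm ?h)\<^sup>2"
      unfolding distrib_right[symmetric] by (intro mult_right_mono) (auto simp: K_def)
    finally have xk: "norm (x (n - k) - ?h * tau n (k - 1) (A1 z)) \<le> K * (norm ?h)\<^sup>2" .
    have "hat_t n D e \<omega> (conn1 lam) k z - lam ^ k * ?h * tau n (k - 1) (A1 z) =
        lam ^ k * (x (n - k) - ?h * tau n (k - 1) (A1 z))"
      by (simp add: hat_t_eq[OF lam0 hH z ind x k] algebra_simps)
    then have 1: "norm (hat_t n D e \<omega> (conn1 lam) k z - lam ^ k * ?h * tau n (k - 1) (A1 z))
        \<le> K * norm (lam ^ k * ?h\<^sup>2)"
      using mult_left_mono[OF xk, of "norm (lam ^ k)"] by (simp add: norm_mult norm_power mult_ac)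
    have "norm (y (k - 1) - zbar_column (k - 1) ?h z) \<le> 2 * (C * norm ?h) * (\<Sum>j<n. norm (zbar_column j ?h z))"
      by (rule solve) (use y nk in auto)
    also have "\<dots> \<le> 2 * (C * norm ?h) * S"
      unfolding S_def
    proof (intro mult_left_mono sum_mono)
      fix j assume "j \<in> {..<n}"
      then have "norm (zbar_column j ?h z - F2 z $$ (j, 0)) \<le> Z * norm ?h" using column hH by auto
      also have "\<dots> \<le> Z * 1" using Z h1 by (intro mult_left_mono) auto
      finally show "norm (zbar_column j ?h z) \<le> Z + norm (F2 z $$ (j, 0))"
        using norm_triangle_sub[of "zbar_column j ?h z" "F2 z $$ (j, 0)"] by linarith
    qed (use C in auto)
    also have "\<dots> = 2 * C * S * norm ?h" by simp
    finally have "norm (y (k - 1) - F2 z $$ (k - 1, 0)) \<le> 2 * C * S * norm ?h + Z * norm ?h"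
      by (rule norm_diff_triangle_le[OF _ column[OF nk(2) hH]])
    also have "\<dots> \<le> K * norm ?h"
      unfolding distrib_right[symmetric] by (intro mult_right_mono) (auto simp: K_def)
    also have "F2 z $$ (k - 1, 0) = m k z"
      using k z W by (auto simp: F2 shift_poly_def subset_iff)
    finally have yk: "norm (y (k - 1) - m k z) \<le> K * norm ?h" .
    have "hat_mu n D e \<omega> (conn1 lam) (conn2 lam) k z - lam * ?h ^ (k - 1) * m k z =
        lam * ?h ^ (k - 1) * (y (k - 1) - m k z)"
      using k by (subst hat_mu_eq[OF lam0 hH z ind y]) (auto simp: algebra_simps)
    then have "norm (hat_mu n D e \<omega> (conn1 lam) (conn2 lam) k z - lam * ?h ^ (k - 1) * m k z)
        \<le> norm (lam * ?h ^ (k - 1)) * (K * norm ?h)"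
      using mult_left_mono[OF yk, of "norm (lam * ?h ^ (k - 1))"] by (simp add: norm_mult)
    also have "\<dots> = K * norm (?h ^ (k - 1) * (lam * ?h))"
      unfolding norm_mult by (simp only: mult_ac)
    also have "\<dots> = K * norm (?h ^ (k - 1))" using lam0 by simp
    finally show ?thesis using 1 by blast
  qed
  then show ?thesis using B by blast
qed

end

context local_pencil
begin

text \<open>At \<open>h = 0\<close> the frame is the standard basis, so the Wronskian is \<open>\<omega> * (1 + h * R)\<close> with \<open>R\<close>
  bounded, and it stays away from zero for small \<open>h\<close>.\<close>
lemma regular_neighbourhood:
  assumes z: "z \<in> D"
  shows "\<exists>\<epsilon>>0. \<exists>r>0. regular_pencil n D e \<omega> m F1 F2 A1 A2 P1 P2 (ball 0 \<epsilon>) (ball z r)"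
proof -
  obtain r where r: "r > 0" "cball z r \<subseteq> D" using D z open_contains_cball by blast
  have fam: "smooth_family H (ball z r) (\<lambda>h. f)" if "smooth_on D f" for f and H :: "complex set"
    by (rule smooth_on_imp_smooth_family[OF that _ _ r(2)]) auto
  have pencil: "pencil_on n D e \<omega> m F1 F2 A1 A2 P1 P2 H (ball z r)" if "bounded H" for H
    using that r A1 P1 vol(1) ball_subset_cball[of z r]
    by unfold_locales (auto intro!: fam simp: smooth_mat_on_def)
  interpret one: pencil_on n D e \<omega> m F1 F2 A1 A2 P1 P2 "ball 0 1" "ball z r"
    by (rule pencil) simp
  obtain R where R: "smooth_family (ball 0 1) (ball z r) R"
    and exp: "\<And>h w. h \<in> ball 0 1 \<Longrightarrow> w \<in> ball z r \<Longrightarrow> wronskian h w = \<omega> w * (1 + h * R h w)"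
    using one.wronskian_expansion by blast
  obtain C where C: "C > 0" "\<And>h w. h \<in> ball 0 1 \<Longrightarrow> w \<in> ball z r \<Longrightarrow> norm (R h w) \<le> C"
    by (rule smooth_family_bounded[OF R]) auto
  have "continuous_on (cball z r) (\<lambda>w. norm (\<omega> w))"
    using vol(1) r(2)
    by (intro continuous_on_norm continuous_at_imp_continuous_on)
      (auto intro!: differentiable_imp_continuous_within smooth_on_differentiable)
  then obtain w0 where w0: "w0 \<in> cball z r" "\<And>w. w \<in> cball z r \<Longrightarrow> norm (\<omega> w0) \<le> norm (\<omega> w)"
    using continuous_attains_inf[of "cball z r" "\<lambda>w. norm (\<omega> w)"] r(1) by auto
  define \<delta> where "\<delta> = norm (\<omega> w0)"
  have \<delta>: "\<delta> > 0" using vol(2) w0(1) r(2) by (auto simp: \<delta>_def)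
  define \<epsilon> where "\<epsilon> = min 1 (1 / (2 * C))"
  have \<epsilon>: "\<epsilon> > 0" using C by (simp add: \<epsilon>_def)
  interpret eps: pencil_on n D e \<omega> m F1 F2 A1 A2 P1 P2 "ball 0 \<epsilon>" "ball z r"
    by (rule pencil) simp
  have low: "norm (wronskian h w) \<ge> \<delta> / 2" if h: "h \<in> ball 0 \<epsilon>" and w: "w \<in> ball z r" for h w
  proof -
    have h1: "h \<in> ball 0 1" and hC: "norm h \<le> 1 / (2 * C)" using h by (auto simp: \<epsilon>_def)
    have "norm (h * R h w) \<le> 1 / (2 * C) * C"
      unfolding norm_mult using hC C(2)[OF h1 w] C(1) by (intro mult_mono) auto
    then have "norm (h * R h w) \<le> 1 / 2" using C(1) by simp
    then have "norm (1 + h * R h w) \<ge> 1 / 2"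
      using norm_triangle_ineq4[of "1 + h * R h w" "h * R h w"] by simp
    moreover have "norm (\<omega> w) \<ge> \<delta>" using w0(2)[of w] w by (simp add: \<delta>_def)
    ultimately have "\<delta> * (1 / 2) \<le> norm (\<omega> w) * norm (1 + h * R h w)"
      using \<delta> by (intro mult_mono) auto
    then show ?thesis by (simp add: exp[OF h1 w] norm_mult)
  qed
  have "regular_pencil n D e \<omega> m F1 F2 A1 A2 P1 P2 (ball 0 \<epsilon>) (ball z r)"
  proof unfold_locales
    show "wronskian h w \<noteq> 0" if "h \<in> ball 0 \<epsilon>" "w \<in> ball z r" for h w
      using low[OF that] \<delta> by auto
    show "smooth_family (ball 0 \<epsilon>) (ball z r) (\<lambda>h w. inverse (wronskian h w))"
      by (rule smooth_family_inverse[OF _ eps.wronskian_family, of "\<delta> / 2"]) (use \<delta> low in auto)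
  qed
  then show ?thesis using \<epsilon> r(1) by blast
qed

lemma top_coeff_parameters:
  assumes z: "z \<in> D" and k: "k \<in> {2..n}"
  shows "top_coeff (int k - 1) (\<lambda>lam. hat_t n D e \<omega> (conn1 lam) k z) = tau n (k - 1) (A1 z)"
    and "top_coeff (2 - int k) (\<lambda>lam. hat_mu n D e \<omega> (conn1 lam) (conn2 lam) k z) = m k z"
proof -
  obtain \<epsilon> r where \<epsilon>: "\<epsilon> > 0" and r: "r > 0"
    and reg: "regular_pencil n D e \<omega> m F1 F2 A1 A2 P1 P2 (ball 0 \<epsilon>) (ball z r)"
    using regular_neighbourhood[OF z] by blast
  interpret regular_pencil n D e \<omega> m F1 F2 A1 A2 P1 P2 "ball 0 \<epsilon>" "ball z r" by (rule reg)
  have centre: "z \<in> ball z r" using r by simp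
  obtain B K where B: "B > 0" and bound: "\<forall>lam. norm lam \<ge> B \<longrightarrow> (\<forall>k\<in>{2..n}.
    norm (hat_t n D e \<omega> (conn1 lam) k z - lam ^ k * inverse lam * tau n (k - 1) (A1 z))
      \<le> K * norm (lam ^ k * (inverse lam)\<^sup>2) \<and>
    norm (hat_mu n D e \<omega> (conn1 lam) (conn2 lam) k z - lam * inverse lam ^ (k - 1) * m k z)
      \<le> K * norm (inverse lam ^ (k - 1)))"
    using hat_asymptotics[OF centre \<epsilon> order_refl] by (elim exE conjE)
  have t: "norm (hat_t n D e \<omega> (conn1 lam) k z - lam ^ k * inverse lam * tau n (k - 1) (A1 z))
      \<le> K * norm (lam ^ k * (inverse lam)\<^sup>2)" if "norm lam \<ge> B" for lam
    using bound k that by blast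
  have mu: "norm (hat_mu n D e \<omega> (conn1 lam) (conn2 lam) k z - lam * inverse lam ^ (k - 1) * m k z)
      \<le> K * norm (inverse lam ^ (k - 1))" if "norm lam \<ge> B" for lam
    using bound k that by blast
  have nat: "int k - 1 = int (k - 1)" "int k - 1 - 1 = int (k - 2)" "2 - int k - 1 = - int (k - 1)"
      "2 - int k = 1 - int (k - 1)"
    using k by auto
  have powers: "lam powi (int k - 1) = lam ^ k * inverse lam"
    "lam powi (int k - 1 - 1) = lam ^ k * (inverse lam)\<^sup>2"
    "lam powi (2 - int k) = lam * inverse lam ^ (k - 1)"
    "lam powi (2 - int k - 1) = inverse lam ^ (k - 1)" if "lam \<noteq> 0" for lam :: complex
  proof -
    obtain q where q: "k = Suc (Suc q)" using k by (metis atLeastAtMost_iff numeral_2_eq_2 Suc_le_D Suc_le_mono)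
    show "lam powi (int k - 1) = lam ^ k * inverse lam" "lam powi (int k - 1 - 1) = lam ^ k * (inverse lam)\<^sup>2"
      unfolding nat power_int_of_nat using that q by (simp_all add: power2_eq_square field_simps)
    show 4: "lam powi (2 - int k - 1) = inverse lam ^ (k - 1)"
      unfolding nat(3) by (simp add: power_int_minus power_inverse)
    show "lam powi (2 - int k) = lam * inverse lam ^ (k - 1)"
      unfolding nat(4) using that by (simp add: power_int_diff power_inverse divide_inverse)
  qed
  show "top_coeff (int k - 1) (\<lambda>lam. hat_t n D e \<omega> (conn1 lam) k z) = tau n (k - 1) (A1 z)"
  proof (rule top_coeffI[where B = B and C = K])
    fix lam :: complex assume lam: "norm lam \<ge> B"
    then have nz: "lam \<noteq> 0" using B by auto
    show "norm (hat_t n D e \<omega> (conn1 lam) k z - lam powi (int k - 1) * tau n (k - 1) (A1 z))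
        \<le> K * norm (lam powi (int k - 1 - 1))"
      unfolding powers[OF nz] by (rule t[OF lam])
  qed
  show "top_coeff (2 - int k) (\<lambda>lam. hat_mu n D e \<omega> (conn1 lam) (conn2 lam) k z) = m k z"
  proof (rule top_coeffI[where B = B and C = K])
    fix lam :: complex assume lam: "norm lam \<ge> B"
    then have nz: "lam \<noteq> 0" using B by auto
    show "norm (hat_mu n D e \<omega> (conn1 lam) (conn2 lam) k z - lam powi (2 - int k) * m k z)
        \<le> K * norm (lam powi (2 - int k - 1))"
      unfolding powers[OF nz] by (rule mu[OF lam])
  qed
qed

end


section \<open>Consequences of flatness\<close>

lemma tau_index: "A \<in> carrier_mat n n \<Longrightarrow> tau n q A = (\<Sum>i<n - q. A $$ (i, i + q))"
  unfolding tau_def by (rule trace_shift_mult)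

lemma tau_large: "A \<in> carrier_mat n n \<Longrightarrow> n \<le> q \<Longrightarrow> tau n q A = 0"
  by (simp add: tau_index)

lemma mat_deriv_carrier [simp]: "mat_deriv n dd M z \<in> carrier_mat n n"
  by (simp add: mat_deriv_def)

lemma mat_deriv_dims: "dim_row (mat_deriv n dd M z) = n" "dim_col (mat_deriv n dd M z) = n"
  by (simp_all add: mat_deriv_def)

lemma shift_dims:
  "dim_row (shift_mat n q) = n" "dim_col (shift_mat n q) = n"
  "dim_row (shift_poly n a) = n" "dim_col (shift_poly n a) = n"
  by (simp_all add: shift_mat_def shift_poly_def)

context
  fixes n :: nat and D :: "complex set" and M :: "complex \<Rightarrow> complex mat"
  assumes D: "open D" and M: "smooth_mat_on n D M"
begin

lemma smooth_mat_carrier: "w \<in> D \<Longrightarrow> M w \<in> carrier_mat n n"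
  using M by (simp add: smooth_mat_on_def)

lemma smooth_mat_differentiable: "z \<in> D \<Longrightarrow> i < n \<Longrightarrow> j < n \<Longrightarrow> (\<lambda>w. M w $$ (i, j)) differentiable at z"
  using M by (auto simp: smooth_mat_on_def intro: smooth_on_differentiable[of D])

lemma tau_sum_differentiable: "z \<in> D \<Longrightarrow> (\<lambda>w. \<Sum>i<n - q. M w $$ (i, i + q)) differentiable at z"
  by (rule differentiable_sum) (auto intro!: smooth_mat_differentiable)

lemma tau_differentiable:
  assumes "z \<in> D"
  shows "(\<lambda>w. tau n q (M w)) differentiable at z"
  by (rule differentiable_cong_open[OF tau_sum_differentiable[OF assms, of q] D assms])
    (simp add: tau_index smooth_mat_carrier)

lemma derivation_tau:
  assumes "derivation dd" "z \<in> D"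
  shows "dd (\<lambda>w. tau n q (M w)) z = tau n q (mat_deriv n dd M z)"
proof -
  have "dd (\<lambda>w. tau n q (M w)) z = dd (\<lambda>w. \<Sum>i<n - q. M w $$ (i, i + q)) z"
    by (rule derivation_cong_open[OF assms(1) tau_differentiable D assms(2)])
      (simp_all add: assms tau_index smooth_mat_carrier)
  also have "\<dots> = (\<Sum>i<n - q. dd (\<lambda>w. M w $$ (i, i + q)) z)"
    by (intro derivation_sum assms smooth_mat_differentiable) auto
  also have "\<dots> = tau n q (mat_deriv n dd M z)"
    unfolding tau_index[OF mat_deriv_carrier] by (intro sum.cong) (auto simp: mat_deriv_def)
  finally show ?thesis .
qed

end

lemma sum_roots_of_unity:
  fixes f :: "complex \<Rightarrow> complex"
  shows "(\<Sum>t\<in>{1, \<i>, -1, -\<i>}. f t) = f 1 + f \<i> + f (-1) + f (-\<i>)"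
  by (simp add: complex_eq_iff)

text \<open>The sum over the fourth roots of unity extracts the coefficient of \<open>\<lambda> ^ 0\<close>: the exponents that
  occur lie between \<open>- 2\<close> and \<open>2\<close>, and only \<open>0\<close> is divisible by \<open>4\<close>.\<close>
lemma roots_of_unity_average:
  fixes a b c a' b' c' :: complex
  shows "(\<Sum>t\<in>{1, \<i>, -1, -\<i>}. (t * a + b + inverse t * c) * (t * a' + b' + inverse t * c')) =
    4 * (a * c' + b * b' + c * a')"
  unfolding sum_roots_of_unity by (simp add: algebra_simps)

context local_pencil
begin

lemma pencil_product_average:
  assumes M: "F \<in> carrier_mat n n" "A \<in> carrier_mat n n" "P \<in> carrier_mat n n"
      "F' \<in> carrier_mat n n" "A' \<in> carrier_mat n n" "P' \<in> carrier_mat n n" and ij: "i < n" "j < n"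
  shows "(\<Sum>t\<in>{1, \<i>, -1, -\<i>}. ((t \<cdot>\<^sub>m F + A + inverse t \<cdot>\<^sub>m P) * (t \<cdot>\<^sub>m F' + A' + inverse t \<cdot>\<^sub>m P')) $$ (i, j)) =
    4 * (F * P' + A * A' + P * F') $$ (i, j)"
proof -
  have "((t \<cdot>\<^sub>m F + A + inverse t \<cdot>\<^sub>m P) * (t \<cdot>\<^sub>m F' + A' + inverse t \<cdot>\<^sub>m P')) $$ (i, j) =
      (\<Sum>k<n. (t * F $$ (i, k) + A $$ (i, k) + inverse t * P $$ (i, k)) *
        (t * F' $$ (k, j) + A' $$ (k, j) + inverse t * P' $$ (k, j)))" for t :: complex
    using M ij by (subst mat_mult_index[of _ n]) auto
  then have "(\<Sum>t\<in>{1, \<i>, -1, -\<i>}. ((t \<cdot>\<^sub>m F + A + inverse t \<cdot>\<^sub>m P) * (t \<cdot>\<^sub>m F' + A' + inverse t \<cdot>\<^sub>m P')) $$ (i, j)) =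
      (\<Sum>k<n. \<Sum>t\<in>{1, \<i>, -1, -\<i>}. (t * F $$ (i, k) + A $$ (i, k) + inverse t * P $$ (i, k)) *
        (t * F' $$ (k, j) + A' $$ (k, j) + inverse t * P' $$ (k, j)))"
    by (simp only: sum.swap[of _ "{..<n}"])
  also have "\<dots> = 4 * (\<Sum>k<n. F $$ (i, k) * P' $$ (k, j) + A $$ (i, k) * A' $$ (k, j) + P $$ (i, k) * F' $$ (k, j))"
    unfolding roots_of_unity_average by (simp add: sum_distrib_left)
  also have "\<dots> = 4 * (F * P' + A * A' + P * F') $$ (i, j)"
    using M ij by (simp add: sum.distrib mat_mult_index[of _ n] del: index_mult_mat(1))
  finally show ?thesis .
qed

lemma F1_deriv:
  assumes z: "z \<in> D" and dd: "derivation dd"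
  shows "mat_deriv n dd F1 z = 0\<^sub>m n n"
proof (rule eq_matI)
  fix i j assume "i < dim_row (0\<^sub>m n n :: complex mat)" "j < dim_col (0\<^sub>m n n :: complex mat)"
  moreover have "dd (\<lambda>w. F1 w $$ (i, j)) z = dd (\<lambda>w. shift_mat n 1 $$ (i, j)) z"
    by (rule derivation_cong_open[OF dd _ D z, symmetric]) (auto simp: F1)
  ultimately show "mat_deriv n dd F1 z $$ (i, j) = 0\<^sub>m n n $$ (i, j)"
    by (simp add: mat_deriv_def derivation_const[OF dd])
qed (simp_all add: mat_deriv_def)

end

locale flat_pencil = local_pencil +
  assumes m: "\<And>k. k \<in> {2..n} \<Longrightarrow> smooth_on D (m k)"
    and parallel: "\<And>z. z \<in> D \<Longrightarrow> cov_ext_deriv n A1 A2 F1 F2 z = 0\<^sub>m n n"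
    and flat: "\<And>lam z. lam \<noteq> 0 \<Longrightarrow> z \<in> D \<Longrightarrow> curvature n (conn1 lam) (conn2 lam) z = 0\<^sub>m n n"
begin

lemma F2_index_differentiable:
  assumes z: "z \<in> D" and ij: "i < n" "j < n"
  shows "(\<lambda>w. F2 w $$ (i, j)) differentiable at z"
    and "derivation dd \<Longrightarrow> dd (\<lambda>w. F2 w $$ (i, j)) z = shift_poly n (\<lambda>k. dd (m k) z) $$ (i, j)"
proof -
  have F2_eq: "(if j < i then m (i - j + 1) w else 0) = F2 w $$ (i, j)" if "w \<in> D" for w
    using that ij by (simp add: F2 shift_poly_def)
  have m_diff: "m (i - j + 1) differentiable at z" if "j < i"
    using that ij z by (intro smooth_on_differentiable[OF m]) auto
  then have diff: "(\<lambda>w. if j < i then m (i - j + 1) w else 0) differentiable at z"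
    by (cases "j < i") auto
  show "(\<lambda>w. F2 w $$ (i, j)) differentiable at z"
    by (rule differentiable_cong_open[OF diff D z F2_eq])
  assume dd: "derivation dd"
  have "dd (\<lambda>w. F2 w $$ (i, j)) z = dd (\<lambda>w. if j < i then m (i - j + 1) w else 0) z"
    by (rule derivation_cong_open[OF dd diff D z F2_eq, symmetric])
  then show "dd (\<lambda>w. F2 w $$ (i, j)) z = shift_poly n (\<lambda>k. dd (m k) z) $$ (i, j)"
    using ij by (cases "j < i") (auto simp: shift_poly_def derivation_const[OF dd])
qed

text \<open>\<open>d\<^sub>A \<Phi> = 0\<close>, solved for \<open>[A\<^sub>2, N]\<close>. The matrix \<open>N\<close> is constant, so only \<open>\<Phi>\<^sub>2\<close> is differentiated.\<close>
lemma order_one_equation: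
  assumes z: "z \<in> D"
  shows "A2 z * shift_mat n 1 - shift_mat n 1 * A2 z =
    shift_poly n (\<lambda>k. d_z (m k) z) + (A1 z * shift_poly n (\<lambda>k. m k z) - shift_poly n (\<lambda>k. m k z) * A1 z)"
proof (rule eq_matI)
  let ?N = "shift_mat n 1" and ?F = "shift_poly n (\<lambda>k. m k z)" and ?dF = "shift_poly n (\<lambda>k. d_z (m k) z)"
  note carr = carrier[OF z]
  fix i j assume "i < dim_row (?dF + (A1 z * ?F - ?F * A1 z))" "j < dim_col (?dF + (A1 z * ?F - ?F * A1 z))"
  then have ij: "i < n" "j < n" using carr by (simp_all add: shift_poly_def)
  have "mat_deriv n d_z F2 z = ?dF"
    by (rule eq_matI) (auto simp: mat_deriv_def F2_index_differentiable(2)[OF z _ _ derivation_d_z] shift_poly_def)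
  moreover have "?dF - 0\<^sub>m n n = ?dF" by (rule eq_matI) (auto simp: shift_poly_def)
  ultimately have "?dF + (A1 z * ?F - ?F * A1 z) - (A2 z * ?N - ?N * A2 z) = 0\<^sub>m n n"
    using parallel[OF z] carr unfolding cov_ext_deriv_def F1_deriv[OF z derivation_d_zbar]
    by (simp add: F1[OF z] F2[OF z])
  then have "(?dF + (A1 z * ?F - ?F * A1 z) - (A2 z * ?N - ?N * A2 z)) $$ (i, j) = 0"
    using ij by simp
  then show "(A2 z * ?N - ?N * A2 z) $$ (i, j) = (?dF + (A1 z * ?F - ?F * A1 z)) $$ (i, j)"
    using carr ij by (simp add: shift_mat_def shift_poly_def)
qed (use carrier[OF z] in \<open>simp_all add: shift_mat_def shift_poly_def\<close>)

text \<open>The coefficient of \<open>\<lambda> ^ 0\<close> in the curvature of the pencil.\<close>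
lemma order_zero_equation:
  assumes z: "z \<in> D"
  shows "mat_deriv n d_z A2 z - mat_deriv n d_zbar A1 z + (A1 z * A2 z - A2 z * A1 z)
    + (shift_mat n 1 * P2 z - P2 z * shift_mat n 1)
    + (P1 z * shift_poly n (\<lambda>k. m k z) - shift_poly n (\<lambda>k. m k z) * P1 z) = 0\<^sub>m n n"
    (is "?lhs = _")
proof (rule eq_matI)
  let ?N = "shift_mat n 1" and ?F = "shift_poly n (\<lambda>k. m k z)"
  note carr = carrier[OF z]
  fix i j assume "i < dim_row (0\<^sub>m n n :: complex mat)" "j < dim_col (0\<^sub>m n n :: complex mat)"
  then have ij: "i < n" "j < n" by simp_all
  have deriv: "mat_deriv n dd (pencil F A P t) z $$ (i, j) =
      t * mat_deriv n dd F z $$ (i, j) + mat_deriv n dd A z $$ (i, j) + inverse t * mat_deriv n dd P z $$ (i, j)"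
    if dd: "derivation dd" and F: "\<And>w. w \<in> D \<Longrightarrow> F w \<in> carrier_mat n n" "(\<lambda>w. F w $$ (i, j)) differentiable at z"
      and A: "smooth_mat_on n D A" and P: "smooth_mat_on n D P" for dd F A P t
  proof -
    have diff: "(\<lambda>w. A w $$ (i, j)) differentiable at z" "(\<lambda>w. P w $$ (i, j)) differentiable at z"
      using smooth_mat_differentiable[OF D A z ij] smooth_mat_differentiable[OF D P z ij] .
    have sum: "(\<lambda>w. t * F w $$ (i, j) + A w $$ (i, j) + inverse t * P w $$ (i, j)) differentiable at z"
      using diff F(2) by simp
    have "dd (\<lambda>w. pencil F A P t w $$ (i, j)) z =
        dd (\<lambda>w. t * F w $$ (i, j) + A w $$ (i, j) + inverse t * P w $$ (i, j)) z"
    proof (rule derivation_cong_open[OF dd sum D z, symmetric])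
      fix w assume w: "w \<in> D"
      show "t * F w $$ (i, j) + A w $$ (i, j) + inverse t * P w $$ (i, j) = pencil F A P t w $$ (i, j)"
        using F(1)[OF w] smooth_mat_carrier[OF D A w] smooth_mat_carrier[OF D P w] ij
        by (simp add: pencil_def)
    qed
    then show ?thesis
      using diff F(2) ij by (simp add: mat_deriv_def derivation_add[OF dd] derivation_cmult[OF dd])
  qed
  have F1_diff: "(\<lambda>w. F1 w $$ (i, j)) differentiable at z"
    by (rule differentiable_cong_open[OF _ D z, of "\<lambda>w. shift_mat n 1 $$ (i, j)"]) (auto simp: F1)
  have d2: "mat_deriv n d_z (conn2 t) z $$ (i, j) = t * mat_deriv n d_z F2 z $$ (i, j)
      + mat_deriv n d_z A2 z $$ (i, j) + inverse t * mat_deriv n d_z P2 z $$ (i, j)" for t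
    by (rule deriv[OF derivation_d_z _ F2_index_differentiable(1)[OF z ij] A2 P2]) (rule carrier(2))
  have d1: "mat_deriv n d_zbar (conn1 t) z $$ (i, j) = t * mat_deriv n d_zbar F1 z $$ (i, j)
      + mat_deriv n d_zbar A1 z $$ (i, j) + inverse t * mat_deriv n d_zbar P1 z $$ (i, j)" for t
    by (rule deriv[OF derivation_d_zbar _ F1_diff A1 P1]) (rule carrier(1))
  let ?T = "{1, \<i>, -1, -\<i>} :: complex set"
  have "0 = (\<Sum>t\<in>?T. curvature n (conn1 t) (conn2 t) z $$ (i, j))"
    unfolding sum_roots_of_unity using flat[OF _ z] ij by simp
  also have "\<dots> = (\<Sum>t\<in>?T. mat_deriv n d_z (conn2 t) z $$ (i, j) - mat_deriv n d_zbar (conn1 t) z $$ (i, j)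
      + ((conn1 t z * conn2 t z) $$ (i, j) - (conn2 t z * conn1 t z) $$ (i, j)))"
  proof (intro sum.cong refl)
    fix t
    show "curvature n (conn1 t) (conn2 t) z $$ (i, j) =
        mat_deriv n d_z (conn2 t) z $$ (i, j) - mat_deriv n d_zbar (conn1 t) z $$ (i, j)
        + ((conn1 t z * conn2 t z) $$ (i, j) - (conn2 t z * conn1 t z) $$ (i, j))"
      using conn1_carrier[OF z, of t] conn2_carrier[OF z, of t] ij
      by (simp add: curvature_def mat_deriv_def del: index_mult_mat(1))
  qed
  also have "\<dots> = (\<Sum>t\<in>?T. mat_deriv n d_z (conn2 t) z $$ (i, j)) - (\<Sum>t\<in>?T. mat_deriv n d_zbar (conn1 t) z $$ (i, j))
      + ((\<Sum>t\<in>?T. (conn1 t z * conn2 t z) $$ (i, j)) - (\<Sum>t\<in>?T. (conn2 t z * conn1 t z) $$ (i, j)))"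
    by (simp only: sum.distrib sum_subtractf)
  also have "(\<Sum>t\<in>?T. mat_deriv n d_z (conn2 t) z $$ (i, j)) = 4 * mat_deriv n d_z A2 z $$ (i, j)"
    unfolding sum_roots_of_unity d2 by simp
  also have "(\<Sum>t\<in>?T. mat_deriv n d_zbar (conn1 t) z $$ (i, j)) = 4 * mat_deriv n d_zbar A1 z $$ (i, j)"
    unfolding sum_roots_of_unity d1 by simp
  also have "(\<Sum>t\<in>?T. (conn1 t z * conn2 t z) $$ (i, j)) =
      4 * (F1 z * P2 z + A1 z * A2 z + P1 z * F2 z) $$ (i, j)"
    unfolding pencil_def by (rule pencil_product_average[OF carr(1,3,5,2,4,6) ij])
  also have "(\<Sum>t\<in>?T. (conn2 t z * conn1 t z) $$ (i, j)) =
      4 * (F2 z * P1 z + A2 z * A1 z + P2 z * F1 z) $$ (i, j)"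
    unfolding pencil_def by (rule pencil_product_average[OF carr(2,4,6,1,3,5) ij])
  finally have "4 * ?lhs $$ (i, j) = 0"
    using carr ij
    by (simp add: F1[OF z] F2[OF z] shift_dims mat_deriv_dims distrib_left right_diff_distrib
        del: index_mult_mat(1)) (simp add: algebra_simps)
  then have "?lhs $$ (i, j) = 0" by simp
  then show "?lhs $$ (i, j) = 0\<^sub>m n n $$ (i, j)" using ij by simp
qed (use carrier[OF z] in \<open>simp_all add: shift_mat_def shift_poly_def\<close>)

text \<open>In the trace of the order zero equation against \<open>N ^ q\<close>, the matrix \<open>N ^ q\<close> is constant, so the
  derivative of \<open>A\<^sub>2\<close> becomes the derivative of its trace, and \<open>tau_second_component\<close> can be
  differentiated as an identity of functions on \<open>D\<close>.\<close>
lemma tau_equation: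
  assumes z: "z \<in> D" and q: "q > 0"
  shows "d_zbar (\<lambda>w. tau n q (A1 w)) z =
    (\<Sum>j=2..n. of_nat (j - 1 + q) * d_z (m j) z * tau n (q + j - 2) (A1 z)
      + of_nat (j - 1) * m j z * d_z (\<lambda>w. tau n (q + j - 2) (A1 w)) z)"
proof -
  let ?t = "\<lambda>p w. tau n p (A1 w)"
  have t_diff: "?t p differentiable at z" for p by (rule tau_differentiable[OF D A1 z])
  have m_diff: "m j differentiable at z" if "j \<in> {2..n}" for j
    using smooth_on_differentiable[OF m[OF that] z] .
  have summand: "(\<lambda>w. of_nat (j - 1) * m j w * ?t (q + j - 2) w) differentiable at z" if "j \<in> {2..n}" for j
    using m_diff[OF that] t_diff by (intro differentiable_mult differentiable_const)
  have "d_zbar (?t q) z = tau n q (mat_deriv n d_zbar A1 z)"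
    by (rule derivation_tau[OF D A1 derivation_d_zbar z])
  also have "\<dots> = tau n q (mat_deriv n d_z A2 z) + of_nat q * (\<Sum>j=2..n. d_z (m j) z * ?t (q + j - 2) z)"
    by (rule tau_dbar[OF carrier(3-6)[OF z] mat_deriv_carrier mat_deriv_carrier q
          order_one_equation[OF z] order_zero_equation[OF z]])
  also have "tau n q (mat_deriv n d_z A2 z) = d_z (\<lambda>w. tau n q (A2 w)) z"
    by (rule derivation_tau[OF D A2 derivation_d_z z, symmetric])
  also have "\<dots> = d_z (\<lambda>w. \<Sum>j=2..n. of_nat (j - 1) * m j w * ?t (q + j - 2) w) z"
    by (rule derivation_cong_open[OF derivation_d_z tau_differentiable[OF D A2 z] D z])
      (rule tau_second_component[OF carrier(3,4) q order_one_equation])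
  also have "\<dots> = (\<Sum>j=2..n. d_z (\<lambda>w. of_nat (j - 1) * m j w * ?t (q + j - 2) w) z)"
    by (rule derivation_sum[OF derivation_d_z summand])
  also have "\<dots> = (\<Sum>j=2..n. of_nat (j - 1) * d_z (m j) z * ?t (q + j - 2) z
      + of_nat (j - 1) * m j z * d_z (?t (q + j - 2)) z)"
  proof (intro sum.cong refl)
    fix j assume j: "j \<in> {2..n}"
    have "(\<lambda>w. of_nat (j - 1) * m j w) differentiable at z" using m_diff[OF j] by simp
    from derivation_mult[OF derivation_d_z this t_diff[of "q + j - 2"]] derivation_cmult[OF derivation_d_z m_diff[OF j], of "of_nat (j - 1)"]
    show "d_z (\<lambda>w. of_nat (j - 1) * m j w * ?t (q + j - 2) w) z = of_nat (j - 1) * d_z (m j) z * ?t (q + j - 2) z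
      + of_nat (j - 1) * m j z * d_z (?t (q + j - 2)) z" by simp
  qed
  also have "\<dots> + of_nat q * (\<Sum>j=2..n. d_z (m j) z * ?t (q + j - 2) z) =
    (\<Sum>j=2..n. of_nat (j - 1 + q) * d_z (m j) z * ?t (q + j - 2) z
      + of_nat (j - 1) * m j z * d_z (?t (q + j - 2)) z)"
    unfolding sum_distrib_left sum.distrib[symmetric] by (intro sum.cong refl) (simp add: algebra_simps)
  finally show ?thesis .
qed

lemma mu_holomorphic_tau: "mu_holomorphic n D m (\<lambda>k w. tau n (k - 1) (A1 w))"
  unfolding mu_holomorphic_def
proof (intro ballI conjI)
  fix k z assume k: "k \<in> {2..n}" and z: "z \<in> D"
  show "m k differentiable at z" by (rule smooth_on_differentiable[OF m[OF k] z])
  show "(\<lambda>w. tau n (k - 1) (A1 w)) differentiable at z" by (rule tau_differentiable[OF D A1 z])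
  let ?t = "\<lambda>p w. tau n p (A1 w)"
  define g where "g l = of_nat (l + k) * d_z (m (l + 2)) z * ?t (k + l - 1) z
    + of_nat (l + 1) * m (l + 2) z * d_z (?t (k + l - 1)) z" for l
  have t0: "?t p z = 0" "d_z (?t p) z = 0" if "n \<le> p" for p
  proof -
    have "d_z (?t p) z = d_z (\<lambda>w. 0) z"
      by (rule derivation_cong_open[OF derivation_d_z tau_differentiable[OF D A1 z] D z])
        (simp add: tau_large carrier that)
    then show "d_z (?t p) z = 0" by (simp add: derivation_const[OF derivation_d_z])
  qed (simp add: tau_large carrier z that)
  have "d_zbar (?t (k - 1)) z = (\<Sum>j=2..n. of_nat (j - 1 + (k - 1)) * d_z (m j) z * ?t (k - 1 + j - 2) z
      + of_nat (j - 1) * m j z * d_z (?t (k - 1 + j - 2)) z)"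
    using k by (intro tau_equation z) auto
  also have "\<dots> = (\<Sum>j=2..n. g (j - 2))"
  proof (intro sum.cong refl)
    fix j assume "j \<in> {2..n}"
    then have "j - 2 + k = j - 1 + (k - 1)" "j - 2 + 2 = j" "k + (j - 2) - 1 = k - 1 + j - 2" "j - 2 + 1 = j - 1"
      using k by auto
    then show "of_nat (j - 1 + (k - 1)) * d_z (m j) z * ?t (k - 1 + j - 2) z
      + of_nat (j - 1) * m j z * d_z (?t (k - 1 + j - 2)) z = g (j - 2)"
      unfolding g_def by (simp only:)
  qed
  also have "{2..n} = {0 + 2..n - 2 + 2}" using n by (simp del: add_2_eq_Suc')
  also have "(\<Sum>j=0 + 2..n - 2 + 2. g (j - 2)) = (\<Sum>l=0..n - 2. g (l + 2 - 2))"
    by (rule sum.shift_bounds_cl_nat_ivl)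
  also have "\<dots> = (\<Sum>l=0..n - 2. g l)" by simp
  \<comment> \<open>the traces against \<open>N ^ p\<close> with \<open>p \<ge> n\<close> vanish, which truncates the sum\<close>
  also have "\<dots> = (\<Sum>l=0..n - k. g l)"
    using k by (intro sum.mono_neutral_right) (auto simp: g_def t0)
  also have "\<dots> = g 0 + (\<Sum>l=1..n - k. g l)"
    by (subst sum.atLeast_Suc_atMost) auto
  finally show "- d_zbar (?t (k - 1)) z + m 2 z * d_z (?t (k - 1)) z + of_nat k * d_z (m 2) z * ?t (k - 1) z
    + (\<Sum>l = 1..n - k. of_nat (l + k) * d_z (m (l + 2)) z * ?t (k + l - 1) z
        + of_nat (l + 1) * m (l + 2) z * d_z (?t (k + l - 1)) z) = 0"
    by (simp add: g_def numeral_2_eq_2)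
qed

end

lemma mu_holomorphic_cong:
  assumes D: "open D" and hol: "mu_holomorphic n D \<mu> t"
    and eq: "\<And>k z. k \<in> {2..n} \<Longrightarrow> z \<in> D \<Longrightarrow> \<mu>' k z = \<mu> k z" "\<And>k z. k \<in> {2..n} \<Longrightarrow> z \<in> D \<Longrightarrow> t' k z = t k z"
  shows "mu_holomorphic n D \<mu>' t'"
  unfolding mu_holomorphic_def
proof (intro ballI)
  fix k z assume k: "k \<in> {2..n}" and z: "z \<in> D"
  have \<mu>: "\<mu> j differentiable at z" and t: "t j differentiable at z" if "j \<in> {2..n}" for j
    using hol that z unfolding mu_holomorphic_def by blast+
  have \<mu>': "\<mu>' j differentiable at z" and t': "t' j differentiable at z" if j: "j \<in> {2..n}" for j
    using eq(1)[OF j] eq(2)[OF j]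
    by (auto intro: differentiable_cong_open[OF \<mu>[OF j] D z] differentiable_cong_open[OF t[OF j] D z])
  have d: "dd (\<mu>' j) z = dd (\<mu> j) z" "dd (t' j) z = dd (t j) z" if j: "j \<in> {2..n}" and dd: "derivation dd" for dd j
    using eq(1)[OF j] eq(2)[OF j]
    by (auto intro!: derivation_cong_open[OF dd _ D z] \<mu>'[OF j] t'[OF j])
  have "(\<Sum>l = 1..n - k. of_nat (l + k) * d_z (\<mu>' (l + 2)) z * t' (k + l) z + of_nat (l + 1) * \<mu>' (l + 2) z * d_z (t' (k + l)) z) =
    (\<Sum>l = 1..n - k. of_nat (l + k) * d_z (\<mu> (l + 2)) z * t (k + l) z + of_nat (l + 1) * \<mu> (l + 2) z * d_z (t (k + l)) z)"
  proof (intro sum.cong refl)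
    fix l assume "l \<in> {1..n - k}"
    then have "l + 2 \<in> {2..n}" "k + l \<in> {2..n}" using k by auto
    then show "of_nat (l + k) * d_z (\<mu>' (l + 2)) z * t' (k + l) z + of_nat (l + 1) * \<mu>' (l + 2) z * d_z (t' (k + l)) z =
      of_nat (l + k) * d_z (\<mu> (l + 2)) z * t (k + l) z + of_nat (l + 1) * \<mu> (l + 2) z * d_z (t (k + l)) z"
      by (simp add: d derivation_d_z eq z)
  qed
  moreover have "2 \<in> {2..n}" using k by auto
  ultimately show "\<mu>' k differentiable at z \<and> t' k differentiable at z \<and>
     (- d_zbar (t' k) z + \<mu>' 2 z * d_z (t' k) z + of_nat k * d_z (\<mu>' 2) z * t' k z) +
     (\<Sum>l = 1..n - k. of_nat (l + k) * d_z (\<mu>' (l + 2)) z * t' (k + l) z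
                     + of_nat (l + 1) * \<mu>' (l + 2) z * d_z (t' (k + l)) z) = 0"
    using hol k z \<mu>'[OF k] t'[OF k]
    unfolding mu_holomorphic_def by (simp add: d derivation_d_z derivation_d_zbar eq)
qed

theorem theorem1:
  fixes X :: "'a topology" and \<A> :: "'a chart set" and g n :: nat
    and I :: "'a chart \<Rightarrow> complex \<Rightarrow> cpoly2 set"
    and \<kappa> :: "'a chart \<Rightarrow> 'a chart \<Rightarrow> complex \<Rightarrow> complex"
    and \<omega> :: "'a chart \<Rightarrow> complex \<Rightarrow> complex"
    and A1 A2 \<Psi>1 \<Psi>2 :: "'a chart \<Rightarrow> complex \<Rightarrow> complex mat"
  defines "\<C> \<equiv> bundle_charts X \<A> n I"
    and "G \<equiv> bundle_transition n I \<kappa>"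
  assumes surface: "closed_oriented_surface X \<A>" "has_genus X g" "g \<ge> 2"
    and hcs: "higher_complex_structure X \<A> n I"
    and root: "sqrt_canonical \<C> \<kappa>"
    and volume: "volume_form \<C> G \<omega>"
    and connection: "sl_connection n \<C> G \<omega> A1 A2"
    and parallel: "\<forall>c\<in>\<C>. \<forall>z\<in>img c.
      cov_ext_deriv n (A1 c) (A2 c) (\<Phi>1 n (I c)) (\<Phi>2 n (I c)) z = 0\<^sub>m n n"
    and form: "sl_one_form n \<C> G \<Psi>1 \<Psi>2"
    and flat: "\<forall>lam. lam \<noteq> 0 \<longrightarrow> (\<forall>c\<in>\<C>. \<forall>z\<in>img c.
      curvature n (pencil (\<Phi>1 n (I c)) (A1 c) (\<Psi>1 c) lam)
        (pencil (\<Phi>2 n (I c)) (A2 c) (\<Psi>2 c) lam) z = 0\<^sub>m n n)"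
  shows "\<forall>c\<in>\<C>. mu_holomorphic n (img c)
    (mu_tensor n I \<omega> A1 A2 \<Psi>1 \<Psi>2 c) (t_tensor n I \<omega> A1 \<Psi>1 c)"
proof (cases "n \<ge> 2")
  case False
  then show ?thesis by (simp add: mu_holomorphic_def)
next
  case n: True
  show ?thesis
  proof
    fix c assume c: "c \<in> \<C>"
    then have chart: "c \<in> oriented_charts X \<A>"
      by (simp add: \<C>_def bundle_charts_def induced_charts_def)
    then have open_img: "open (img c)" by (simp add: oriented_charts_def is_chart_def)
    obtain m where m: "\<forall>k\<in>{2..n}. smooth_on (img c) (m k)"
      and I: "\<forall>z\<in>img c. I c z = normal_form n (\<lambda>k. m k z)"
      using conjunct2[OF bspec[OF conjunct1[OF hcs[unfolded higher_complex_structure_def]] chart]]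
      by blast
    interpret flat_pencil n "img c" "unit_section n (I c)" "\<omega> c" m "\<Phi>1 n (I c)" "\<Phi>2 n (I c)"
      "A1 c" "A2 c" "\<Psi>1 c" "\<Psi>2 c"
    proof unfold_locales
      show "unit_section n (I c) w = unit_vec n 0" if "w \<in> img c" for w
        using I that n by (simp add: unit_section_def coords_one)
      show "\<Phi>1 n (I c) w = shift_mat n 1" if "w \<in> img c" for w
        using I that by (simp add: \<Phi>1_def mult_mat_p_var shift_mat_def)
      show "\<Phi>2 n (I c) w = shift_poly n (\<lambda>k. m k w)" if "w \<in> img c" for w
        using I that by (simp add: \<Phi>2_def mult_mat_pbar_var shift_poly_def)
      show "smooth_on (img c) (\<omega> c)" using volume c by (auto simp: volume_form_def)
      show "\<omega> c w \<noteq> 0" if "w \<in> img c" for w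
        using volume c that by (auto simp: volume_form_def)
    qed (use n open_img m connection form parallel flat volume c in
        \<open>auto simp: sl_connection_def sl_one_form_def volume_form_def\<close>)
    show "mu_holomorphic n (img c) (mu_tensor n I \<omega> A1 A2 \<Psi>1 \<Psi>2 c) (t_tensor n I \<omega> A1 \<Psi>1 c)"
      by (rule mu_holomorphic_cong[OF open_img mu_holomorphic_tau])
        (simp_all only: mu_tensor_def t_tensor_def top_coeff_parameters)
  qed
qed

end
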